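(* Let $\kappa$ be strongly inaccessible and $d\in\omega$, and suppose $HL^{tc}(d,<\kappa,\kappa)$ holds. Then for every $\delta<\kappa$ and every $f:\mathbb{Q}_\kappa^{d+1}\to\delta$ there exist $X_0,\dots,X_d\subseteq\mathbb{Q}_\kappa$, each of order type $\eta_\kappa$, such that $|f''\prod_{j\le d}X_j|\le(d+1)!$.
   Context: A linear order is $\kappa$-saturated if for any $A<B$ with $|A|,|B|<\kappa$ there is $c$ with $A<c<B$; since $\kappa^{<\kappa}=\kappa$, there is a unique such order of size $\kappa$ up to isomorphism, $\mathbb{Q}_\kappa$, with order type $\eta_\kappa$. Tree notions: $ht_T(t)$ order type of predecessors; $T(\alpha)$ level $\alpha$; $Succ_T(t)$ immediate successors. A nice tree: unique root; heights $<\kappa$ unbounded in $\kappa$, levels of size $<\kappa$; every maximal path of order type $\kappa$, at limit levels nodes with the same predecessors coincide; every node has two incomparable extensions. $T'\subseteq T$ is a strong subtree with witnessing level set $A\in[\kappa]^\kappa$ (increasing enumeration $\langle a_\xi\rangle$) if $T'$ is nice, $T'(\xi)\subseteq T(a_\xi)$, and each immediate successor in $T$ of a node of $T'(\xi)$ has exactly one extension in $T'(\xi+1)$. For $\bar u\in\prod_jT'_j(\xi)$ and $\zeta\le\xi$, $\bar u\restriction'\zeta$ is the tuple of $T'_j$-predecessors of height $\zeta$. $HL^{tc}(d,<\kappa,\kappa)$: for any $\langle\delta_l<\kappa:l<\kappa\rangle$, any nice trees $\langle S_j:j<d\rangle$ and colorings $g_l:\prod_{j<d}S_j\to\delta_l$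 ($l<\kappa$), there exist strong subtrees $S'_j\subseteq S_j$ sharing a witnessing level set such that for all $l<\kappa$, $\xi\ge l+1$ and $\bar u\in\prod_{j<d}S'_j(\xi)$, $g_l(\bar u)=g_l(\bar u\restriction'(l+1))$. *)

theory Defs
  imports Main "HOL-Library.FuncSet"
begin

unbundle cardinal_syntax

text \<open>
  The cardinal \<open>\<kappa>\<close> is a well-ordered type \<open>'k\<close> whose order is assumed to be an initial ordinal
  (\<open>Card_order\<close>, inside \<open>strongly_inaccessible\<close>). The elements of \<open>'k\<close> are the ordinals below
  \<open>\<kappa>\<close>; \<open>kappa\<close> is the same order as a relation, as the cardinal library expects it.
\<close>

definition kappa :: "'k::wellorder rel" where
  "kappa = {(a, b). a \<le> b}"

definition strongly_inaccessible :: "'a rel \<Rightarrow> bool" where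
  "strongly_inaccessible r \<longleftrightarrow>
     Card_order r \<and> natLeq <o r \<and> regularCard r \<and>
     (\<forall>A \<subseteq> Field r. |A| <o r \<longrightarrow> |Pow A| <o r)"

definition osuc :: "'k::wellorder \<Rightarrow> 'k" where
  "osuc \<alpha> = (LEAST \<beta>. \<alpha> < \<beta>)"

definition is_limit :: "'k::wellorder \<Rightarrow> bool" where
  "is_limit \<alpha> \<longleftrightarrow> (\<exists>\<beta>. \<beta> < \<alpha>) \<and> (\<forall>\<beta><\<alpha>. \<exists>\<gamma><\<alpha>. \<beta> < \<gamma>)"

text \<open>
  A tree is a reflexive partial order \<open>T\<close> whose set of nodes is \<open>Field T\<close>.
\<close>

definition tree :: "'a rel \<Rightarrow> bool" where
  "tree T \<longleftrightarrow> Partial_order T \<and> (\<forall>t \<in> Field T. Well_order (Restr T (underS T t)))"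

definition has_height :: "'a rel \<Rightarrow> 'a \<Rightarrow> 'k::wellorder \<Rightarrow> bool" where
  "has_height T t \<alpha> \<longleftrightarrow> Restr T (underS T t) =o Restr (kappa :: 'k rel) {..<\<alpha>}"

definition level :: "'a rel \<Rightarrow> 'k::wellorder \<Rightarrow> 'a set" where
  "level T \<alpha> = {t \<in> Field T. has_height T t \<alpha>}"

definition Succ :: "'a rel \<Rightarrow> 'a \<Rightarrow> 'a set" where
  "Succ T t = {s. t \<in> underS T s \<and> \<not> (\<exists>u. t \<in> underS T u \<and> u \<in> underS T s)}"

definition maximal_path :: "'a rel \<Rightarrow> 'a set \<Rightarrow> bool" where
  "maximal_path T b \<longleftrightarrow> b \<in> Chains T \<and> (\<forall>c \<in> Chains T. b \<subseteq> c \<longrightarrow> c = b)"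

definition nice_tree :: "'k::wellorder itself \<Rightarrow> 'a rel \<Rightarrow> bool" where
  "nice_tree K T \<longleftrightarrow>
     tree T \<and>
     (\<exists>!t. t \<in> Field T \<and> underS T t = {}) \<and>
     (\<forall>t \<in> Field T. \<exists>\<alpha>::'k. has_height T t \<alpha>) \<and>
     (\<forall>\<alpha>::'k. \<exists>\<beta>\<ge>\<alpha>. level T \<beta> \<noteq> {}) \<and>
     (\<forall>\<alpha>::'k. |level T \<alpha>| <o (kappa :: 'k rel)) \<and>
     (\<forall>b. maximal_path T b \<longrightarrow> Restr T b =o (kappa :: 'k rel)) \<and>
     (\<forall>\<alpha>::'k. is_limit \<alpha> \<longrightarrow>
        (\<forall>s \<in> level T \<alpha>. \<forall>t \<in> level T \<alpha>. underS T s = underS T t \<longrightarrow> s = t)) \<and>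
     (\<forall>t \<in> Field T. \<exists>u v. (t, u) \<in> T \<and> (t, v) \<in> T \<and> (u, v) \<notin> T \<and> (v, u) \<notin> T)"

text \<open>
  The function \<open>a\<close> is the increasing enumeration of the level set \<open>A\<close>. Extensions are
  non-strict: an immediate successor that itself lies in \<open>T'\<close> extends itself.
\<close>

definition strong_subtree :: "'a rel \<Rightarrow> 'a rel \<Rightarrow> 'k::wellorder set \<Rightarrow> bool" where
  "strong_subtree T' T A \<longleftrightarrow>
     Field T' \<subseteq> Field T \<and> T' = Restr T (Field T') \<and>
     nice_tree TYPE('k) T' \<and>
     |A| =o (kappa :: 'k rel) \<and>
     (\<exists>a :: 'k \<Rightarrow> 'k. strict_mono a \<and> range a = A \<and>
        (\<forall>\<xi>. level T' \<xi> \<subseteq> level T (a \<xi>) \<and>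
             (\<forall>t \<in> level T' \<xi>. \<forall>s \<in> Succ T t. \<exists>!u. u \<in> level T' (osuc \<xi>) \<and> (s, u) \<in> T)))"

text \<open>
  Tuples \<open>\<langle>u\<^sub>j : j < d\<rangle>\<close> are extensional functions on \<open>{..<d}\<close>. The restriction of \<open>u\<close> to height
  \<open>\<zeta>\<close> is taken in the trees \<open>T j\<close>; if \<open>\<zeta>\<close> is the height of \<open>u j\<close>, it is \<open>u j\<close> itself.
\<close>

definition restrict_tuple ::
    "nat \<Rightarrow> (nat \<Rightarrow> 'a rel) \<Rightarrow> (nat \<Rightarrow> 'a) \<Rightarrow> 'k::wellorder \<Rightarrow> nat \<Rightarrow> 'a" where
  "restrict_tuple d T u \<zeta> = (\<lambda>j\<in>{..<d}. THE s. s \<in> level (T j) \<zeta> \<and> (s, u j) \<in> T j)"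

text \<open>
  \<open>HL_tc TYPE('k) d\<close> is \<open>HL\<^sup>t\<^sup>c(d, <\<kappa>, \<kappa>)\<close>. Nice trees are quantified with nodes in \<open>'k\<close>. For regular
  \<open>\<kappa>\<close> this is no restriction up to isomorphism, since a nice tree has \<open>\<kappa>\<close> levels, each of
  size less than \<open>\<kappa>\<close>, and hence exactly \<open>\<kappa>\<close> nodes.
\<close>

definition HL_tc :: "'k::wellorder itself \<Rightarrow> nat \<Rightarrow> bool" where
  "HL_tc K d \<longleftrightarrow>
     (\<forall>(\<delta> :: 'k \<Rightarrow> 'k) (S :: nat \<Rightarrow> 'k rel) (g :: 'k \<Rightarrow> (nat \<Rightarrow> 'k) \<Rightarrow> 'k).
        (\<forall>j<d. nice_tree TYPE('k) (S j)) \<longrightarrow>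
        (\<forall>l. g l \<in> (\<Pi>\<^sub>E j\<in>{..<d}. Field (S j)) \<rightarrow> {..<\<delta> l}) \<longrightarrow>
        (\<exists>(S' :: nat \<Rightarrow> 'k rel) (A :: 'k set).
           (\<forall>j<d. strong_subtree (S' j) (S j) A) \<and>
           (\<forall>l \<xi>. osuc l \<le> \<xi> \<longrightarrow>
              (\<forall>u \<in> (\<Pi>\<^sub>E j\<in>{..<d}. level (S' j) \<xi>).
                 g l u = g l (restrict_tuple d S' u (osuc l))))))"

definition saturated :: "'k rel \<Rightarrow> 'q::linorder set \<Rightarrow> bool" where
  "saturated r Q \<longleftrightarrow>
     (\<forall>A B. A \<subseteq> Q \<longrightarrow> B \<subseteq> Q \<longrightarrow> |A| <o r \<longrightarrow> |B| <o r \<longrightarrow> (\<forall>a\<in>A. \<forall>b\<in>B. a < b) \<longrightarrow>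
        (\<exists>c\<in>Q. (\<forall>a\<in>A. a < c) \<and> (\<forall>b\<in>B. c < b)))"

text \<open>
  \<open>is_Q_kappa r Q\<close>: the set \<open>Q\<close> with the induced order is (a copy of) \<open>\<rat>\<^sub>\<kappa>\<close>, the linear order that
  is unique up to isomorphism among the saturated ones of size \<open>\<kappa>\<close>. A set has order type
  \<open>\<eta>\<^sub>\<kappa>\<close> if it has the same order type as \<open>\<rat>\<^sub>\<kappa>\<close>.
\<close>

definition is_Q_kappa :: "'k rel \<Rightarrow> 'q::linorder set \<Rightarrow> bool" where
  "is_Q_kappa r Q \<longleftrightarrow> saturated r Q \<and> |Q| =o r"

definition same_order_type :: "'q::linorder set \<Rightarrow> 'p::linorder set \<Rightarrow> bool" where
  "same_order_type X Y \<longleftrightarrow> (\<exists>h. strict_mono_on X h \<and> h ` X = Y)"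

end

theory Submission
  imports Defs "HOL-Combinatorics.Permutations"
begin

text \<open>
  Enumerate the order by the ordinals below \<open>\<kappa>\<close>. This makes \<open>\<rat>\<^sub>\<kappa>\<close> itself a binary nice tree, and
  every subtree in which each node branches to the left and to the right contains copies of \<open>\<rat>\<^sub>\<kappa>\<close>.
  The colour of a tuple is controlled separately for each of the \<open>(d + 1)!\<close> orders in which its
  coordinates can be enumerated; say the order is \<open>x\<^sub>0, \<dots>, x\<^sub>d\<close>. Applying the tail cone
  property \<open>d\<close> times, from the last coordinate down, makes the colour of the tuple depend
  only on \<open>x\<^sub>0\<close> and on the predecessors of \<open>x\<^sub>1, \<dots>, x\<^sub>d\<close> just above \<open>x\<^sub>0\<close>. A last
  application shows that some colour \<open>c\<close> is dense: above some node, every set of nodes of one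
  level in the \<open>d\<close> trees can be extended, together with a point \<open>x\<^sub>0\<close>, so that all the resulting
  tuples get colour \<open>c\<close>. The copies are then built by a transfinite recursion that places
  one point at each stage.
\<close>

section \<open>Ordinals below an inaccessible cardinal\<close>

text \<open>\<open>HL_tc\<close> compares only tuples that lie on one common level, while a product
  of copies contains tuples whose points lie on many levels. This is why the coordinates are turned
  into points one at a time: the points already placed act as parameters, and the others are still
  generic nodes on a common level. By inaccessibility there are fewer than \<kappa> parameter tuples
  of level at most \<open>l\<close>, and fewer than \<kappa> ways to colour them, so the single
  colouring \<open>g l\<close> can record the colours for all these parameters. The lowest point is
  found by density instead of homogeneity, so it needs no tree of its own and \<open>d\<close> trees
  serve \<open>d + 1\<close> coordinates. Ties between coordinates are excluded by an enumeration
  \<open>e\<close> that is injective on all points of all coordinates together. The orders of the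
  coordinates are treated one after another by composing embeddings. A later embedding must not
  change the order type of a tuple treated earlier, so every embedding is made to preserve the order
  given by \<open>e\<close> as well as the order of the points.\<close>

lemma underS_kappa: "underS (kappa :: 'k::wellorder rel) \<alpha> = {..<\<alpha>}"
  by (auto simp: underS_def kappa_def)

lemma Field_kappa: "Field (kappa :: 'k::wellorder rel) = UNIV"
  by (auto simp: Field_def kappa_def)

lemma Well_order_kappa: "Well_order (kappa :: 'k::wellorder rel)"
proof -
  have "wf ((kappa :: 'k rel) - Id)"
    by (rule wf_subset[OF wf]) (auto simp: kappa_def)
  then show ?thesis
    by (auto simp: well_order_on_def linear_order_on_def partial_order_on_def preorder_on_def
        refl_on_def trans_def antisym_def total_on_def kappa_def Field_def)
qed

lemma Well_order_Restr_kappa: "Well_order (Restr (kappa :: 'k::wellorder rel) A)"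
  by (rule Well_order_Restr[OF Well_order_kappa])

lemma Field_Restr_kappa: "Field (Restr (kappa :: 'k::wellorder rel) A) = A"
  by (auto simp: Field_def kappa_def)

lemma osuc_leI: "\<alpha> < \<beta> \<Longrightarrow> osuc \<alpha> \<le> \<beta>"
  unfolding osuc_def by (rule Least_le)

locale inaccessible =
  fixes \<kappa> :: "'k::wellorder rel"
  assumes kappa: "\<kappa> = kappa"
    and inacc: "strongly_inaccessible \<kappa>"
begin

abbreviation small :: "'a set \<Rightarrow> bool" where
  "small A \<equiv> |A| <o \<kappa>"

lemma Card_kappa: "Card_order \<kappa>"
  and reg: "regularCard \<kappa>"
  and natLeq_kappa: "natLeq <o \<kappa>"
  using inacc by (auto simp: strongly_inaccessible_def)

lemma infinite_kappa: "\<not> finite (Field \<kappa>)"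
  using ordLess_imp_ordLeq[OF natLeq_kappa] infinite_iff_natLeq_ordLeq[of "Field \<kappa>"]
    card_of_Field_ordIso[OF Card_kappa] ordIso_symmetric ordLeq_ordIso_trans by blast

lemma small_lessThan: "small {..<\<alpha>::'k}"
  using card_of_underS[OF Card_kappa, of \<alpha>] by (simp add: underS_kappa Field_kappa kappa)

lemma small_mono: "A \<subseteq> B \<Longrightarrow> small B \<Longrightarrow> small A"
  using card_of_mono1 ordLeq_ordLess_trans by blast

lemma small_image: "small A \<Longrightarrow> small (f ` A)"
  using card_of_image ordLeq_ordLess_trans by blast

lemma small_inj: "inj_on f A \<Longrightarrow> f ` A \<subseteq> B \<Longrightarrow> small B \<Longrightarrow> small A"
  using card_of_ordLeqI[of f A B] ordLeq_ordLess_trans by blast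

lemma small_UN: "small I \<Longrightarrow> (\<And>i. i \<in> I \<Longrightarrow> small (A i)) \<Longrightarrow> small (\<Union>i\<in>I. A i)"
  using card_of_UNION_ordLess_infinite_Field_regularCard[OF reg, of I A] infinite_kappa Card_kappa
  by (auto simp: cinfinite_def)

lemma small_Times:
  assumes "small A" "small B" shows "small (A \<times> B)"
proof -
  have "A \<times> B = (\<Union>a\<in>A. Pair a ` B)" by auto
  then show ?thesis using small_UN[OF assms(1)] small_image[OF assms(2)] by metis
qed

lemma small_finite: "finite A \<Longrightarrow> small A"
  using finite_ordLess_infinite[of "|A|" \<kappa>] infinite_kappa Well_order_kappa kappa
    card_of_Well_order by (auto simp: Field_card_of)

text \<open>An unbounded set is cofinal, and by regularity a cofinal set has size \<kappa>.\<close>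

lemma small_bounded: "small (A :: 'k set) \<Longrightarrow> \<exists>\<beta>. \<forall>\<alpha>\<in>A. \<alpha> < \<beta>"
proof (rule ccontr)
  assume s: "small A" and "\<nexists>\<beta>. \<forall>\<alpha>\<in>A. \<alpha> < \<beta>"
  then have *: "\<forall>\<beta>. \<exists>\<alpha>\<in>A. \<beta> \<le> \<alpha>" by (meson not_less)
  have "cofinal A \<kappa>"
    unfolding cofinal_def
  proof
    fix a :: 'k assume "a \<in> Field \<kappa>"
    then obtain b where "a \<noteq> b" "(a, b) \<in> \<kappa>"
      using infinite_Card_order_limit[OF Card_kappa infinite_kappa] by blast
    moreover obtain c where "c \<in> A" "b \<le> c" using * by blast
    ultimately have "c \<in> A" "a \<noteq> c" "(a, c) \<in> \<kappa>"
      by (auto simp: kappa kappa_def)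
    then show "\<exists>b\<in>A. a \<noteq> b \<and> (a, b) \<in> \<kappa>" by blast
  qed
  then have "|A| =o \<kappa>"
    using reg unfolding regularCard_def kappa Field_kappa by blast
  with s show False using not_ordLess_ordIso by blast
qed

lemma osuc_greater [simp]: "\<alpha> < osuc (\<alpha>::'k)"
proof -
  have "small {\<alpha>}" by (rule small_finite) simp
  then obtain \<beta> where "\<alpha> < \<beta>" using small_bounded by blast
  then show ?thesis unfolding osuc_def by (rule LeastI)
qed

lemma osuc_le_iff: "osuc \<alpha> \<le> \<beta> \<longleftrightarrow> (\<alpha>::'k) < \<beta>"
  using osuc_leI osuc_greater less_le_trans by blast

lemma less_osuc_iff: "\<alpha> < osuc \<beta> \<longleftrightarrow> (\<alpha>::'k) \<le> \<beta>"
proof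
  assume "\<alpha> < osuc \<beta>"
  then show "\<alpha> \<le> \<beta>" using osuc_leI[of \<beta> \<alpha>] by (meson leD leI)
qed (rule le_less_trans[OF _ osuc_greater])

lemma osuc_mono: "(\<alpha>::'k) \<le> \<beta> \<Longrightarrow> osuc \<alpha> \<le> osuc \<beta>"
  by (simp add: osuc_le_iff less_osuc_iff)

lemma osuc_inject: "osuc \<alpha> = osuc \<beta> \<Longrightarrow> (\<alpha>::'k) = \<beta>"
proof (rule order.antisym)
  assume *: "osuc \<alpha> = osuc \<beta>"
  show "\<alpha> \<le> \<beta>" using osuc_greater[of \<alpha>] unfolding * less_osuc_iff .
  show "\<beta> \<le> \<alpha>" using osuc_greater[of \<beta>] unfolding *[symmetric] less_osuc_iff .
qed

lemma small_Pow: 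
  assumes "small A" shows "small (Pow A)"
proof -
  obtain B where B: "B \<subseteq> Field \<kappa>" "|A| =o |B|" "|B| <o \<kappa>"
    using internalize_card_of_ordLess[of A \<kappa>] assms by blast
  then have "|Pow B| <o \<kappa>"
    using inacc unfolding strongly_inaccessible_def by blast
  moreover obtain f where "bij_betw f A B" using B(2) card_of_ordIso by blast
  then have "inj_on ((`) f) (Pow A)" "(`) f ` Pow A \<subseteq> Pow B"
    by (auto simp: bij_betw_def inj_on_image_Pow)
  ultimately show ?thesis using small_inj by blast
qed

text \<open>A function is coded by its graph, a subset of a small set, so the strong limit property
  applies. This later bounds the number of colour patterns over all parameters of bounded
  level.\<close>

lemma small_PiE:
  assumes "small I" "\<And>i. i \<in> I \<Longrightarrow> small (A i)" shows "small (PiE I A)"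
proof (rule small_inj)
  let ?g = "\<lambda>f. (\<lambda>i. (i, f i)) ` I"
  show "inj_on ?g (PiE I A)"
  proof (rule inj_onI)
    fix f g assume *: "f \<in> PiE I A" "g \<in> PiE I A" "?g f = ?g g"
    show "f = g"
    proof (rule PiE_ext[OF *(1,2)])
      fix i assume "i \<in> I"
      then have "(i, f i) \<in> ?g g" using *(3) by blast
      then show "f i = g i" by auto
    qed
  qed
  show "?g ` PiE I A \<subseteq> Pow (I \<times> (\<Union>i\<in>I. A i))" by auto
  show "small (Pow (I \<times> (\<Union>i\<in>I. A i)))"
    by (intro small_Pow small_Times small_UN assms)
qed

text \<open>\<open>HL_tc\<close> wants its colours in a proper initial segment of \<kappa>; any
  small set of colours can be renamed into one.\<close>

lemma small_code:
  assumes "small A" shows "\<exists>(c :: 'a \<Rightarrow> 'k) \<delta>. inj_on c A \<and> c ` A \<subseteq> {..<\<delta>}"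
proof -
  obtain B where B: "B \<subseteq> Field \<kappa>" "|A| =o |B|" "|B| <o \<kappa>"
    using internalize_card_of_ordLess[of A \<kappa>] assms by blast
  obtain c where "bij_betw c A B" using B(2) card_of_ordIso by blast
  moreover obtain \<delta> where "\<forall>\<beta>\<in>B. \<beta> < \<delta>" using small_bounded[OF B(3)] by blast
  ultimately show ?thesis unfolding bij_betw_def by (intro exI[of _ c] exI[of _ \<delta>]) auto
qed

lemma pairing: "\<exists>p :: 'k \<times> 'k \<Rightarrow> 'k. inj p"
proof -
  have F: "Field \<kappa> = UNIV" by (simp add: kappa Field_kappa)
  have "|(UNIV :: 'k set) \<times> (UNIV :: 'k set)| \<le>o |UNIV :: 'k set|"
    using ordLeq_ordIso_trans[OF Card_order_Times_same_infinite[OF Card_kappa infinite_kappa]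
        ordIso_symmetric[OF card_of_Field_ordIso[OF Card_kappa]]] unfolding F .
  then show ?thesis using card_of_ordLeq[of "(UNIV :: 'k set) \<times> (UNIV :: 'k set)" "UNIV :: 'k set"] by auto
qed

lemma tuple_code: "\<exists>c :: (nat \<Rightarrow> 'k) \<Rightarrow> 'k. inj_on c (\<Pi>\<^sub>E j\<in>{..<d::nat}. UNIV)"
proof (induction d)
  case 0
  show ?case by auto
next
  case (Suc d)
  then obtain c :: "(nat \<Rightarrow> 'k) \<Rightarrow> 'k" where c: "inj_on c (\<Pi>\<^sub>E j\<in>{..<d}. UNIV)" by blast
  obtain p :: "'k \<times> 'k \<Rightarrow> 'k" where p: "inj p" using pairing by blast
  have "inj_on (\<lambda>u. p (c (restrict u {..<d}), u d)) (\<Pi>\<^sub>E j\<in>{..<Suc d}. UNIV)"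
  proof (rule inj_onI)
    fix u v :: "nat \<Rightarrow> 'k"
    assume u: "u \<in> (\<Pi>\<^sub>E j\<in>{..<Suc d}. UNIV)" and v: "v \<in> (\<Pi>\<^sub>E j\<in>{..<Suc d}. UNIV)"
      and "p (c (restrict u {..<d}), u d) = p (c (restrict v {..<d}), v d)"
    then have "c (restrict u {..<d}) = c (restrict v {..<d})" and d: "u d = v d"
      using p by (auto dest: injD)
    then have "restrict u {..<d} = restrict v {..<d}"
      by (intro inj_onD[OF c]) auto
    then have "u j = v j" if "j < d" for j using that by (metis lessThan_iff restrict_apply')
    then show "u = v" using d by (intro PiE_ext[OF u v]) (auto simp: less_Suc_eq)
  qed
  then show ?case by blast
qed

text \<open>Zero is included. Uniqueness of the root and uniqueness of nodes at limit levels thereby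
  become a single condition.\<close>

definition nonsucc :: "'k \<Rightarrow> bool" where
  "nonsucc \<xi> \<longleftrightarrow> (\<nexists>\<eta>. \<xi> = osuc \<eta>)"

lemma nonsucc_osuc_less: "nonsucc \<xi> \<Longrightarrow> \<eta> < \<xi> \<Longrightarrow> osuc \<eta> < \<xi>"
  using osuc_leI[of \<eta> \<xi>] by (auto simp: nonsucc_def less_le)

lemma is_limit_nonsucc: "is_limit \<xi> \<Longrightarrow> nonsucc (\<xi>::'k)"
  unfolding is_limit_def nonsucc_def
proof
  assume *: "(\<exists>\<beta>. \<beta> < \<xi>) \<and> (\<forall>\<beta><\<xi>. \<exists>\<gamma><\<xi>. \<beta> < \<gamma>)" and "\<exists>\<eta>. \<xi> = osuc \<eta>"
  then obtain \<eta> where \<eta>: "\<xi> = osuc \<eta>" by blast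
  then obtain \<gamma> where "\<gamma> < \<xi>" "\<eta> < \<gamma>" using * osuc_greater[of \<eta>] by blast
  then show False using \<eta> by (simp add: less_osuc_iff)
qed

lemma strict_mono_ge: "strict_mono (a :: 'k \<Rightarrow> 'k) \<Longrightarrow> \<xi> \<le> a \<xi>"
proof (induction \<xi> rule: less_induct)
  case (less \<xi>)
  show ?case
  proof (rule ccontr)
    assume "\<not> \<xi> \<le> a \<xi>"
    then have "a \<xi> < \<xi>" by simp
    then have "a \<xi> \<le> a (a \<xi>)" by (rule less.IH[OF _ less.prems])
    moreover have "a (a \<xi>) < a \<xi>" by (rule strict_monoD[OF less.prems \<open>a \<xi> < \<xi>\<close>])
    ultimately show False by simp
  qed
qed

text \<open>A normal sequence that outruns \<open>\<phi>\<close> at successors. The last clause is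
  continuity at limits; at the least \<xi> it says that nothing lies below \<open>b \<xi>\<close>.
  Both are needed when a tree is thinned to the levels in the range of \<open>b\<close>: the root
  has to stay, and no splitting may appear at limit levels.\<close>

lemma normal_function:
  fixes \<phi> :: "'k \<Rightarrow> 'k"
  shows "\<exists>b. strict_mono b \<and> (\<forall>\<xi>. \<phi> (b \<xi>) \<le> b (osuc \<xi>)) \<and>
    (\<forall>\<xi>. nonsucc \<xi> \<longrightarrow> (\<forall>\<zeta><b \<xi>. \<exists>\<eta><\<xi>. \<zeta> \<le> b \<eta>))"
proof -
  define \<psi> where "\<psi> \<beta> = max (\<phi> \<beta>) (osuc \<beta>)" for \<beta>
  let ?P = "\<lambda>f (\<xi>::'k) r. (r::'k) = (LEAST \<beta>. \<forall>\<eta><\<xi>. \<psi> (f \<eta>) \<le> \<beta>)"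
  have "\<exists>b. \<forall>\<xi>. ?P b \<xi> (b \<xi>)"
  proof (rule dependent_wellorder_choice[where P = ?P])
    fix f g :: "'k \<Rightarrow> 'k" and x r assume "\<And>y. y < x \<Longrightarrow> f y = g y"
    then have "(\<lambda>\<beta>. \<forall>\<eta><x. \<psi> (f \<eta>) \<le> \<beta>) = (\<lambda>\<beta>. \<forall>\<eta><x. \<psi> (g \<eta>) \<le> \<beta>)" by simp
    then show "?P f x r = ?P g x r" by simp
  qed (rule exI, rule refl)
  then obtain b where "\<forall>\<xi>. ?P b \<xi> (b \<xi>)" ..
  then have b: "b \<xi> = (LEAST \<beta>. \<forall>\<eta><\<xi>. \<psi> (b \<eta>) \<le> \<beta>)" for \<xi> by (rule spec)
  have ex: "\<exists>\<beta>. \<forall>\<eta><\<xi>. \<psi> (b \<eta>) \<le> \<beta>" for \<xi>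
    using small_bounded[OF small_image[OF small_lessThan[of \<xi>], of "\<lambda>\<eta>. \<psi> (b \<eta>)"]]
    by (auto intro: less_imp_le)
  have ge: "\<psi> (b \<eta>) \<le> b \<xi>" if "\<eta> < \<xi>" for \<eta> \<xi>
    using LeastI_ex[OF ex[of \<xi>]] that unfolding b[symmetric] by blast
  have least: "b \<xi> \<le> \<beta>" if "\<forall>\<eta><\<xi>. \<psi> (b \<eta>) \<le> \<beta>" for \<xi> \<beta>
    using Least_le[of "\<lambda>\<beta>. \<forall>\<eta><\<xi>. \<psi> (b \<eta>) \<le> \<beta>" \<beta>] that unfolding b[symmetric] by blast
  have mono: "strict_mono b"
  proof (rule strict_monoI)
    fix \<eta> \<xi> :: 'k assume "\<eta> < \<xi>"
    then have "osuc (b \<eta>) \<le> b \<xi>" using ge[of \<eta> \<xi>] by (simp add: \<psi>_def)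
    then show "b \<eta> < b \<xi>" by (simp add: osuc_le_iff)
  qed
  moreover have "\<phi> (b \<xi>) \<le> b (osuc \<xi>)" for \<xi>
    using ge[of \<xi> "osuc \<xi>"] by (simp add: \<psi>_def)
  moreover have "\<exists>\<eta><\<xi>. \<zeta> \<le> b \<eta>" if "nonsucc \<xi>" "\<zeta> < b \<xi>" for \<xi> \<zeta>
  proof (rule ccontr)
    assume "\<not> ?thesis"
    then have *: "b \<eta> \<le> \<zeta>" if "\<eta> < \<xi>" for \<eta> using that by force
    \<comment> \<open>Below a nonsuccessor \<xi> the ordinal \<open>osuc \<eta>\<close> is available
      too, so \<open>\<psi> (b \<eta>)\<close> is itself bounded by an earlier value of
      \<open>b\<close>.\<close>
    have "\<psi> (b \<eta>) \<le> \<zeta>" if "\<eta> < \<xi>" for \<eta>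
      using ge[of \<eta> "osuc \<eta>"] *[OF nonsucc_osuc_less[OF \<open>nonsucc \<xi>\<close> that]] by simp
    then have "b \<xi> \<le> \<zeta>" by (intro least) blast
    then show False using \<open>\<zeta> < b \<xi>\<close> by simp
  qed
  ultimately show ?thesis by blast
qed

end

section \<open>Heights and maximal paths in abstract trees\<close>

lemma Well_order_Restr_pullback:
  fixes \<phi> :: "'a \<Rightarrow> 'k::wellorder"
  assumes inj: "inj_on \<phi> U"
    and ord: "\<And>s s'. s \<in> U \<Longrightarrow> s' \<in> U \<Longrightarrow> (s, s') \<in> S \<longleftrightarrow> \<phi> s \<le> \<phi> s'"
  shows "Field (Restr S U) = U" "Well_order (Restr S U)"
proof -
  have F: "Field (Restr S U) = U" using ord by (auto simp: Field_def)
  have "Restr S U - Id \<subseteq> inv_image {(x, y). x < y} \<phi>"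
  proof (rule subrelI)
    fix a b assume "(a, b) \<in> Restr S U - Id"
    then have "\<phi> a \<le> \<phi> b" "\<phi> a \<noteq> \<phi> b" using ord inj by (auto dest: inj_onD)
    then show "(a, b) \<in> inv_image {(x, y). x < y} \<phi>" by simp
  qed
  then have "wf (Restr S U - Id)"
    using wf_subset[OF wf_inv_image[OF wf]] by blast
  moreover have "refl_on U (Restr S U)" using ord by (auto simp: refl_on_def)
  moreover have "trans (Restr S U)"
  proof (rule transI)
    fix a b c assume "(a, b) \<in> Restr S U" "(b, c) \<in> Restr S U"
    then have "a \<in> U" "c \<in> U" "\<phi> a \<le> \<phi> b" "\<phi> b \<le> \<phi> c" using ord by auto
    then show "(a, c) \<in> Restr S U" using ord[of a c] by auto
  qed
  moreover have "antisym (Restr S U)"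
  proof (rule antisymI)
    fix a b assume "(a, b) \<in> Restr S U" "(b, a) \<in> Restr S U"
    then have "a \<in> U" "b \<in> U" "\<phi> a = \<phi> b" using ord[of a b] ord[of b a] by auto
    then show "a = b" using inj by (auto dest: inj_onD)
  qed
  moreover have "total_on U (Restr S U)" using ord by (auto simp: total_on_def)
  ultimately have "Well_order (Restr S U)"
    unfolding F well_order_on_def linear_order_on_def partial_order_on_def preorder_on_def
    by (auto simp: Field_def)
  with F show "Field (Restr S U) = U" "Well_order (Restr S U)" by simp_all
qed

lemma has_heightI:
  fixes \<phi> :: "'a \<Rightarrow> 'k::wellorder"
  assumes bij: "bij_betw \<phi> (underS S t) {..<\<alpha>}"
    and ord: "\<And>s s'. s \<in> underS S t \<Longrightarrow> s' \<in> underS S t \<Longrightarrow> (s, s') \<in> S \<longleftrightarrow> \<phi> s \<le> \<phi> s'"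
  shows "has_height S t \<alpha>"
proof -
  let ?U = "underS S t"
  have U: "Field (Restr S ?U) = ?U" "Well_order (Restr S ?U)"
    by (intro Well_order_Restr_pullback[OF bij_betw_imp_inj_on[OF bij]] ord; assumption)+
  have "iso (Restr S ?U) (Restr kappa {..<\<alpha>}) \<phi>"
    unfolding iso_iff2 U(1) Field_Restr_kappa using bij ord
    by (auto simp: kappa_def dest: bij_betwE)
  then show ?thesis
    unfolding has_height_def ordIso_def using U(2) Well_order_Restr_kappa by blast
qed

lemma has_heightE:
  assumes "Partial_order S" "has_height S t (\<alpha> :: 'k::wellorder)"
  obtains \<phi> where "bij_betw \<phi> (underS S t) {..<\<alpha>}"
    "\<And>s s'. s \<in> underS S t \<Longrightarrow> s' \<in> underS S t \<Longrightarrow> (s, s') \<in> S \<longleftrightarrow> \<phi> s \<le> \<phi> s'"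
proof -
  let ?U = "underS S t"
  have "(s, s) \<in> S" if "s \<in> ?U" for s
    using that assms(1)
    by (auto simp: underS_def partial_order_on_def preorder_on_def refl_on_def Field_def)
  then have F: "Field (Restr S ?U) = ?U" by (auto simp: Field_def)
  obtain \<phi> where "iso (Restr S ?U) (Restr (kappa :: 'k rel) {..<\<alpha>}) \<phi>"
    using assms(2) unfolding has_height_def ordIso_def by blast
  then have \<phi>: "bij_betw \<phi> ?U {..<\<alpha>}"
    and *: "\<forall>a\<in>?U. \<forall>b\<in>?U. (a, b) \<in> Restr S ?U \<longleftrightarrow> (\<phi> a, \<phi> b) \<in> Restr (kappa :: 'k rel) {..<\<alpha>}"
    unfolding iso_iff2 F Field_Restr_kappa by blast+
  show thesis
  proof (rule that[OF \<phi>])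
    fix s s' assume s: "s \<in> ?U" "s' \<in> ?U"
    then have "\<phi> s < \<alpha>" "\<phi> s' < \<alpha>" using \<phi> by (auto dest: bij_betwE)
    then show "(s, s') \<in> S \<longleftrightarrow> \<phi> s \<le> \<phi> s'" using * s by (auto simp: kappa_def)
  qed
qed

text \<open>A well-order is not isomorphic to a proper initial segment of itself.\<close>

lemma height_unique:
  assumes "has_height S t (\<alpha> :: 'k::wellorder)" "has_height S t \<beta>"
  shows "\<alpha> = \<beta>"
proof -
  have less: False if ab: "\<alpha> < \<beta>" and a: "has_height S t \<alpha>" and b: "has_height S t \<beta>"
    for \<alpha> \<beta> :: 'k
  proof -
    let ?r = "Restr (kappa :: 'k rel) {..<\<beta>}"
    have u: "underS ?r \<alpha> = {..<\<alpha>}" using ab by (auto simp: underS_def kappa_def)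
    have "Restr ?r (underS ?r \<alpha>) = Restr kappa {..<\<alpha>}" unfolding u using ab by auto
    moreover have "Field ?r \<noteq> {}" using ab by (auto simp: Field_Restr_kappa)
    ultimately have "Restr (kappa :: 'k rel) {..<\<alpha>} <o ?r"
      using underS_Restr_ordLess[OF Well_order_Restr_kappa, of "{..<\<beta>}" \<alpha>] by simp
    moreover have "Restr (kappa :: 'k rel) {..<\<alpha>} =o ?r"
      using a b unfolding has_height_def
      by (rule ordIso_transitive[OF ordIso_symmetric])
    ultimately show False using not_ordLess_ordIso by blast
  qed
  show ?thesis using less[OF _ assms] less[OF _ assms(2,1)] by (meson less_linear)
qed

text \<open>Serves two ends: among the points it yields chains that reach every level, and in a tree
  delivered by \<open>HL_tc\<close> it gives access to the order type \<kappa> of maximal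
  paths.\<close>

lemma maximal_path_extends:
  assumes C: "C \<in> Chains S"
  shows "\<exists>M. maximal_path S M \<and> C \<subseteq> M"
proof -
  let ?A = "{D. D \<in> Chains S \<and> C \<subseteq> D}"
  have "\<exists>M\<in>?A. \<forall>X\<in>?A. M \<subseteq> X \<longrightarrow> X = M"
  proof (rule subset_Zorn)
    fix \<C> assume \<C>: "subset.chain ?A \<C>"
    show "\<exists>U\<in>?A. \<forall>X\<in>\<C>. X \<subseteq> U"
    proof (cases "\<C> = {}")
      case True
      then show ?thesis using C by auto
    next
      case False
      have "\<Union>\<C> \<in> Chains S"
        unfolding Chains_def
      proof (intro CollectI ballI)
        fix s t assume "s \<in> \<Union>\<C>" "t \<in> \<Union>\<C>"
        then obtain X Y where XY: "X \<in> \<C>" "Y \<in> \<C>" "s \<in> X" "t \<in> Y" by blast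
        then have "X \<subseteq> Y \<or> Y \<subseteq> X" "X \<in> Chains S" "Y \<in> Chains S"
          using \<C> by (auto simp: subset_chain_def)
        then show "(s, t) \<in> S \<or> (t, s) \<in> S" using XY unfolding Chains_def by blast
      qed
      moreover obtain X where "X \<in> \<C>" using False by blast
      then have "C \<subseteq> \<Union>\<C>" using \<C> by (auto simp: subset_chain_def)
      ultimately show ?thesis by blast
    qed
  qed
  then obtain M where "M \<in> ?A" and max: "\<forall>X\<in>?A. M \<subseteq> X \<longrightarrow> X = M" by (rule bexE)
  then have M: "M \<in> Chains S" "C \<subseteq> M" by simp_all
  have "maximal_path S M"
    unfolding maximal_path_def
  proof (intro conjI ballI impI)
    fix c assume "c \<in> Chains S" "M \<subseteq> c"
    then show "c = M" using max M(2) by auto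
  qed (rule M(1))
  with M(2) show ?thesis by blast
qed

section \<open>A linear order as a binary tree\<close>

text \<open>
  The points form a binary search tree whose indices increase along the branches, so an extension
  of a node stays on its side of every earlier node.
\<close>

locale treap = inaccessible \<kappa> for \<kappa> :: "'k::wellorder rel" +
  fixes qq :: "'k \<Rightarrow> 'q::linorder"
  assumes inj_qq: "inj qq" and sat: "saturated \<kappa> (range qq)"
begin

abbreviation lss :: "'k \<Rightarrow> 'k \<Rightarrow> bool" (infix \<open>\<lhd>\<close> 50) where
  "s \<lhd> t \<equiv> qq s < qq t"

text \<open>The ancestor relation of the Cartesian tree whose keys are the points
  \<open>qq s\<close> and whose priorities are the indices \<open>s\<close>.\<close>

definition tle :: "'k \<Rightarrow> 'k \<Rightarrow> bool" (infix \<open>\<sqsubseteq>\<close> 50) where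
  "s \<sqsubseteq> t \<longleftrightarrow> (\<forall>z. qq s \<le> qq z \<and> qq z \<le> qq t \<or> qq t \<le> qq z \<and> qq z \<le> qq s \<longrightarrow> s \<le> z)"

definition chain :: "'k set \<Rightarrow> bool" where
  "chain C \<longleftrightarrow> (\<forall>s\<in>C. \<forall>t\<in>C. s \<sqsubseteq> t \<or> t \<sqsubseteq> s)"

lemma qq_eq [simp]: "qq s = qq t \<longleftrightarrow> s = t"
  using inj_qq by (auto dest: injD)

lemma lss_linear: "s \<lhd> t \<or> s = t \<or> t \<lhd> s"
  using less_linear[of "qq s" "qq t"] by simp

lemma saturation:
  assumes "small A" "small B" "\<And>a b. a \<in> A \<Longrightarrow> b \<in> B \<Longrightarrow> a \<lhd> b"
  shows "\<exists>c. (\<forall>a\<in>A. a \<lhd> c) \<and> (\<forall>b\<in>B. c \<lhd> b)"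
proof -
  have 1: "qq ` A \<subseteq> range qq" "qq ` B \<subseteq> range qq" by blast+
  have 2: "small (qq ` A)" "small (qq ` B)" by (rule small_image, rule assms)+
  have 3: "\<forall>a\<in>qq ` A. \<forall>b\<in>qq ` B. a < b" using assms(3) by blast
  from 1 2 3 have "\<exists>c\<in>range qq. (\<forall>a\<in>qq ` A. a < c) \<and> (\<forall>b\<in>qq ` B. c < b)"
    by (rule sat[unfolded saturated_def, THEN spec, THEN spec, THEN mp, THEN mp, THEN mp, THEN mp, THEN mp])
  then show ?thesis by simp
qed

lemma tleD:
  "s \<sqsubseteq> t \<Longrightarrow> qq s \<le> qq z \<and> qq z \<le> qq t \<or> qq t \<le> qq z \<and> qq z \<le> qq s \<Longrightarrow> s \<le> z"
  unfolding tle_def by blast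

lemma tle_refl [simp]: "s \<sqsubseteq> s"
  by (auto simp: tle_def dest: order.antisym)

lemma tle_le: "s \<sqsubseteq> t \<Longrightarrow> s \<le> t"
  by (erule tleD) auto

lemma tle_antisym: "s \<sqsubseteq> t \<Longrightarrow> t \<sqsubseteq> s \<Longrightarrow> s = t"
  using tle_le order.antisym by blast

lemma tle_trans:
  assumes "s \<sqsubseteq> t" "t \<sqsubseteq> u" shows "s \<sqsubseteq> u"
  unfolding tle_def
proof (intro allI impI)
  fix z assume z: "qq s \<le> qq z \<and> qq z \<le> qq u \<or> qq u \<le> qq z \<and> qq z \<le> qq s"
  show "s \<le> z"
  proof (cases "qq s \<le> qq z \<and> qq z \<le> qq t \<or> qq t \<le> qq z \<and> qq z \<le> qq s")
    case True
    then show ?thesis by (rule tleD[OF assms(1)])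
  next
    case False
    then have "qq t \<le> qq z \<and> qq z \<le> qq u \<or> qq u \<le> qq z \<and> qq z \<le> qq t"
      using z by auto
    then have "t \<le> z" by (rule tleD[OF assms(2)])
    then show ?thesis using tle_le[OF assms(1)] by simp
  qed
qed

text \<open>The interval between \<open>s\<close> and \<open>t\<close> is covered by the one between
  \<open>s\<close> and \<open>u\<close> and the one between \<open>t\<close> and \<open>u\<close>.
  Hence the ancestors of a node are linearly ordered.\<close>

lemma tle_below:
  assumes "s \<sqsubseteq> u" "t \<sqsubseteq> u" "s \<le> t" shows "s \<sqsubseteq> t"
  unfolding tle_def
proof (intro allI impI)
  fix z assume z: "qq s \<le> qq z \<and> qq z \<le> qq t \<or> qq t \<le> qq z \<and> qq z \<le> qq s"
  show "s \<le> z"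
  proof (cases "qq s \<le> qq z \<and> qq z \<le> qq u \<or> qq u \<le> qq z \<and> qq z \<le> qq s")
    case True
    then show ?thesis by (rule tleD[OF assms(1)])
  next
    case False
    then have "qq t \<le> qq z \<and> qq z \<le> qq u \<or> qq u \<le> qq z \<and> qq z \<le> qq t"
      using z by auto
    then have "t \<le> z" by (rule tleD[OF assms(2)])
    then show ?thesis using assms(3) by simp
  qed
qed

lemma tle_linear: "s \<sqsubseteq> u \<Longrightarrow> t \<sqsubseteq> u \<Longrightarrow> s \<sqsubseteq> t \<or> t \<sqsubseteq> s"
  using linear[of s t] tle_below[of s u t] tle_below[of t u s] by auto

text \<open>Otherwise \<open>t\<close> would lie between \<open>u\<close> and \<open>v\<close>, so
  \<open>u\<close>, being an ancestor of \<open>v\<close>, would have an index at most that of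
  \<open>t\<close>.\<close>

lemma side_left:
  assumes "t \<sqsubseteq> u" "u \<sqsubseteq> v" "u \<lhd> t" shows "v \<lhd> t"
proof (rule ccontr)
  assume "\<not> v \<lhd> t"
  then have "u \<le> t" using assms by (intro tleD[OF assms(2)]) auto
  then have "u = t" using tle_le[OF assms(1)] by simp
  then show False using assms(3) by simp
qed

lemma side_right:
  assumes "t \<sqsubseteq> u" "u \<sqsubseteq> v" "t \<lhd> u" shows "t \<lhd> v"
proof (rule ccontr)
  assume "\<not> t \<lhd> v"
  then have "u \<le> t" using assms by (intro tleD[OF assms(2)]) auto
  then have "u = t" using tle_le[OF assms(1)] by simp
  then show False using assms(3) by simp
qed

text \<open>The point of least index between \<open>s\<close> and \<open>t\<close>: this is where
  the branches to \<open>s\<close> and \<open>t\<close> part.\<close>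

lemma meet:
  assumes "s \<lhd> t"
  shows "\<exists>m. m \<sqsubseteq> s \<and> m \<sqsubseteq> t \<and> qq s \<le> qq m \<and> qq m \<le> qq t"
proof -
  define m where "m = (LEAST z. qq s \<le> qq z \<and> qq z \<le> qq t)"
  have m: "qq s \<le> qq m \<and> qq m \<le> qq t"
    unfolding m_def by (rule LeastI[of _ s]) (use assms in auto)
  have least: "m \<le> z" if "qq s \<le> qq z" "qq z \<le> qq t" for z
    unfolding m_def by (rule Least_le) (use that in auto)
  have "m \<sqsubseteq> s" unfolding tle_def
  proof (intro allI impI least)
    fix z assume z: "qq m \<le> qq z \<and> qq z \<le> qq s \<or> qq s \<le> qq z \<and> qq z \<le> qq m"
    from z m assms show "qq s \<le> qq z" by (elim disjE conjE; order)
    from z m assms show "qq z \<le> qq t" by (elim disjE conjE; order)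
  qed
  moreover have "m \<sqsubseteq> t" unfolding tle_def
  proof (intro allI impI least)
    fix z assume z: "qq m \<le> qq z \<and> qq z \<le> qq t \<or> qq t \<le> qq z \<and> qq z \<le> qq m"
    from z m assms show "qq s \<le> qq z" by (elim disjE conjE; order)
    from z m assms show "qq z \<le> qq t" by (elim disjE conjE; order)
  qed
  ultimately show ?thesis using m by blast
qed

text \<open>Fewer than \<kappa> points have an index below \<open>t\<close>, so saturation finds
  \<open>c\<close> closer to \<open>t\<close> on the left than any of them. Then nothing between
  \<open>c\<close> and \<open>t\<close> has a smaller index than \<open>t\<close>.\<close>

lemma left_ext: "\<exists>c. t \<sqsubseteq> c \<and> c \<lhd> t"
proof -
  have "\<exists>c. (\<forall>a\<in>{z. z < t \<and> z \<lhd> t}. a \<lhd> c) \<and> (\<forall>b\<in>{t}. c \<lhd> b)"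
  proof (rule saturation)
    show "small {z. z < t \<and> z \<lhd> t}" by (rule small_mono[OF _ small_lessThan[of t]]) auto
    show "small {t}" by (rule small_finite) simp
  qed simp
  then obtain c where c: "\<And>a. a < t \<Longrightarrow> a \<lhd> t \<Longrightarrow> a \<lhd> c" "c \<lhd> t" by auto
  have "t \<sqsubseteq> c"
    unfolding tle_def
  proof (intro allI impI)
    fix z assume "qq t \<le> qq z \<and> qq z \<le> qq c \<or> qq c \<le> qq z \<and> qq z \<le> qq t"
    then have "qq c \<le> qq z" "qq z \<le> qq t" using c(2) by auto
    then show "t \<le> z" using c(1)[of z] lss_linear[of z t] by force
  qed
  with c(2) show ?thesis by blast
qed

lemma right_ext: "\<exists>c. t \<sqsubseteq> c \<and> t \<lhd> c"
proof -
  have "\<exists>c. (\<forall>a\<in>{t}. a \<lhd> c) \<and> (\<forall>b\<in>{z. z < t \<and> t \<lhd> z}. c \<lhd> b)"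
  proof (rule saturation)
    show "small {z. z < t \<and> t \<lhd> z}" by (rule small_mono[OF _ small_lessThan[of t]]) auto
    show "small {t}" by (rule small_finite) simp
  qed simp
  then obtain c where c: "\<And>a. a < t \<Longrightarrow> t \<lhd> a \<Longrightarrow> c \<lhd> a" "t \<lhd> c" by auto
  have "t \<sqsubseteq> c"
    unfolding tle_def
  proof (intro allI impI)
    fix z assume "qq t \<le> qq z \<and> qq z \<le> qq c \<or> qq c \<le> qq z \<and> qq z \<le> qq t"
    then have "qq t \<le> qq z" "qq z \<le> qq c" using c(2) by auto
    then show "t \<le> z" using c(1)[of z] lss_linear[of z t] by force
  qed
  with c(2) show ?thesis by blast
qed

text \<open>A point with an index below some \<open>c\<close> in \<open>C\<close> cannot lie between
  \<open>c\<close> and a later member of the chain, so from \<open>c\<close> on it stays on one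
  side. Saturation yields a point in the cut between those that end up on the left and those that
  end up on the right.\<close>

lemma chain_upper_bound:
  assumes C: "chain C" and small: "small C"
  shows "\<exists>u. \<forall>c\<in>C. c \<sqsubseteq> u"
proof (cases "\<exists>u\<in>C. \<forall>c\<in>C. c \<sqsubseteq> u")
  case True
  then show ?thesis by (elim bexE) (rule exI)
next
  case False
  have common: "\<exists>c\<in>C. c0 \<sqsubseteq> c \<and> c1 \<sqsubseteq> c" if "c0 \<in> C" "c1 \<in> C" for c0 c1
  proof -
    have "c0 \<sqsubseteq> c1 \<or> c1 \<sqsubseteq> c0" using C that by (simp add: chain_def)
    then show ?thesis
    proof
      assume "c0 \<sqsubseteq> c1"
      then show ?thesis by (intro bexI[of _ c1] conjI tle_refl that)
    next
      assume "c1 \<sqsubseteq> c0"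
      then show ?thesis by (intro bexI[of _ c0] conjI tle_refl that)
    qed
  qed
  define U where "U = (\<Union>c\<in>C. {..<c})"
  have U: "small U" unfolding U_def by (intro small_UN small small_lessThan)
  have side: "z \<lhd> c \<and> z \<lhd> c' \<or> c \<lhd> z \<and> c' \<lhd> z" if "z < c" "c \<sqsubseteq> c'" for z c c'
  proof -
    have "z \<noteq> c" "z \<noteq> c'" using that tle_le[OF that(2)] by auto
    moreover have "\<not> (qq c \<le> qq z \<and> qq z \<le> qq c' \<or> qq c' \<le> qq z \<and> qq z \<le> qq c)"
      using tleD[OF that(2), of z] that(1) by auto
    ultimately show ?thesis using lss_linear[of z c] lss_linear[of z c'] by auto
  qed
  define A where "A = {z\<in>U. \<exists>c0\<in>C. \<forall>c\<in>C. c0 \<sqsubseteq> c \<longrightarrow> z \<lhd> c}"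
  define B where "B = {z\<in>U. \<exists>c0\<in>C. \<forall>c\<in>C. c0 \<sqsubseteq> c \<longrightarrow> c \<lhd> z}"
  have AB: "A \<union> B = U"
  proof
    show "U \<subseteq> A \<union> B"
    proof
      fix z assume z: "z \<in> U"
      then obtain c where c: "c \<in> C" "z < c" by (auto simp: U_def)
      show "z \<in> A \<union> B"
      proof (cases "z \<lhd> c")
        case True
        then have "\<forall>c'\<in>C. c \<sqsubseteq> c' \<longrightarrow> z \<lhd> c'" using side[OF c(2)] by fastforce
        then show ?thesis using z c by (auto simp: A_def)
      next
        case False
        then have "\<forall>c'\<in>C. c \<sqsubseteq> c' \<longrightarrow> c' \<lhd> z" using side[OF c(2)] by fastforce
        then show ?thesis using z c by (auto simp: B_def)
      qed
    qed
  qed (auto simp: A_def B_def)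
  have "\<exists>u. (\<forall>a\<in>A. a \<lhd> u) \<and> (\<forall>b\<in>B. u \<lhd> b)"
  proof (rule saturation)
    show "small A" by (rule small_mono[OF _ U]) (simp add: AB[symmetric])
    show "small B" by (rule small_mono[OF _ U]) (simp add: AB[symmetric])
    fix a b assume "a \<in> A" "b \<in> B"
    then obtain c0 c1 where c: "c0 \<in> C" "\<forall>c\<in>C. c0 \<sqsubseteq> c \<longrightarrow> a \<lhd> c"
      "c1 \<in> C" "\<forall>c\<in>C. c1 \<sqsubseteq> c \<longrightarrow> c \<lhd> b" by (auto simp: A_def B_def)
    then obtain c where "c \<in> C" "c0 \<sqsubseteq> c" "c1 \<sqsubseteq> c" using common[of c0 c1] by blast
    then show "a \<lhd> b" using c less_trans[of "qq a" "qq c" "qq b"] by simp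
  qed
  then obtain u where u: "\<And>a. a \<in> A \<Longrightarrow> a \<lhd> u" "\<And>b. b \<in> B \<Longrightarrow> u \<lhd> b" by blast
  have "c \<sqsubseteq> u" if c: "c \<in> C" for c
    unfolding tle_def
  proof (intro allI impI)
    fix z assume z: "qq c \<le> qq z \<and> qq z \<le> qq u \<or> qq u \<le> qq z \<and> qq z \<le> qq c"
    show "c \<le> z"
    proof (rule ccontr)
      assume "\<not> c \<le> z"
      then have zc: "z < c" by simp
      then have "z \<in> A \<union> B" using c by (auto simp: AB U_def)
      then consider "z \<in> A" | "z \<in> B" by blast
      then show False
      proof cases
        case 1
        then obtain c0 where c0: "c0 \<in> C" "\<forall>c\<in>C. c0 \<sqsubseteq> c \<longrightarrow> z \<lhd> c" by (auto simp: A_def)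
        then obtain c' where "c' \<in> C" "c0 \<sqsubseteq> c'" "c \<sqsubseteq> c'" using common[of c0 c] c by blast
        then have "z \<lhd> c" using side[OF zc, of c'] c0 by fastforce
        then show False using z u(1)[OF 1] by auto
      next
        case 2
        then obtain c0 where c0: "c0 \<in> C" "\<forall>c\<in>C. c0 \<sqsubseteq> c \<longrightarrow> c \<lhd> z" by (auto simp: B_def)
        then obtain c' where "c' \<in> C" "c0 \<sqsubseteq> c'" "c \<sqsubseteq> c'" using common[of c0 c] c by blast
        then have "c \<lhd> z" using side[OF zc, of c'] c0 by fastforce
        then show False using z u(2)[OF 2] by auto
      qed
    qed
  qed
  then show ?thesis by blast
qed

subsection \<open>Levels\<close>

text \<open>The rank in the tree order; the recursion terminates because proper ancestors have
  smaller indices.\<close>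

function lev :: "'k \<Rightarrow> 'k" where
  "lev t = (LEAST \<beta>. \<forall>s. s \<sqsubseteq> t \<and> s \<noteq> t \<longrightarrow> lev s < \<beta>)"
  by auto
termination
proof (relation "{(x, y). x < y}")
  show "wf {(x, y). x < (y::'k)}" by (rule wf)
  fix t s :: 'k assume "s \<sqsubseteq> t \<and> s \<noteq> t"
  then show "(s, t) \<in> {(x, y). x < y}" using tle_le[of s t] by auto
qed

declare lev.simps [simp del]

lemma lev_le: "lev t \<le> t"
proof (induction t rule: less_induct)
  case (less t)
  have "lev s < t" if "s \<sqsubseteq> t" "s \<noteq> t" for s
  proof -
    have "s < t" using tle_le[OF that(1)] that(2) by simp
    then show ?thesis using less le_less_trans by blast
  qed
  then show ?case unfolding lev.simps[of t] by (intro Least_le) blast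
qed

lemma lev_less: "s \<sqsubseteq> t \<Longrightarrow> s \<noteq> t \<Longrightarrow> lev s < lev t"
proof -
  have "\<forall>s. s \<sqsubseteq> t \<and> s \<noteq> t \<longrightarrow> lev s < t"
  proof (intro allI impI)
    fix s assume "s \<sqsubseteq> t \<and> s \<noteq> t"
    then have "s < t" using tle_le[of s t] by (simp add: less_le)
    then show "lev s < t" using lev_le[of s] by simp
  qed
  then have "\<forall>s. s \<sqsubseteq> t \<and> s \<noteq> t \<longrightarrow> lev s < lev t"
    unfolding lev.simps[of t] by (rule LeastI)
  then show "s \<sqsubseteq> t \<Longrightarrow> s \<noteq> t \<Longrightarrow> lev s < lev t" by blast
qed

lemma lev_mono: "s \<sqsubseteq> t \<Longrightarrow> lev s \<le> lev t"
  using lev_less[of s t] by fastforce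

lemma lev_surj: "\<beta> \<le> lev t \<Longrightarrow> \<exists>s. s \<sqsubseteq> t \<and> lev s = \<beta>"
proof (induction t rule: less_induct)
  case (less t)
  show ?case
  proof (cases "\<beta> = lev t")
    case False
    then have "\<beta> < lev t" using less.prems by simp
    then have "\<not> (\<forall>s. s \<sqsubseteq> t \<and> s \<noteq> t \<longrightarrow> lev s < \<beta>)"
      unfolding lev.simps[of t] by (rule not_less_Least)
    then obtain s where s: "s \<sqsubseteq> t" "s \<noteq> t" "\<beta> \<le> lev s" by (auto simp: not_less)
    then have "s < t" using tle_le[of s t] by (simp add: less_le)
    then obtain s' where "s' \<sqsubseteq> s" "lev s' = \<beta>" using less.IH s(3) by blast
    then show ?thesis using s(1) tle_trans by blast
  qed (use tle_refl in blast)
qed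

lemma lev_unique: "s \<sqsubseteq> u \<Longrightarrow> t \<sqsubseteq> u \<Longrightarrow> lev s = lev t \<Longrightarrow> s = t"
  using tle_linear[of s u t] lev_less[of s t] lev_less[of t s] by auto

lemma lev_below: "s \<sqsubseteq> u \<Longrightarrow> t \<sqsubseteq> u \<Longrightarrow> lev s \<le> lev t \<Longrightarrow> s \<sqsubseteq> t"
  using tle_linear[of s u t] lev_less[of t s] by (cases "s = t") auto

definition rs :: "'k \<Rightarrow> 'k \<Rightarrow> 'k" where
  "rs t \<alpha> = (THE s. s \<sqsubseteq> t \<and> lev s = \<alpha>)"

lemma rs_eqI: "s \<sqsubseteq> t \<Longrightarrow> lev s = \<alpha> \<Longrightarrow> rs t \<alpha> = s"
  unfolding rs_def using lev_unique[of _ t s] by blast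

lemma rs: assumes "\<alpha> \<le> lev t" shows rs_tle: "rs t \<alpha> \<sqsubseteq> t" and lev_rs: "lev (rs t \<alpha>) = \<alpha>"
proof -
  obtain s where "s \<sqsubseteq> t" "lev s = \<alpha>" using lev_surj[OF assms] by blast
  then show "rs t \<alpha> \<sqsubseteq> t" "lev (rs t \<alpha>) = \<alpha>" using rs_eqI[of s t \<alpha>] by auto
qed

lemma rs_tle_eq: "s \<sqsubseteq> t \<Longrightarrow> \<alpha> \<le> lev s \<Longrightarrow> rs s \<alpha> = rs t \<alpha>"
  by (rule rs_eqI[symmetric]) (auto simp: lev_rs intro: tle_trans[OF rs_tle])

text \<open>A node is determined by its level and the set of levels at which its branch turns right:
  two nodes of one level part at their meet, where only the right one can turn right. So a level
  \<alpha> has at most as many nodes as there are subsets of \<alpha>.\<close>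

lemma small_level: "small {t. lev t = \<alpha>}"
proof (rule small_inj)
  let ?g = "\<lambda>t. {lev s |s. s \<sqsubseteq> t \<and> s \<lhd> t}"
  have *: False if st: "s \<lhd> t" "?g s = ?g t" "lev s = lev t" for s t
  proof -
    obtain m where m: "m \<sqsubseteq> s" "m \<sqsubseteq> t" "qq s \<le> qq m" "qq m \<le> qq t" using meet[OF st(1)] by blast
    have "m \<noteq> t" using lev_less[of t s] m st by force
    then have "m \<lhd> t" using m(4) by (simp add: order_le_less)
    then have "lev m \<in> ?g t" using m by auto
    then have "lev m \<in> ?g s" using st by simp
    then obtain r where "r \<sqsubseteq> s" "r \<lhd> s" "lev r = lev m" by auto
    then have "r = m" using lev_unique m by blast
    then show False using \<open>r \<lhd> s\<close> m by simp
  qed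
  show "inj_on ?g {t. lev t = \<alpha>}"
  proof (rule inj_onI)
    fix s t assume "s \<in> {t. lev t = \<alpha>}" "t \<in> {t. lev t = \<alpha>}" "?g s = ?g t"
    then show "s = t" using *[of s t] *[of t s] lss_linear[of s t] by auto
  qed
  show "?g ` {t. lev t = \<alpha>} \<subseteq> Pow {..<\<alpha>}" using lev_less by force
  show "small (Pow {..<\<alpha>})" by (intro small_Pow small_lessThan)
qed

lemma small_level_le: "small {t. lev t \<le> \<alpha>}"
proof -
  have "{t. lev t \<le> \<alpha>} = (\<Union>\<beta>\<in>{..<osuc \<alpha>}. {t. lev t = \<beta>})" by (auto simp: less_osuc_iff)
  then show ?thesis using small_UN[OF small_lessThan small_level] by simp
qed

lemma chain_small: "chain C \<Longrightarrow> (\<And>c. c \<in> C \<Longrightarrow> lev c \<le> \<alpha>) \<Longrightarrow> small C"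
  by (rule small_mono[OF _ small_level_le[of \<alpha>]]) auto

lemma chain_insert: "chain C \<Longrightarrow> \<forall>c\<in>C. c \<sqsubseteq> u \<Longrightarrow> chain (insert u C)"
  by (auto simp: chain_def)

text \<open>A maximal chain reaches level \<alpha>: if it did not, it would be small and hence
  bounded, and a left extension of a bound could be added to it. Its member at or above \<alpha> is
  then cut down to level \<alpha>.\<close>

lemma chain_level_bound:
  assumes C: "chain C" and le: "\<And>c. c \<in> C \<Longrightarrow> lev c \<le> \<alpha>"
  shows "\<exists>u. lev u = \<alpha> \<and> (\<forall>c\<in>C. c \<sqsubseteq> u)"
proof -
  have Ch: "C \<in> Chains {(s, t). s \<sqsubseteq> t} \<longleftrightarrow> chain C" for C
    by (simp add: Chains_def chain_def)
  obtain M where "maximal_path {(s, t). s \<sqsubseteq> t} M" and "C \<subseteq> M"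
    using maximal_path_extends[of C "{(s, t). s \<sqsubseteq> t}"] C Ch by auto
  then have M: "chain M" "C \<subseteq> M" by (simp_all add: maximal_path_def Ch)
  have max: "X = M" if "chain X" "M \<subseteq> X" for X
    using \<open>maximal_path _ M\<close> that by (simp add: maximal_path_def Ch)
  have "\<exists>u\<in>M. \<alpha> \<le> lev u"
  proof (rule ccontr)
    assume no: "\<not> ?thesis"
    have "lev c \<le> \<alpha>" if "c \<in> M" for c using no that linear[of "lev c" \<alpha>] by auto
    then have "small M" by (intro chain_small[OF M(1), of \<alpha>])
    then obtain u where u: "\<forall>c\<in>M. c \<sqsubseteq> u" using chain_upper_bound[OF M(1)] by blast
    obtain v where v: "u \<sqsubseteq> v" "v \<lhd> u" using left_ext by blast
    have "c \<sqsubseteq> v" if "c \<in> M" for c by (rule tle_trans[OF u[rule_format, OF that] v(1)])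
    then have "chain (insert v M)" by (intro chain_insert[OF M(1)]) simp
    then have "insert v M = M" by (rule max) (rule subset_insertI)
    then have "v \<sqsubseteq> u" using u by blast
    then have "u = v" by (rule tle_antisym[OF v(1)])
    then show False using v(2) by simp
  qed
  then obtain u where u: "u \<in> M" "\<alpha> \<le> lev u" by blast
  have "c \<sqsubseteq> rs u \<alpha>" if c: "c \<in> C" for c
  proof -
    have "c \<sqsubseteq> u \<or> u \<sqsubseteq> c" using M c u by (auto simp: chain_def)
    then show ?thesis
    proof
      assume "c \<sqsubseteq> u"
      then show ?thesis
        using lev_below[OF _ rs_tle[OF u(2)]] le[OF c] lev_rs[OF u(2)] by simp
    next
      assume *: "u \<sqsubseteq> c"
      then have "lev u = \<alpha>" using lev_mono[of u c] le[OF c] u(2) by simp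
      moreover have "u = c" using lev_less[OF *] le[OF c] u(2) by force
      ultimately show ?thesis using rs_eqI[of u u] by simp
    qed
  qed
  then show ?thesis using lev_rs[OF u(2)] by blast
qed

text \<open>If \<open>u\<close> and \<open>v\<close> differ, they part at a meet \<open>m\<close>
  below level \<xi>. As \<xi> is no successor, they still have a common ancestor just above
  \<open>m\<close>, and this puts both on the same side of \<open>m\<close>.\<close>

lemma nonsucc_unique:
  assumes \<xi>: "nonsucc \<xi>" and lev: "lev u = \<xi>" "lev v = \<xi>"
    and eq: "\<And>\<eta>. \<eta> < \<xi> \<Longrightarrow> rs u \<eta> = rs v \<eta>"
  shows "u = v"
proof -
  have *: False if "u \<lhd> v" and lev: "lev u = \<xi>" "lev v = \<xi>"
    and eq: "\<And>\<eta>. \<eta> < \<xi> \<Longrightarrow> rs u \<eta> = rs v \<eta>" for u v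
  proof -
    obtain m where m: "m \<sqsubseteq> u" "m \<sqsubseteq> v" "qq u \<le> qq m" "qq m \<le> qq v"
      using meet[OF \<open>u \<lhd> v\<close>] by blast
    have "u \<noteq> v" using \<open>u \<lhd> v\<close> by auto
    then have ne: "m \<noteq> u" "m \<noteq> v" using lev_less[of u v] lev_less[of v u] m lev by auto
    have lm: "lev m < \<xi>" using lev_less[OF m(1) ne(1)] lev by simp
    then have os: "osuc (lev m) < \<xi>" using nonsucc_osuc_less[OF \<xi>] by blast
    define c where "c = rs u (osuc (lev m))"
    have c: "c \<sqsubseteq> u" "c \<sqsubseteq> v" "lev c = osuc (lev m)"
      using rs[of "osuc (lev m)" u] rs[of "osuc (lev m)" v] eq[OF os] os lev by (auto simp: c_def)
    have "m \<sqsubseteq> c"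
      using lev_below[OF m(1) c(1)] c(3) less_imp_le[OF osuc_greater[of "lev m"]] by simp
    have "m \<noteq> c" using c(3) by (metis order_less_irrefl osuc_greater)
    then have "c \<lhd> m \<or> m \<lhd> c" using lss_linear[of c m] by auto
    moreover have "\<not> v \<lhd> m" "\<not> m \<lhd> u" using m by auto
    ultimately show False using side_left[OF \<open>m \<sqsubseteq> c\<close> c(2)] side_right[OF \<open>m \<sqsubseteq> c\<close> c(1)] by blast
  qed
  show ?thesis using *[of u v] *[of v u] assms lss_linear[of u v] by auto
qed

lemma left_child: "\<exists>u. t \<sqsubseteq> u \<and> u \<lhd> t \<and> lev u = osuc (lev t)"
proof -
  obtain c where c: "t \<sqsubseteq> c" "c \<lhd> t" using left_ext by blast
  then have "t \<noteq> c" by auto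
  then have l: "osuc (lev t) \<le> lev c" using lev_less[OF c(1)] osuc_leI by blast
  define u where "u = rs c (osuc (lev t))"
  have u: "u \<sqsubseteq> c" "lev u = osuc (lev t)" using rs[OF l] by (auto simp: u_def)
  then have tu: "t \<sqsubseteq> u" using lev_below[OF c(1) u(1)] by (simp add: less_imp_le)
  have "t \<noteq> u" using u by (metis order_less_irrefl osuc_greater)
  then have "u \<lhd> t" using lss_linear[of u t] side_right[OF tu u(1)] c(2) by auto
  with u tu show ?thesis by blast
qed

lemma right_child: "\<exists>u. t \<sqsubseteq> u \<and> t \<lhd> u \<and> lev u = osuc (lev t)"
proof -
  obtain c where c: "t \<sqsubseteq> c" "t \<lhd> c" using right_ext by blast
  then have "t \<noteq> c" by auto
  then have l: "osuc (lev t) \<le> lev c" using lev_less[OF c(1)] osuc_leI by blast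
  define u where "u = rs c (osuc (lev t))"
  have u: "u \<sqsubseteq> c" "lev u = osuc (lev t)" using rs[OF l] by (auto simp: u_def)
  then have tu: "t \<sqsubseteq> u" using lev_below[OF c(1) u(1)] by (simp add: less_imp_le)
  have "t \<noteq> u" using u by (metis order_less_irrefl osuc_greater)
  then have "t \<lhd> u" using lss_linear[of u t] side_left[OF tu u(1)] c(2) by auto
  with u tu show ?thesis by blast
qed

end

section \<open>Level enumerations, and nodes of prescribed height in trees given only as
  relations\<close>

lemma strict_mono_range_unique:
  fixes a b :: "'k::wellorder \<Rightarrow> 'k"
  assumes a: "strict_mono a" and b: "strict_mono b" and eq: "range a = range b"
  shows "a = b"
proof -
  have *: "b \<xi> \<le> a \<xi>"
    if a: "strict_mono a" and b: "strict_mono b" and eq: "range a = range b"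
      and IH: "\<And>\<eta>. \<eta> < \<xi> \<Longrightarrow> a \<eta> = b \<eta>" for a b :: "'k \<Rightarrow> 'k" and \<xi>
  proof -
    obtain \<zeta> where z: "a \<xi> = b \<zeta>" using eq by (metis rangeE rangeI)
    have "\<not> \<zeta> < \<xi>"
    proof
      assume "\<zeta> < \<xi>"
      then have "a \<zeta> < a \<xi>" "a \<zeta> = b \<zeta>" by (rule strict_monoD[OF a], rule IH)
      then show False using z by simp
    qed
    then show ?thesis using z strict_mono_less_eq[OF b, of \<xi> \<zeta>] by simp
  qed
  have "a \<xi> = b \<xi>" for \<xi>
  proof (induction \<xi> rule: less_induct)
    case (less \<xi>)
    have "b \<xi> \<le> a \<xi>" by (rule *[OF a b eq less])
    moreover have "a \<xi> \<le> b \<xi>" by (rule *[OF b a eq[symmetric] less[symmetric]])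
    ultimately show ?case by simp
  qed
  then show ?thesis by (rule ext)
qed

lemma ordIso_kappa_pullback:
  fixes \<phi> :: "'a \<Rightarrow> 'k::wellorder"
  assumes bij: "bij_betw \<phi> U UNIV"
    and ord: "\<And>s s'. s \<in> U \<Longrightarrow> s' \<in> U \<Longrightarrow> (s, s') \<in> S \<longleftrightarrow> \<phi> s \<le> \<phi> s'"
  shows "Restr S U =o (kappa :: 'k rel)"
proof -
  have F: "Field (Restr S U) = U" and W: "Well_order (Restr S U)"
    by (intro Well_order_Restr_pullback[OF bij_betw_imp_inj_on[OF bij]] ord; assumption)+
  have "iso (Restr S U) kappa \<phi>"
    unfolding iso_iff2 F Field_kappa using bij ord by (auto simp: kappa_def)
  then show ?thesis unfolding ordIso_def using W Well_order_kappa by blast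
qed

text \<open>Of the subtrees delivered by \<open>HL_tc\<close> only abstract heights are known; this
  lemma and the next find nodes of a given height in them.\<close>

lemma has_height_below:
  assumes po: "Partial_order S" and h: "has_height S t (\<xi>::'k::wellorder)" and lt: "\<eta> < \<xi>"
  shows "\<exists>s\<in>underS S t. has_height S s \<eta>"
proof -
  have refl: "(s, s) \<in> S" if "(s, s') \<in> S" for s s'
    using po that
    by (auto simp: partial_order_on_def preorder_on_def refl_on_def Field_def)
  have trans: "(s, s'') \<in> S" if "(s, s') \<in> S" "(s', s'') \<in> S" for s s' s''
    using po that unfolding partial_order_on_def preorder_on_def trans_def by blast
  have anti: "s = s'" if "(s, s') \<in> S" "(s', s) \<in> S" for s s'
    using po that unfolding partial_order_on_def antisym_def by blast
  obtain \<phi> where \<phi>: "bij_betw \<phi> (underS S t) {..<\<xi>}"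
    and ord: "\<And>s s'. s \<in> underS S t \<Longrightarrow> s' \<in> underS S t \<Longrightarrow> (s, s') \<in> S \<longleftrightarrow> \<phi> s \<le> \<phi> s'"
    using has_heightE[OF po h] by blast
  obtain s where s: "s \<in> underS S t" "\<phi> s = \<eta>"
    using \<phi> lt unfolding bij_betw_def by (metis imageE lessThan_iff)
  have sub: "r \<in> underS S t" if "r \<in> underS S s" for r
    using that s trans[of r s t] anti[of s t] by (auto simp: underS_def)
  have "has_height S s \<eta>"
  proof (rule has_heightI)
    show "bij_betw \<phi> (underS S s) {..<\<eta>}"
      unfolding bij_betw_def
    proof
      show "inj_on \<phi> (underS S s)"
        using \<phi> sub unfolding bij_betw_def by (meson inj_on_subset subsetI)
      show "\<phi> ` underS S s = {..<\<eta>}"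
      proof
        show "\<phi> ` underS S s \<subseteq> {..<\<eta>}"
        proof (rule image_subsetI)
          fix r assume r: "r \<in> underS S s"
          then have "\<phi> r \<le> \<eta>" using ord[OF sub[OF r] s(1)] s(2) by (auto simp: underS_def)
          moreover have "\<phi> r \<noteq> \<phi> s"
            using \<phi> sub[OF r] s(1) r by (auto simp: bij_betw_def underS_def dest: inj_onD)
          ultimately show "\<phi> r \<in> {..<\<eta>}" using s(2) by simp
        qed
        show "{..<\<eta>} \<subseteq> \<phi> ` underS S s"
        proof
          fix \<zeta> assume "\<zeta> \<in> {..<\<eta>}"
          then have z: "\<zeta> < \<eta>" "\<zeta> < \<xi>" using lt by auto
          then obtain r where r: "r \<in> underS S t" "\<phi> r = \<zeta>"
            using \<phi> unfolding bij_betw_def by (metis imageE lessThan_iff)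
          then have "(r, s) \<in> S" using ord[OF r(1) s(1)] z s(2) by simp
          moreover have "r \<noteq> s" using r s z by auto
          ultimately show "\<zeta> \<in> \<phi> ` underS S s" using r by (auto simp: underS_def)
        qed
      qed
    qed
  qed (use sub ord in blast)
  with s show ?thesis by blast
qed

text \<open>A maximal path is closed downwards, so the predecessors of its member number \<xi> are
  exactly its earlier members.\<close>

lemma maximal_path_height:
  assumes po: "Partial_order S"
    and lin: "\<And>r s t. (r, t) \<in> S \<Longrightarrow> (s, t) \<in> S \<Longrightarrow> (r, s) \<in> S \<or> (s, r) \<in> S"
    and M: "maximal_path S M" and iso: "Restr S M =o (kappa :: 'k::wellorder rel)"
  shows "\<exists>t\<in>M. has_height S t (\<xi>::'k)"
proof -
  have trans: "(s, s'') \<in> S" if "(s, s') \<in> S" "(s', s'') \<in> S" for s s' s''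
    using po that unfolding partial_order_on_def preorder_on_def trans_def by blast
  have refl: "(s, s) \<in> S" if "(s, s') \<in> S" for s s'
    using po that
    by (auto simp: partial_order_on_def preorder_on_def refl_on_def Field_def)
  have ch: "(s, t) \<in> S \<or> (t, s) \<in> S" if "s \<in> M" "t \<in> M" for s t
    using M that by (auto simp: maximal_path_def Chains_def)
  have down: "s \<in> M" if "t \<in> M" "(s, t) \<in> S" for s t
  proof -
    have "(s, c) \<in> S \<or> (c, s) \<in> S" if "c \<in> M" for c
      using ch[OF that \<open>t \<in> M\<close>] lin[OF \<open>(s, t) \<in> S\<close>, of c] trans[OF \<open>(s, t) \<in> S\<close>, of c] by blast
    then have "insert s M \<in> Chains S"
      using ch refl[OF \<open>(s, t) \<in> S\<close>] by (auto simp: Chains_def)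
    then have "insert s M = M" using M subset_insertI[of M s] unfolding maximal_path_def by blast
    then show ?thesis by blast
  qed
  have F: "Field (Restr S M) = M" using ch by (auto simp: Field_def)
  obtain f where "iso (Restr S M) (kappa :: 'k rel) f" using iso unfolding ordIso_def by blast
  then have f: "bij_betw f M UNIV"
    and ford: "\<And>a b. a \<in> M \<Longrightarrow> b \<in> M \<Longrightarrow> (a, b) \<in> S \<longleftrightarrow> f a \<le> f b"
    unfolding iso_iff2 F Field_kappa by (auto simp: kappa_def)
  obtain t where t: "t \<in> M" "f t = \<xi>" using f unfolding bij_betw_def by (metis imageE UNIV_I)
  have U: "underS S t = {s \<in> M. f s < \<xi>}"
  proof (intro equalityI subsetI)
    fix s assume s: "s \<in> underS S t"
    then have sM: "s \<in> M" using down[OF t(1)] by (auto simp: underS_def)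
    moreover have "f s \<le> \<xi>" using ford[OF sM t(1)] s t(2) by (auto simp: underS_def)
    moreover have "f s \<noteq> f t"
      using f sM t(1) s by (auto simp: bij_betw_def underS_def dest: inj_onD)
    ultimately show "s \<in> {s \<in> M. f s < \<xi>}" using t(2) by simp
  next
    fix s assume "s \<in> {s \<in> M. f s < \<xi>}"
    then show "s \<in> underS S t" using ford[of s t] t by (auto simp: underS_def)
  qed
  have "has_height S t \<xi>"
  proof (rule has_heightI)
    have "f ` {s \<in> M. f s < \<xi>} = {..<\<xi>}"
    proof (intro equalityI subsetI)
      fix \<zeta> assume "\<zeta> \<in> {..<\<xi>}"
      moreover obtain s where "s \<in> M" "f s = \<zeta>"
        using f unfolding bij_betw_def by (metis imageE UNIV_I)
      ultimately show "\<zeta> \<in> f ` {s \<in> M. f s < \<xi>}" by auto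
    qed auto
    then show "bij_betw f (underS S t) {..<\<xi>}"
      unfolding U bij_betw_def using f
      by (auto simp: bij_betw_def intro: inj_on_subset)
  qed (use U ford in auto)
  with t show ?thesis by blast
qed

context treap
begin

section \<open>Subtrees\<close>

definition RT :: "'k set \<Rightarrow> 'k rel" where
  "RT Y = {(s, t). s \<in> Y \<and> t \<in> Y \<and> s \<sqsubseteq> t}"

text \<open>
  \<open>a\<close> enumerates the levels of the whole tree that \<open>Y\<close> meets, so level \<open>\<xi>\<close> of the tree \<open>RT Y\<close>
  consists of the nodes of \<open>Y\<close> of level \<open>a \<xi>\<close>.
\<close>

definition sub :: "'k set \<Rightarrow> ('k \<Rightarrow> 'k) \<Rightarrow> bool" where
  "sub Y a \<longleftrightarrow> strict_mono a \<and> (\<forall>t\<in>Y. lev t \<in> range a) \<and>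
    (\<forall>t\<in>Y. \<forall>\<xi>. a \<xi> \<le> lev t \<longrightarrow> rs t (a \<xi>) \<in> Y) \<and>
    (\<forall>C \<xi>. C \<subseteq> Y \<longrightarrow> chain C \<longrightarrow> (\<forall>c\<in>C. lev c \<le> a \<xi>) \<longrightarrow>
      (\<exists>u\<in>Y. lev u = a \<xi> \<and> (\<forall>c\<in>C. c \<sqsubseteq> u))) \<and>
    (\<forall>\<xi> u v. nonsucc \<xi> \<longrightarrow> u \<in> Y \<longrightarrow> v \<in> Y \<longrightarrow> lev u = a \<xi> \<longrightarrow> lev v = a \<xi> \<longrightarrow>
      (\<forall>\<eta><\<xi>. rs u (a \<eta>) = rs v (a \<eta>)) \<longrightarrow> u = v) \<and>
    (\<forall>t\<in>Y. \<forall>\<xi>. lev t = a \<xi> \<longrightarrow>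
      (\<exists>u\<in>Y. t \<sqsubseteq> u \<and> u \<lhd> t \<and> lev u = a (osuc \<xi>)) \<and>
      (\<exists>u\<in>Y. t \<sqsubseteq> u \<and> t \<lhd> u \<and> lev u = a (osuc \<xi>)))"

lemma
  assumes "sub Y a"
  shows sub_strict_mono: "strict_mono a"
    and sub_lev: "t \<in> Y \<Longrightarrow> \<exists>\<xi>. lev t = a \<xi>"
    and sub_rs: "t \<in> Y \<Longrightarrow> a \<xi> \<le> lev t \<Longrightarrow> rs t (a \<xi>) \<in> Y"
    and sub_chain: "C \<subseteq> Y \<Longrightarrow> chain C \<Longrightarrow> (\<And>c. c \<in> C \<Longrightarrow> lev c \<le> a \<xi>) \<Longrightarrow>
      \<exists>u\<in>Y. lev u = a \<xi> \<and> (\<forall>c\<in>C. c \<sqsubseteq> u)"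
    and sub_unique: "nonsucc \<xi> \<Longrightarrow> u \<in> Y \<Longrightarrow> v \<in> Y \<Longrightarrow> lev u = a \<xi> \<Longrightarrow> lev v = a \<xi> \<Longrightarrow>
      (\<And>\<eta>. \<eta> < \<xi> \<Longrightarrow> rs u (a \<eta>) = rs v (a \<eta>)) \<Longrightarrow> u = v"
    and sub_left: "t \<in> Y \<Longrightarrow> lev t = a \<xi> \<Longrightarrow> \<exists>u\<in>Y. t \<sqsubseteq> u \<and> u \<lhd> t \<and> lev u = a (osuc \<xi>)"
    and sub_right: "t \<in> Y \<Longrightarrow> lev t = a \<xi> \<Longrightarrow> \<exists>u\<in>Y. t \<sqsubseteq> u \<and> t \<lhd> u \<and> lev u = a (osuc \<xi>)"
proof -
  note s1 = assms[unfolded sub_def]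
  note a = s1[THEN conjunct1] and s2 = s1[THEN conjunct2]
  note l = s2[THEN conjunct1] and s3 = s2[THEN conjunct2]
  note r = s3[THEN conjunct1] and s4 = s3[THEN conjunct2]
  note c = s4[THEN conjunct1] and s5 = s4[THEN conjunct2]
  note u = s5[THEN conjunct1] and b = s5[THEN conjunct2]
  show "strict_mono a" by (rule a)
  show "\<exists>\<xi>. lev t = a \<xi>" if "t \<in> Y" using l that by auto
  show "rs t (a \<xi>) \<in> Y" if "t \<in> Y" "a \<xi> \<le> lev t" using r that by simp
  show "\<exists>u\<in>Y. lev u = a \<xi> \<and> (\<forall>c\<in>C. c \<sqsubseteq> u)"
    if "C \<subseteq> Y" "chain C" "\<And>c. c \<in> C \<Longrightarrow> lev c \<le> a \<xi>"
    using c that by simp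
  show "u = v" if "nonsucc \<xi>" "u \<in> Y" "v \<in> Y" "lev u = a \<xi>" "lev v = a \<xi>"
      "\<And>\<eta>. \<eta> < \<xi> \<Longrightarrow> rs u (a \<eta>) = rs v (a \<eta>)"
    by (rule u[THEN spec, THEN spec, THEN spec, THEN mp, THEN mp, THEN mp, THEN mp, THEN mp, THEN mp,
        of \<xi>]) (use that in simp_all)
  show "\<exists>u\<in>Y. t \<sqsubseteq> u \<and> u \<lhd> t \<and> lev u = a (osuc \<xi>)" if "t \<in> Y" "lev t = a \<xi>"
    using b that by simp
  show "\<exists>u\<in>Y. t \<sqsubseteq> u \<and> t \<lhd> u \<and> lev u = a (osuc \<xi>)" if "t \<in> Y" "lev t = a \<xi>"
    using b that by simp
qed

lemma sub_extend:
  assumes "sub Y a" "t \<in> Y" "lev t \<le> a \<xi>"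
  shows "\<exists>u\<in>Y. lev u = a \<xi> \<and> t \<sqsubseteq> u"
  using sub_chain[OF assms(1), of "{t}" \<xi>] assms(2,3) by (auto simp: chain_def)

lemma sub_nonempty: "sub Y a \<Longrightarrow> \<exists>u\<in>Y. lev u = a \<xi>"
  using sub_chain[of Y a "{}" \<xi>] by (auto simp: chain_def)

lemma sub_UNIV: "sub UNIV (\<lambda>\<xi>. \<xi>)"
  unfolding sub_def
proof (intro conjI allI impI ballI)
  fix C \<xi> assume "chain C" "\<forall>c\<in>C. lev c \<le> \<xi>"
  then show "\<exists>u\<in>UNIV. lev u = \<xi> \<and> (\<forall>c\<in>C. c \<sqsubseteq> u)"
    using chain_level_bound[of C \<xi>] by simp
next
  fix \<xi> u v assume "nonsucc \<xi>" "lev u = \<xi>" "lev v = \<xi>" "\<forall>\<eta><\<xi>. rs u \<eta> = rs v \<eta>"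
  then show "u = v" using nonsucc_unique[of \<xi> u v] by simp
next
  fix t \<xi> assume "lev t = \<xi>"
  then show "\<exists>u\<in>UNIV. t \<sqsubseteq> u \<and> u \<lhd> t \<and> lev u = osuc \<xi>"
    "\<exists>u\<in>UNIV. t \<sqsubseteq> u \<and> t \<lhd> u \<and> lev u = osuc \<xi>"
    using left_child[of t] right_child[of t] by simp_all
qed (auto simp: strict_mono_def)

text \<open>Only the uniqueness clause is delicate. It survives because \<open>b\<close> is
  continuous at nonsuccessors, so that agreement on the kept levels below \<open>b \<xi>\<close> is
  agreement on all levels of \<open>Y\<close> below it.\<close>

lemma sub_thin:
  assumes Y: "sub Y a" and b: "strict_mono b"
    and cont: "\<And>\<xi> \<zeta>. nonsucc \<xi> \<Longrightarrow> \<zeta> < b \<xi> \<Longrightarrow> \<exists>\<eta><\<xi>. \<zeta> \<le> b \<eta>"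
  shows "sub {t \<in> Y. lev t \<in> range (a \<circ> b)} (a \<circ> b)" (is "sub ?Z _")
proof -
  note a = sub_strict_mono[OF Y]
  \<comment> \<open>The immediate child in \<open>Y\<close> decides the side of a node; any
    extension of that child to the next kept level stays on this side.\<close>
  have child: "\<exists>v\<in>?Z. lev v = (a \<circ> b) (osuc \<xi>) \<and> u \<sqsubseteq> v"
    if u: "u \<in> Y" "lev u = a (osuc (b \<xi>))" for u \<xi>
  proof -
    have "osuc (b \<xi>) \<le> b (osuc \<xi>)" using strict_monoD[OF b osuc_greater] osuc_leI by blast
    then have "lev u \<le> a (b (osuc \<xi>))" using u strict_mono_less_eq[OF a] by simp
    then obtain v where "v \<in> Y" "lev v = a (b (osuc \<xi>))" "u \<sqsubseteq> v"
      using sub_extend[OF Y u(1)] by blast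
    then show ?thesis by (intro bexI[of _ v]) auto
  qed
  show ?thesis
    unfolding sub_def
  proof (intro conjI allI impI ballI)
    show "strict_mono (a \<circ> b)" using a b by (simp add: strict_mono_def)
  next
    fix t \<xi> assume t: "t \<in> ?Z" and le: "(a \<circ> b) \<xi> \<le> lev t"
    then have "rs t (a (b \<xi>)) \<in> Y" using sub_rs[OF Y] by simp
    then show "rs t ((a \<circ> b) \<xi>) \<in> ?Z" using lev_rs[OF le] by auto
  next
    fix C \<xi> assume "C \<subseteq> ?Z" "chain C" "\<forall>c\<in>C. lev c \<le> (a \<circ> b) \<xi>"
    then obtain u where "u \<in> Y" "lev u = a (b \<xi>)" "\<forall>c\<in>C. c \<sqsubseteq> u"
      using sub_chain[OF Y, of C "b \<xi>"] by auto
    then show "\<exists>u\<in>?Z. lev u = (a \<circ> b) \<xi> \<and> (\<forall>c\<in>C. c \<sqsubseteq> u)" by (intro bexI[of _ u]) auto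
  next
    fix \<xi> u v assume \<xi>: "nonsucc \<xi>" and u: "u \<in> ?Z" "lev u = (a \<circ> b) \<xi>"
      and v: "v \<in> ?Z" "lev v = (a \<circ> b) \<xi>"
      and eq: "\<forall>\<eta><\<xi>. rs u ((a \<circ> b) \<eta>) = rs v ((a \<circ> b) \<eta>)"
    \<comment> \<open>If \<open>b \<xi>\<close> were the successor of \<zeta>, continuity would give
      an earlier \<eta> with \<open>\<zeta> \<le> b \<eta>\<close>, yet the two values
      \<open>b \<eta> < b (osuc \<eta>)\<close> both fit below \<open>b \<xi>\<close>.\<close>
    have "nonsucc (b \<xi>)"
      unfolding nonsucc_def
    proof
      assume "\<exists>\<zeta>. b \<xi> = osuc \<zeta>"
      then obtain \<zeta> where z: "b \<xi> = osuc \<zeta>" by blast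
      then obtain \<eta> where \<eta>: "\<eta> < \<xi>" "\<zeta> \<le> b \<eta>" using cont[OF \<xi>, of \<zeta>] by auto
      have "b \<eta> < b (osuc \<eta>)" "b (osuc \<eta>) < b \<xi>"
        using strict_monoD[OF b] nonsucc_osuc_less[OF \<xi> \<eta>(1)] osuc_greater by blast+
      then have "b \<eta> < \<zeta>" unfolding z less_osuc_iff by simp
      then show False using \<eta>(2) by simp
    qed
    moreover have "rs u (a \<zeta>) = rs v (a \<zeta>)" if z: "\<zeta> < b \<xi>" for \<zeta>
    proof -
      obtain \<eta> where \<eta>: "\<eta> < \<xi>" "\<zeta> \<le> b \<eta>" using cont[OF \<xi> z] by blast
      have le: "a (b \<eta>) \<le> lev u" "a (b \<eta>) \<le> lev v" "a \<zeta> \<le> a (b \<eta>)"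
        using u v \<eta> strict_mono_less_eq[OF a] strict_mono_less_eq[OF b] by auto
      have "rs u (a \<zeta>) = rs (rs u (a (b \<eta>))) (a \<zeta>)"
        using rs_tle_eq[OF rs_tle[OF le(1)]] le lev_rs[OF le(1)] by simp
      also have "\<dots> = rs v (a \<zeta>)"
        using rs_tle_eq[OF rs_tle[OF le(2)]] le lev_rs[OF le(2)] eq \<eta>(1) by simp
      finally show ?thesis .
    qed
    ultimately show "u = v" using sub_unique[OF Y, of "b \<xi>" u v] u v by auto
  next
    fix t \<xi> assume t: "t \<in> ?Z" "lev t = (a \<circ> b) \<xi>"
    have tY: "t \<in> Y" "lev t = a (b \<xi>)" using t by auto
    obtain u where u: "u \<in> Y" "t \<sqsubseteq> u" "u \<lhd> t" "lev u = a (osuc (b \<xi>))"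
      using sub_left[OF Y tY] by blast
    then obtain v where "v \<in> ?Z" "lev v = (a \<circ> b) (osuc \<xi>)" "u \<sqsubseteq> v" using child by blast
    then show "\<exists>u\<in>?Z. t \<sqsubseteq> u \<and> u \<lhd> t \<and> lev u = (a \<circ> b) (osuc \<xi>)"
      using tle_trans[OF u(2)] side_left[OF u(2) _ u(3)] by blast
    obtain u where u: "u \<in> Y" "t \<sqsubseteq> u" "t \<lhd> u" "lev u = a (osuc (b \<xi>))"
      using sub_right[OF Y tY] by blast
    then obtain v where "v \<in> ?Z" "lev v = (a \<circ> b) (osuc \<xi>)" "u \<sqsubseteq> v" using child by blast
    then show "\<exists>u\<in>?Z. t \<sqsubseteq> u \<and> t \<lhd> u \<and> lev u = (a \<circ> b) (osuc \<xi>)"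
      using tle_trans[OF u(2)] side_right[OF u(2) _ u(3)] by blast
  qed auto
qed

subsection \<open>Subtrees are nice trees\<close>

lemma Field_RT: "Field (RT Y) = Y"
  by (auto simp: RT_def Field_def)

lemma Partial_order_RT: "Partial_order (RT Y)"
  unfolding partial_order_on_def preorder_on_def Field_RT
  by (auto simp: RT_def refl_on_def trans_def antisym_def intro: tle_trans tle_antisym)

lemma underS_RT: "t \<in> Y \<Longrightarrow> underS (RT Y) t = {s \<in> Y. s \<sqsubseteq> t \<and> s \<noteq> t}"
  by (auto simp: RT_def underS_def)

lemma chain_iff_Chains: "C \<in> Chains (RT Y) \<longleftrightarrow> C \<subseteq> Y \<and> chain C"
  by (auto simp: Chains_def chain_def RT_def)

lemma RT_linear: "(r, t) \<in> RT Y \<Longrightarrow> (s, t) \<in> RT Y \<Longrightarrow> (r, s) \<in> RT Y \<or> (s, r) \<in> RT Y"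
  using tle_linear by (auto simp: RT_def)

lemma rs_less: "\<alpha> < lev t \<Longrightarrow> rs t \<alpha> \<noteq> t"
  using lev_rs[of \<alpha> t] by (metis less_imp_le order_less_irrefl)

lemma sub_has_height:
  assumes Y: "sub Y a" and t: "t \<in> Y" "lev t = a \<xi>"
  shows "has_height (RT Y) t \<xi>"
proof (rule has_heightI)
  note a = sub_strict_mono[OF Y]
  define ia where "ia = inv a"
  have ia: "ia (a \<eta>) = \<eta>" for \<eta>
    unfolding ia_def by (rule inv_f_f[OF strict_mono_imp_inj_on[OF a]])
  have aia: "a (ia (lev s)) = lev s" if "s \<in> Y" for s
    using sub_lev[OF Y that] ia by auto
  have U: "underS (RT Y) t = {s \<in> Y. s \<sqsubseteq> t \<and> s \<noteq> t}" by (rule underS_RT[OF t(1)])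
  show "bij_betw (\<lambda>s. ia (lev s)) (underS (RT Y) t) {..<\<xi>}"
    unfolding U
  proof (rule bij_betw_byWitness[where f' = "\<lambda>\<eta>. rs t (a \<eta>)"])
    show "\<forall>s\<in>{s \<in> Y. s \<sqsubseteq> t \<and> s \<noteq> t}. rs t (a (ia (lev s))) = s"
      using rs_eqI aia by simp
    show "\<forall>\<eta>\<in>{..<\<xi>}. ia (lev (rs t (a \<eta>))) = \<eta>"
      using lev_rs[of _ t] t(2) strict_mono_less_eq[OF a] ia by (simp add: less_imp_le)
    show "(\<lambda>s. ia (lev s)) ` {s \<in> Y. s \<sqsubseteq> t \<and> s \<noteq> t} \<subseteq> {..<\<xi>}"
    proof (rule image_subsetI)
      fix s assume s: "s \<in> {s \<in> Y. s \<sqsubseteq> t \<and> s \<noteq> t}"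
      then have "a (ia (lev s)) < a \<xi>" using lev_less[of s t] aia[of s] t(2) by simp
      then show "ia (lev s) \<in> {..<\<xi>}" using strict_mono_less[OF a] by simp
    qed
    show "(\<lambda>\<eta>. rs t (a \<eta>)) ` {..<\<xi>} \<subseteq> {s \<in> Y. s \<sqsubseteq> t \<and> s \<noteq> t}"
    proof (rule image_subsetI)
      fix \<eta> assume "\<eta> \<in> {..<\<xi>}"
      then have lt: "a \<eta> < lev t" using t(2) strict_mono_less[OF a] by simp
      then show "rs t (a \<eta>) \<in> {s \<in> Y. s \<sqsubseteq> t \<and> s \<noteq> t}"
        using sub_rs[OF Y t(1), of \<eta>] rs_tle[of "a \<eta>" t] rs_less[OF lt] by auto
    qed
  qed
  fix s s' assume "s \<in> underS (RT Y) t" "s' \<in> underS (RT Y) t"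
  then have s: "s \<in> Y" "s \<sqsubseteq> t" "s' \<in> Y" "s' \<sqsubseteq> t" by (auto simp: U)
  have "ia (lev s) \<le> ia (lev s') \<longleftrightarrow> lev s \<le> lev s'"
    using strict_mono_less_eq[OF a, of "ia (lev s)" "ia (lev s')"] aia s by simp
  also have "\<dots> \<longleftrightarrow> s \<sqsubseteq> s'" using lev_below[OF s(2,4)] lev_mono[of s s'] by blast
  finally show "(s, s') \<in> RT Y \<longleftrightarrow> ia (lev s) \<le> ia (lev s')" using s by (simp add: RT_def)
qed

lemma sub_level:
  assumes Y: "sub Y a"
  shows "level (RT Y) \<xi> = {t \<in> Y. lev t = a \<xi>}"
proof (intro equalityI subsetI)
  fix t assume "t \<in> level (RT Y) \<xi>"
  then have t: "t \<in> Y" "has_height (RT Y) t \<xi>" by (auto simp: level_def Field_RT)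
  obtain \<eta> where \<eta>: "lev t = a \<eta>" using sub_lev[OF Y t(1)] by blast
  have "\<eta> = \<xi>" using height_unique[OF sub_has_height[OF Y t(1) \<eta>] t(2)] .
  then show "t \<in> {t \<in> Y. lev t = a \<xi>}" using t \<eta> by simp
qed (auto simp: level_def Field_RT intro: sub_has_height[OF Y])

definition ord0 :: 'k where "ord0 = (LEAST x. True)"

lemma ord0_le [simp]: "ord0 \<le> x"
  unfolding ord0_def by (rule Least_le) simp

lemma not_less_ord0 [simp]: "\<not> x < ord0"
  using ord0_le[of x] by (simp add: not_less)

lemma nonsucc_ord0: "nonsucc ord0"
  unfolding nonsucc_def using osuc_greater not_less_ord0 by metis

text \<open>By maximality \<open>M\<close> contains every node comparable with all of
  \<open>M\<close>. Such a node exists on each level: an ancestor of a member where \<open>M\<close>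
  goes that high, and otherwise a bound given by the chain clause.\<close>

lemma sub_maximal_path:
  assumes Y: "sub Y a" and M: "maximal_path (RT Y) M"
  shows "Restr (RT Y) M =o (kappa :: 'k rel)"
proof -
  note a = sub_strict_mono[OF Y]
  have MY: "M \<subseteq> Y" and ch: "chain M" using M chain_iff_Chains by (auto simp: maximal_path_def)
  have max: "u \<in> M" if "u \<in> Y" "\<And>c. c \<in> M \<Longrightarrow> c \<sqsubseteq> u \<or> u \<sqsubseteq> c" for u
  proof -
    have "chain (insert u M)" using ch that(2) tle_refl by (auto simp: chain_def)
    then have "insert u M \<in> Chains (RT Y)" using MY that(1) chain_iff_Chains by simp
    then have "insert u M = M" using M subset_insertI[of M u] by (simp add: maximal_path_def)
    then show ?thesis by blast
  qed
  have ex: "\<exists>t\<in>M. lev t = a \<xi>" for \<xi>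
  proof (cases "\<exists>t\<in>M. a \<xi> \<le> lev t")
    case True
    then obtain t where t: "t \<in> M" "a \<xi> \<le> lev t" by blast
    have "rs t (a \<xi>) \<in> M"
    proof (rule max)
      show "rs t (a \<xi>) \<in> Y" using sub_rs[OF Y] t MY by blast
      fix c assume "c \<in> M"
      then have "c \<sqsubseteq> t \<or> t \<sqsubseteq> c" using ch t(1) by (simp add: chain_def)
      then show "c \<sqsubseteq> rs t (a \<xi>) \<or> rs t (a \<xi>) \<sqsubseteq> c"
        using tle_linear[OF _ rs_tle[OF t(2)]] tle_trans[OF rs_tle[OF t(2)]] by blast
    qed
    then show ?thesis using lev_rs[OF t(2)] by blast
  next
    case False
    have "lev c \<le> a \<xi>" if "c \<in> M" for c using False that linear[of "lev c" "a \<xi>"] by auto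
    then obtain u where u: "u \<in> Y" "lev u = a \<xi>" "\<forall>c\<in>M. c \<sqsubseteq> u"
      using sub_chain[OF Y MY ch, of \<xi>] by blast
    then have "u \<in> M" by (intro max) auto
    then show ?thesis using u by blast
  qed
  define ia where "ia = inv a"
  have ia: "ia (a \<eta>) = \<eta>" for \<eta>
    unfolding ia_def by (rule inv_f_f[OF strict_mono_imp_inj_on[OF a]])
  have aia: "a (ia (lev s)) = lev s" if s: "s \<in> M" for s
  proof -
    obtain \<eta> where "lev s = a \<eta>" using sub_lev[OF Y] s MY by blast
    then show ?thesis by (simp add: ia)
  qed
  have ord: "(s, s') \<in> RT Y \<longleftrightarrow> ia (lev s) \<le> ia (lev s')" if s: "s \<in> M" "s' \<in> M" for s s'
  proof -
    have "ia (lev s) \<le> ia (lev s') \<longleftrightarrow> lev s \<le> lev s'"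
      using strict_mono_less_eq[OF a, of "ia (lev s)" "ia (lev s')"] aia s by simp
    also have "\<dots> \<longleftrightarrow> s \<sqsubseteq> s'"
    proof
      assume le: "lev s \<le> lev s'"
      have "s \<sqsubseteq> s' \<or> s' \<sqsubseteq> s" using ch s by (simp add: chain_def)
      then show "s \<sqsubseteq> s'" using le lev_less[of s' s] by (cases "s = s'") auto
    qed (rule lev_mono)
    finally show ?thesis using s MY by (auto simp: RT_def)
  qed
  show ?thesis
  proof (rule ordIso_kappa_pullback)
    show "bij_betw (\<lambda>s. ia (lev s)) M UNIV"
      unfolding bij_betw_def
    proof
      show "inj_on (\<lambda>s. ia (lev s)) M"
      proof (rule inj_onI)
        fix s s' assume s: "s \<in> M" "s' \<in> M" and "ia (lev s) = ia (lev s')"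
        then have "s \<sqsubseteq> s'" "s' \<sqsubseteq> s" using ord[of s s'] ord[of s' s] by (auto simp: RT_def)
        then show "s = s'" by (rule tle_antisym)
      qed
      show "(\<lambda>s. ia (lev s)) ` M = UNIV"
      proof (intro equalityI subsetI UNIV_I)
        fix \<xi> obtain t where "t \<in> M" "lev t = a \<xi>" using ex by blast
        then show "\<xi> \<in> (\<lambda>s. ia (lev s)) ` M" by (intro image_eqI[of _ _ t]) (simp_all add: ia)
      qed
    qed
  qed (rule ord)
qed

lemma sub_nice_tree:
  assumes Y: "sub Y a"
  shows "nice_tree TYPE('k) (RT Y)"
  unfolding nice_tree_def
proof (intro conjI allI ballI impI)
  note a = sub_strict_mono[OF Y]
  show "tree (RT Y)"
    unfolding tree_def Field_RT
  proof (intro conjI ballI)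
    show "partial_order_on Y (RT Y)" using Partial_order_RT[of Y] unfolding Field_RT .
    fix t assume t: "t \<in> Y"
    obtain \<xi> where "lev t = a \<xi>" using sub_lev[OF Y t] by blast
    then show "Well_order (Restr (RT Y) (underS (RT Y) t))"
      using sub_has_height[OF Y t] by (auto simp: has_height_def ordIso_def)
  qed
  \<comment> \<open>At \<open>ord0\<close> the uniqueness clause has an empty hypothesis about
    smaller levels, so it says that there is only one root.\<close>
  show "\<exists>!t. t \<in> Field (RT Y) \<and> underS (RT Y) t = {}"
  proof -
    obtain r where r: "r \<in> Y" "lev r = a ord0" using sub_nonempty[OF Y] by blast
    have "lev t = a ord0 \<longleftrightarrow> underS (RT Y) t = {}" if t: "t \<in> Y" for t
    proof
      assume l: "lev t = a ord0"
      have False if s: "s \<in> Y" "s \<sqsubseteq> t" "s \<noteq> t" for s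
      proof -
        obtain \<xi> where "lev s = a \<xi>" using sub_lev[OF Y s(1)] by blast
        then have "a \<xi> < a ord0" using lev_less[OF s(2,3)] l by simp
        then show False using strict_mono_less[OF a] by simp
      qed
      then show "underS (RT Y) t = {}" using underS_RT[OF t] by blast
    next
      assume e: "underS (RT Y) t = {}"
      obtain \<xi> where \<xi>: "lev t = a \<xi>" using sub_lev[OF Y t] by blast
      have le: "a ord0 \<le> lev t" using \<xi> strict_mono_less_eq[OF a] by simp
      have "rs t (a ord0) = t"
        using e rs_tle[OF le] sub_rs[OF Y t le] unfolding underS_RT[OF t] by blast
      then show "lev t = a ord0" using lev_rs[OF le] by simp
    qed
    moreover have "t = r" if "t \<in> Y" "lev t = a ord0" for t
      using sub_unique[OF Y nonsucc_ord0 that(1) r(1) that(2) r(2)] by simp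
    ultimately show ?thesis using r unfolding Field_RT by blast
  qed
  show "\<exists>\<alpha>::'k. has_height (RT Y) t \<alpha>" if "t \<in> Field (RT Y)" for t
    using sub_has_height[OF Y] sub_lev[OF Y] that unfolding Field_RT by blast
  show "\<exists>\<beta>\<ge>\<alpha>. level (RT Y) \<beta> \<noteq> {}" for \<alpha> :: 'k
    using sub_nonempty[OF Y, of \<alpha>] unfolding sub_level[OF Y] by (intro exI[of _ \<alpha>]) auto
  have "small {t \<in> Y. lev t = a \<alpha>}" for \<alpha>
    by (rule small_mono[OF _ small_level[of "a \<alpha>"]]) auto
  then show "|level (RT Y) \<alpha>| <o (kappa :: 'k rel)" for \<alpha> :: 'k
    unfolding sub_level[OF Y] kappa[symmetric] .
  show "Restr (RT Y) b =o (kappa :: 'k rel)" if "maximal_path (RT Y) b" for b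
    by (rule sub_maximal_path[OF Y that])
  show "s = t" if lim: "is_limit \<alpha>" and s: "s \<in> level (RT Y) \<alpha>" and t: "t \<in> level (RT Y) \<alpha>"
    and eq: "underS (RT Y) s = underS (RT Y) t" for \<alpha> :: 'k and s t
  proof (rule sub_unique[OF Y is_limit_nonsucc[OF lim]])
    show st: "s \<in> Y" "t \<in> Y" "lev s = a \<alpha>" "lev t = a \<alpha>" using s t sub_level[OF Y] by auto
    fix \<eta> assume "\<eta> < \<alpha>"
    then have lt: "a \<eta> < lev s" using st(3) strict_mono_less[OF a] by simp
    then have "rs s (a \<eta>) \<in> underS (RT Y) s"
      using sub_rs[OF Y st(1), of \<eta>] rs_tle[of "a \<eta>" s] rs_less[OF lt]
      unfolding underS_RT[OF st(1)] by auto
    then have "rs s (a \<eta>) \<sqsubseteq> t" unfolding eq underS_RT[OF st(2)] by simp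
    then show "rs s (a \<eta>) = rs t (a \<eta>)" using rs_eqI lev_rs[of "a \<eta>" s] lt by simp
  qed
  show "\<exists>u v. (t, u) \<in> RT Y \<and> (t, v) \<in> RT Y \<and> (u, v) \<notin> RT Y \<and> (v, u) \<notin> RT Y"
    if "t \<in> Field (RT Y)" for t
  proof -
    have t: "t \<in> Y" using that by (simp add: Field_RT)
    obtain \<xi> where \<xi>: "lev t = a \<xi>" using sub_lev[OF Y t] by blast
    obtain u where u: "u \<in> Y" "t \<sqsubseteq> u" "u \<lhd> t" using sub_left[OF Y t \<xi>] by blast
    obtain v where v: "v \<in> Y" "t \<sqsubseteq> v" "t \<lhd> v" using sub_right[OF Y t \<xi>] by blast
    have "\<not> u \<sqsubseteq> v" using side_left[OF u(2) _ u(3), of v] v(3) by auto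
    moreover have "\<not> v \<sqsubseteq> u" using side_right[OF v(2) _ v(3), of u] u(3) by auto
    ultimately show ?thesis using t u v by (intro exI[of _ u] exI[of _ v]) (simp add: RT_def)
  qed
qed


subsection \<open>Strong subtrees\<close>

text \<open>Heights in \<open>S\<close> correspond to values of \<open>lev\<close> along
  \<open>a \<circ> a0\<close>, which translates each clause. The chain clause comes from the order
  type of maximal paths, the uniqueness clause from the unique root together with the limit
  condition. Branching to both sides comes from the strong condition applied to a left and to a
  right child in \<open>Y\<close>. The last conjunct keeps the strong condition in a usable
  form.\<close>

lemma strong_subtree_sub:
  assumes Y: "sub Y a" and S: "strong_subtree S (RT Y) (A :: 'k set)"
  shows "\<exists>a0. strict_mono a0 \<and> range a0 = A \<and> sub (Field S) (a \<circ> a0) \<and> S = RT (Field S) \<and>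
    Field S \<subseteq> Y \<and>
    (\<forall>\<xi>. \<forall>t\<in>Field S. lev t = a (a0 \<xi>) \<longrightarrow> (\<forall>s\<in>Y. t \<sqsubseteq> s \<longrightarrow> lev s = a (osuc (a0 \<xi>)) \<longrightarrow>
      (\<exists>v\<in>Field S. lev v = a (a0 (osuc \<xi>)) \<and> s \<sqsubseteq> v)))"
proof -
  note a = sub_strict_mono[OF Y]
  define Z where "Z = Field S"
  have ZY: "Z \<subseteq> Y" and SR: "S = Restr (RT Y) Z" and nice: "nice_tree TYPE('k) S"
    and ex: "\<exists>a :: 'k \<Rightarrow> 'k. strict_mono a \<and> range a = A \<and>
        (\<forall>\<xi>. level S \<xi> \<subseteq> level (RT Y) (a \<xi>) \<and>
             (\<forall>t \<in> level S \<xi>. \<forall>s \<in> Succ (RT Y) t. \<exists>!u. u \<in> level S (osuc \<xi>) \<and> (s, u) \<in> RT Y))"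
    using S unfolding strong_subtree_def Z_def[symmetric] Field_RT by blast+
  have SZ: "S = RT Z" unfolding SR using ZY by (auto simp: RT_def)
  obtain a0 :: "'k \<Rightarrow> 'k" where a0_all: "strict_mono a0 \<and> range a0 = A \<and>
        (\<forall>\<xi>. level S \<xi> \<subseteq> level (RT Y) (a0 \<xi>) \<and>
             (\<forall>t \<in> level S \<xi>. \<forall>s \<in> Succ (RT Y) t. \<exists>!u. u \<in> level S (osuc \<xi>) \<and> (s, u) \<in> RT Y))"
    using ex by (rule exE)
  then have a0: "strict_mono a0" and rng: "range a0 = A"
    and lv: "\<And>\<xi>. level S \<xi> \<subseteq> level (RT Y) (a0 \<xi>)"
    by simp_all
  have st: "\<exists>u. u \<in> level S (osuc \<xi>) \<and> (s, u) \<in> RT Y"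
    if "t \<in> level S \<xi>" "s \<in> Succ (RT Y) t" for t s and \<xi> :: 'k
    using a0_all that by (meson ex1_implies_ex)
  have po: "Partial_order S" unfolding SZ by (rule Partial_order_RT)
  have lev1: "lev t = a (a0 \<xi>)" if t: "t \<in> Z" "has_height S t \<xi>" for t \<xi>
  proof -
    have "t \<in> level S \<xi>" using t by (simp add: level_def Z_def)
    then have "t \<in> level (RT Y) (a0 \<xi>)" using lv by blast
    then show ?thesis unfolding sub_level[OF Y] by simp
  qed
  have hex: "\<exists>\<xi>::'k. has_height S t \<xi>" if "t \<in> Z" for t :: 'k
    using nice that unfolding nice_tree_def Z_def by blast
  have aa: "strict_mono (a \<circ> a0)" using a a0 by (simp add: strict_mono_def)
  have height: "has_height S t \<xi>" if t: "t \<in> Z" "lev t = a (a0 \<xi>)" for t \<xi>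
  proof -
    obtain \<eta> :: 'k where h: "has_height S t \<eta>" using hex[OF t(1)] by blast
    then have "(a \<circ> a0) \<eta> = (a \<circ> a0) \<xi>" using lev1[OF t(1) h] t(2) by simp
    then have "\<eta> = \<xi>" using strict_mono_eq[OF aa] by simp
    then show ?thesis using h by simp
  qed
  have levelS: "level S \<xi> = {t \<in> Z. lev t = a (a0 \<xi>)}" for \<xi>
  proof (intro equalityI subsetI)
    fix t assume "t \<in> level S \<xi>"
    then have "t \<in> Z" "has_height S t \<xi>" by (simp_all add: level_def Z_def)
    then show "t \<in> {t \<in> Z. lev t = a (a0 \<xi>)}" using lev1 by simp
  next
    fix t assume "t \<in> {t \<in> Z. lev t = a (a0 \<xi>)}"
    then show "t \<in> level S \<xi>" using height by (simp add: level_def Z_def)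
  qed
  have strong: "\<exists>v\<in>Z. lev v = a (a0 (osuc \<xi>)) \<and> s \<sqsubseteq> v"
    if t: "t \<in> Z" "lev t = a (a0 \<xi>)" and s: "s \<in> Y" "t \<sqsubseteq> s" "lev s = a (osuc (a0 \<xi>))" for \<xi> t s
  proof -
    have "lev t < lev s" using t s strict_monoD[OF a osuc_greater] by simp
    then have ne: "t \<noteq> s" by auto
    have tl: "t \<in> level S \<xi>" using t levelS by simp
    \<comment> \<open>\<open>Y\<close> has no level strictly between indices \<open>a0 \<xi>\<close>
      and \<open>osuc (a0 \<xi>)\<close>.\<close>
    have "s \<in> Succ (RT Y) t"
      unfolding Succ_def
    proof (intro CollectI conjI notI)
      show "t \<in> underS (RT Y) s" using underS_RT[OF s(1)] ne s(2) t(1) ZY by auto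
      assume "\<exists>u. t \<in> underS (RT Y) u \<and> u \<in> underS (RT Y) s"
      then obtain u where u: "t \<in> underS (RT Y) u" "u \<in> underS (RT Y) s" by blast
      then have uY: "u \<in> Y" "u \<sqsubseteq> s" "u \<noteq> s" by (simp_all add: underS_RT[OF s(1)])
      then have "t \<sqsubseteq> u" "t \<noteq> u" using u(1) by (simp_all add: underS_RT)
      then have l: "lev t < lev u" "lev u < lev s" using lev_less uY by simp_all
      obtain \<eta> where \<eta>: "lev u = a \<eta>" using sub_lev[OF Y uY(1)] by blast
      have "a0 \<xi> < \<eta>" "\<eta> < osuc (a0 \<xi>)" using l \<eta> t s strict_mono_less[OF a] by simp_all
      then show False using less_osuc_iff[of \<eta> "a0 \<xi>"] by simp
    qed
    then obtain v where "v \<in> level S (osuc \<xi>)" "(s, v) \<in> RT Y" using st[OF tl] by blast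
    then show ?thesis unfolding levelS by (auto simp: RT_def)
  qed
  have "sub Z (a \<circ> a0)"
    unfolding sub_def
  proof (intro conjI allI impI ballI)
    show "strict_mono (a \<circ> a0)" by (rule aa)
  next
    fix t assume t: "t \<in> Z"
    then obtain \<xi> :: 'k where "has_height S t \<xi>" using hex by blast
    then show "lev t \<in> range (a \<circ> a0)" using lev1[OF t] by auto
  next
    fix t \<xi> assume t: "t \<in> Z" and le: "(a \<circ> a0) \<xi> \<le> lev t"
    obtain \<zeta> :: 'k where h: "has_height S t \<zeta>" using hex[OF t] by blast
    then have l: "lev t = (a \<circ> a0) \<zeta>" using lev1[OF t] by simp
    then have "\<xi> \<le> \<zeta>" using le strict_mono_less_eq[OF aa] by simp
    then consider "\<xi> = \<zeta>" | "\<xi> < \<zeta>" by (auto simp: order_le_less)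
    then show "rs t ((a \<circ> a0) \<xi>) \<in> Z"
    proof cases
      case 1
      have "rs t ((a \<circ> a0) \<zeta>) = t" by (rule rs_eqI[OF tle_refl l])
      then show ?thesis using 1 t by simp
    next
      case 2
      then obtain s where s: "s \<in> underS S t" "has_height S s \<xi>"
        using has_height_below[OF po h] by blast
      then have sZ: "s \<in> Z" "s \<sqsubseteq> t" using underS_RT[OF t] unfolding SZ by auto
      then have "lev s = (a \<circ> a0) \<xi>" using lev1 s(2) by simp
      then show ?thesis using rs_eqI[OF sZ(2)] sZ(1) by simp
    qed
  next
    fix C \<xi> assume C: "C \<subseteq> Z" "chain C" and le: "\<forall>c\<in>C. lev c \<le> (a \<circ> a0) \<xi>"
    then have "C \<in> Chains S" unfolding SZ chain_iff_Chains by simp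
    then obtain M where M: "maximal_path S M" and CM: "C \<subseteq> M"
      using maximal_path_extends by blast
    \<comment> \<open>A path of type \<kappa> has a node at height \<xi>, and this node bounds
      \<open>C\<close>, whose members are comparable with it and not higher.\<close>
    have iso: "Restr S M =o (kappa :: 'k rel)" using nice M unfolding nice_tree_def by blast
    obtain t where t: "t \<in> M" "has_height S t \<xi>"
      using maximal_path_height[OF po _ M iso, of \<xi>] RT_linear unfolding SZ by blast
    have M2: "M \<subseteq> Z" "chain M"
      using M unfolding maximal_path_def SZ chain_iff_Chains by blast+
    have l: "lev t = (a \<circ> a0) \<xi>" using lev1 t M2 by auto
    have "c \<sqsubseteq> t" if c: "c \<in> C" for c
    proof -
      have "c \<sqsubseteq> t \<or> t \<sqsubseteq> c" using M2(2) CM c t(1) by (auto simp: chain_def)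
      moreover have "\<not> lev t < lev c" using le c l by auto
      ultimately show ?thesis using lev_less[of t c] by (cases "c = t") auto
    qed
    then show "\<exists>u\<in>Z. lev u = (a \<circ> a0) \<xi> \<and> (\<forall>c\<in>C. c \<sqsubseteq> u)" using t(1) M2(1) l by blast
  next
    fix \<xi> u v assume \<xi>: "nonsucc \<xi>" and u: "u \<in> Z" "lev u = (a \<circ> a0) \<xi>"
      and v: "v \<in> Z" "lev v = (a \<circ> a0) \<xi>"
      and eq: "\<forall>\<eta><\<xi>. rs u ((a \<circ> a0) \<eta>) = rs v ((a \<circ> a0) \<eta>)"
    have below: "s \<in> underS S v"
      if w: "u \<in> Z" "lev u = (a \<circ> a0) \<xi>" "v \<in> Z" "lev v = (a \<circ> a0) \<xi>"
        "\<forall>\<eta><\<xi>. rs u ((a \<circ> a0) \<eta>) = rs v ((a \<circ> a0) \<eta>)" "s \<in> underS S u" for u v s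
    proof -
      have s: "s \<in> Z" "s \<sqsubseteq> u" "s \<noteq> u" using w(6) underS_RT[OF w(1)] unfolding SZ by auto
      obtain \<eta> :: 'k where "has_height S s \<eta>" using hex[OF s(1)] by blast
      then have \<eta>: "lev s = (a \<circ> a0) \<eta>" using lev1[OF s(1)] by simp
      then have "\<eta> < \<xi>" using lev_less[OF s(2,3)] w(2) strict_mono_less[OF aa] by simp
      then have "rs v ((a \<circ> a0) \<eta>) = s" "(a \<circ> a0) \<eta> < lev v"
        using w(4,5) rs_eqI[OF s(2) \<eta>] strict_mono_less[OF aa] by simp_all
      then have "s \<sqsubseteq> v" "s \<noteq> v"
        using rs_tle[of "(a \<circ> a0) \<eta>" v] rs_less[of "(a \<circ> a0) \<eta>" v] by auto
      then show ?thesis using s(1) underS_RT[OF w(3)] unfolding SZ by auto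
    qed
    have eq': "\<forall>\<eta><\<xi>. rs v ((a \<circ> a0) \<eta>) = rs u ((a \<circ> a0) \<eta>)" using eq by simp
    have uS: "underS S u = underS S v"
      using below[OF u v eq] below[OF v u eq'] by blast
    show "u = v"
    \<comment> \<open>A nonsuccessor is a limit or zero; niceness treats the former by the limit
      condition and the latter by the unique root.\<close>
    proof (cases "\<exists>\<beta>. \<beta> < \<xi>")
      case True
      then have "is_limit \<xi>"
        unfolding is_limit_def using nonsucc_osuc_less[OF \<xi>] osuc_greater by blast
      moreover have "u \<in> level S \<xi>" "v \<in> level S \<xi>" using u v unfolding levelS by simp_all
      ultimately show ?thesis using nice uS unfolding nice_tree_def by blast
    next
      case False
      have empty: "underS S w = {}" if w: "w \<in> Z" "lev w = (a \<circ> a0) \<xi>" for w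
      proof (rule ccontr)
        assume "underS S w \<noteq> {}"
        then obtain s where "s \<in> underS S w" by blast
        then have s: "s \<in> Z" "s \<sqsubseteq> w" "s \<noteq> w" using underS_RT[OF w(1)] unfolding SZ by auto
        obtain \<eta> :: 'k where "has_height S s \<eta>" using hex[OF s(1)] by blast
        then have "lev s = (a \<circ> a0) \<eta>" using lev1[OF s(1)] by simp
        then have "\<eta> < \<xi>" using lev_less[OF s(2,3)] w(2) strict_mono_less[OF aa] by simp
        then show False using False by blast
      qed
      moreover have "\<exists>!t. t \<in> Z \<and> underS S t = {}"
        using nice unfolding nice_tree_def Z_def by blast
      ultimately show ?thesis using u v by blast
    qed
  next
    fix t \<xi> assume t: "t \<in> Z" "lev t = (a \<circ> a0) \<xi>"
    have tY: "t \<in> Y" "lev t = a (a0 \<xi>)" using t ZY by auto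
    obtain u where u: "u \<in> Y" "t \<sqsubseteq> u" "u \<lhd> t" "lev u = a (osuc (a0 \<xi>))"
      using sub_left[OF Y tY] by blast
    obtain v where v: "v \<in> Z" "lev v = a (a0 (osuc \<xi>))" "u \<sqsubseteq> v"
      using strong[OF t(1) tY(2) u(1,2,4)] by blast
    show "\<exists>u\<in>Z. t \<sqsubseteq> u \<and> u \<lhd> t \<and> lev u = (a \<circ> a0) (osuc \<xi>)"
      using v tle_trans[OF u(2) v(3)] side_left[OF u(2) v(3) u(3)] by (intro bexI[of _ v]) simp_all
    obtain u where u: "u \<in> Y" "t \<sqsubseteq> u" "t \<lhd> u" "lev u = a (osuc (a0 \<xi>))"
      using sub_right[OF Y tY] by blast
    obtain v where v: "v \<in> Z" "lev v = a (a0 (osuc \<xi>))" "u \<sqsubseteq> v"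
      using strong[OF t(1) tY(2) u(1,2,4)] by blast
    show "\<exists>u\<in>Z. t \<sqsubseteq> u \<and> t \<lhd> u \<and> lev u = (a \<circ> a0) (osuc \<xi>)"
      using v tle_trans[OF u(2) v(3)] side_right[OF u(2) v(3) u(3)] by (intro bexI[of _ v]) simp_all
  qed
  then show ?thesis
    unfolding Z_def[symmetric] using a0 rng SZ ZY strong by (intro exI[of _ a0]) blast
qed

text \<open>The tail cone property for subtrees of the tree of points and for colourings with any
  small set of colours. It is stated as a comparison of two tuples, possibly on different levels: by
  \<open>HL_tc\<close> each has the colour of its restriction to height \<open>osuc l\<close>, and
  these restrictions coincide.\<close>

lemma HL_sub:
  fixes g :: "'k \<Rightarrow> (nat \<Rightarrow> 'k) \<Rightarrow> 'b"
  assumes HL: "HL_tc TYPE('k) d"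
    and Y: "\<And>j. j < d \<Longrightarrow> sub (Y j) a"
    and g: "\<And>l. small (g l ` (\<Pi>\<^sub>E j\<in>{..<d}. Y j))"
  obtains Z a0 where "strict_mono a0"
    and "\<And>j. j < d \<Longrightarrow> sub (Z j) (a \<circ> a0)"
    and "\<And>j. j < d \<Longrightarrow> Z j \<subseteq> Y j"
    and "\<And>j \<xi> t s. j < d \<Longrightarrow> t \<in> Z j \<Longrightarrow> lev t = a (a0 \<xi>) \<Longrightarrow> s \<in> Y j \<Longrightarrow> t \<sqsubseteq> s \<Longrightarrow>
      lev s = a (osuc (a0 \<xi>)) \<Longrightarrow> \<exists>v\<in>Z j. lev v = a (a0 (osuc \<xi>)) \<and> s \<sqsubseteq> v"
    and "\<And>l \<xi> \<eta> u v. osuc l \<le> \<xi> \<Longrightarrow> osuc l \<le> \<eta> \<Longrightarrow>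
      u \<in> (\<Pi>\<^sub>E j\<in>{..<d}. Z j) \<Longrightarrow> v \<in> (\<Pi>\<^sub>E j\<in>{..<d}. Z j) \<Longrightarrow>
      (\<And>j. j < d \<Longrightarrow> lev (u j) = a (a0 \<xi>)) \<Longrightarrow> (\<And>j. j < d \<Longrightarrow> lev (v j) = a (a0 \<eta>)) \<Longrightarrow>
      (\<And>j. j < d \<Longrightarrow> rs (u j) (a (a0 (osuc l))) = rs (v j) (a (a0 (osuc l)))) \<Longrightarrow> g l u = g l v"
proof -
  let ?P = "\<Pi>\<^sub>E j\<in>{..<d}. Y j"
  have "\<forall>l. \<exists>cd. inj_on (fst cd) (g l ` ?P) \<and> fst cd ` g l ` ?P \<subseteq> {..<snd cd :: 'k}"
    using small_code[OF g] by (metis fst_conv snd_conv)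
  then obtain cd :: "'k \<Rightarrow> ('b \<Rightarrow> 'k) \<times> 'k" where
    cd: "\<And>l. inj_on (fst (cd l)) (g l ` ?P)" "\<And>l. fst (cd l) ` g l ` ?P \<subseteq> {..<snd (cd l)}"
    by metis
  \<comment> \<open>The colours are renamed to ordinals; the renaming is injective on the colours
    that occur, so equalities can be carried back.\<close>
  define h where "h l u = fst (cd l) (g l u)" for l u
  have h_eq: "g l u = g l v" if "u \<in> ?P" "v \<in> ?P" "h l u = h l v" for l u v
    using cd(1)[of l] that unfolding h_def by (auto dest: inj_onD)
  have h_range: "h l \<in> (\<Pi>\<^sub>E j\<in>{..<d}. Field (RT (Y j))) \<rightarrow> {..<snd (cd l)}" for l
    using cd(2)[of l] unfolding Field_RT h_def by auto
  have "\<exists>(S :: nat \<Rightarrow> 'k rel) (A :: 'k set).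
      (\<forall>j<d. strong_subtree (S j) (RT (Y j)) A) \<and>
      (\<forall>l \<xi>. osuc l \<le> \<xi> \<longrightarrow> (\<forall>u \<in> (\<Pi>\<^sub>E j\<in>{..<d}. level (S j) \<xi>).
                 h l u = h l (restrict_tuple d S u (osuc l))))"
    using HL[unfolded HL_tc_def, THEN spec[of _ "\<lambda>l. snd (cd l)"], THEN spec[of _ "\<lambda>j. RT (Y j)"],
        THEN spec[of _ h]] sub_nice_tree[OF Y] h_range by blast
  then obtain S :: "nat \<Rightarrow> 'k rel" and A :: "'k set" where
    S: "\<And>j. j < d \<Longrightarrow> strong_subtree (S j) (RT (Y j)) A"
    and hom: "\<And>l \<xi> u. osuc l \<le> \<xi> \<Longrightarrow> u \<in> (\<Pi>\<^sub>E j\<in>{..<d}. level (S j) \<xi>) \<Longrightarrow>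
                 h l u = h l (restrict_tuple d S u (osuc l))"
    by blast
  define Z where "Z j = Field (S j)" for j
  have "\<exists>a0 :: 'k \<Rightarrow> 'k. strict_mono a0 \<and> (\<forall>j<d. range a0 = A)"
  proof (cases "d = 0")
    case True
    \<comment> \<open>Without trees no level set is tied to the subtrees, so any strictly increasing
      function can serve as the enumeration.\<close>
    then show ?thesis by (intro exI[of _ "\<lambda>x. x"]) (simp add: strict_mono_def)
  next
    case False
    then obtain a0 :: "'k \<Rightarrow> 'k" where "strict_mono a0" "range a0 = A"
      using strong_subtree_sub[OF Y S, of 0] by blast
    then show ?thesis by blast
  qed
  then obtain a0 :: "'k \<Rightarrow> 'k" where a0: "strict_mono a0" and rng: "\<And>j. j < d \<Longrightarrow> range a0 = A" by blast
  have Z: "sub (Z j) (a \<circ> a0) \<and> S j = RT (Z j) \<and> Z j \<subseteq> Y j \<and>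
    (\<forall>\<xi>. \<forall>t\<in>Z j. lev t = a (a0 \<xi>) \<longrightarrow> (\<forall>s\<in>Y j. t \<sqsubseteq> s \<longrightarrow> lev s = a (osuc (a0 \<xi>)) \<longrightarrow>
      (\<exists>v\<in>Z j. lev v = a (a0 (osuc \<xi>)) \<and> s \<sqsubseteq> v)))" if j: "j < d" for j
  proof -
    obtain a1 where a1: "strict_mono a1" "range a1 = A" "sub (Z j) (a \<circ> a1)"
      "S j = RT (Z j)" "Z j \<subseteq> Y j"
      "\<forall>\<xi>. \<forall>t\<in>Z j. lev t = a (a1 \<xi>) \<longrightarrow> (\<forall>s\<in>Y j. t \<sqsubseteq> s \<longrightarrow> lev s = a (osuc (a1 \<xi>)) \<longrightarrow>
      (\<exists>v\<in>Z j. lev v = a (a1 (osuc \<xi>)) \<and> s \<sqsubseteq> v))"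
      using strong_subtree_sub[OF Y[OF j] S[OF j]] unfolding Z_def by blast
    \<comment> \<open>Each tree comes with its own enumeration of the shared level set; equal ranges
      make the enumerations equal.\<close>
    have "a1 = a0" by (rule strict_mono_range_unique[OF a1(1) a0]) (simp add: a1(2) rng[OF j])
    then show ?thesis using a1(3-6) by simp
  qed
  have lvl: "level (S j) \<xi> = {t \<in> Z j. lev t = a (a0 \<xi>)}" if "j < d" for j \<xi>
    using Z[OF that] sub_level[of "Z j" "a \<circ> a0" \<xi>] by simp
  have restr: "restrict_tuple d S u (osuc l) = (\<lambda>j\<in>{..<d}. rs (u j) (a (a0 (osuc l))))"
    if l: "osuc l \<le> \<xi>" and u: "u \<in> (\<Pi>\<^sub>E j\<in>{..<d}. level (S j) \<xi>)" for l \<xi> u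
    unfolding restrict_tuple_def
  proof (rule restrict_ext)
    fix j assume "j \<in> {..<d}"
    then have j: "j < d" by simp
    have uj: "u j \<in> Z j" "lev (u j) = a (a0 \<xi>)" using u j lvl[OF j] by (auto dest: PiE_mem)
    have le: "a (a0 (osuc l)) \<le> lev (u j)"
      using l uj strict_mono_less_eq[OF sub_strict_mono[OF conjunct1[OF Z[OF j]]], of "osuc l" \<xi>] by simp
    have S_j: "S j = RT (Z j)" using Z[OF j] by blast
    let ?r = "rs (u j) (a (a0 (osuc l)))"
    have rZ: "?r \<in> Z j" using sub_rs[OF conjunct1[OF Z[OF j]] uj(1), of "osuc l"] le by simp
    show "(THE s. s \<in> level (S j) (osuc l) \<and> (s, u j) \<in> S j) = ?r"
    proof (rule the_equality)
      show "?r \<in> level (S j) (osuc l) \<and> (?r, u j) \<in> S j"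
        using rZ rs_tle[OF le] lev_rs[OF le] uj unfolding lvl[OF j] unfolding S_j by (simp add: RT_def)
      fix s assume "s \<in> level (S j) (osuc l) \<and> (s, u j) \<in> S j"
      then have "s \<sqsubseteq> u j" "lev s = a (a0 (osuc l))" unfolding lvl[OF j] unfolding S_j by (simp_all add: RT_def)
      then show "s = ?r" using rs_eqI by simp
    qed
  qed
  show thesis
  proof (rule that[of a0 Z])
    fix l \<xi> \<eta> u v assume l: "osuc l \<le> \<xi>" "osuc l \<le> \<eta>"
      and u: "u \<in> (\<Pi>\<^sub>E j\<in>{..<d}. Z j)" and v: "v \<in> (\<Pi>\<^sub>E j\<in>{..<d}. Z j)"
      and lu: "\<And>j. j < d \<Longrightarrow> lev (u j) = a (a0 \<xi>)" and lv: "\<And>j. j < d \<Longrightarrow> lev (v j) = a (a0 \<eta>)"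
      and eq: "\<And>j. j < d \<Longrightarrow> rs (u j) (a (a0 (osuc l))) = rs (v j) (a (a0 (osuc l)))"
    have u': "u \<in> (\<Pi>\<^sub>E j\<in>{..<d}. level (S j) \<xi>)" using u lu lvl by (auto simp: PiE_iff)
    have v': "v \<in> (\<Pi>\<^sub>E j\<in>{..<d}. level (S j) \<eta>)" using v lv lvl by (auto simp: PiE_iff)
    have "restrict_tuple d S u (osuc l) = restrict_tuple d S v (osuc l)"
      unfolding restr[OF l(1) u'] restr[OF l(2) v'] using eq by (intro restrict_ext) simp
    then have "h l u = h l v" using hom[OF l(1) u'] hom[OF l(2) v'] by simp
    moreover have "(\<Pi>\<^sub>E j\<in>{..<d}. Z j) \<subseteq> ?P" by (rule PiE_mono) (use Z in blast)
    then have "u \<in> ?P" "v \<in> ?P" using u v by blast+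
    ultimately show "g l u = g l v" using h_eq by blast
  qed (use a0 Z in blast)+
qed


section \<open>Iterated tail cones\<close>

definition tup :: "nat \<Rightarrow> (nat \<Rightarrow> 'k set) \<Rightarrow> ('k \<Rightarrow> 'k) \<Rightarrow> 'k \<Rightarrow> (nat \<Rightarrow> 'k) set" where
  "tup d Y a \<xi> = (\<Pi>\<^sub>E j\<in>{..<d}. {t \<in> Y j. lev t = a \<xi>})"

lemma tupD: "u \<in> tup d Y a \<xi> \<Longrightarrow> j < d \<Longrightarrow> u j \<in> Y j \<and> lev (u j) = a \<xi>"
  by (auto simp: tup_def PiE_iff)

lemma tupI: "(\<And>j. j < d \<Longrightarrow> u j \<in> Y j \<and> lev (u j) = a \<xi>) \<Longrightarrow> (\<lambda>j\<in>{..<d}. u j) \<in> tup d Y a \<xi>"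
  by (auto simp: tup_def)

lemma tup_subset:
  assumes "\<And>j. j < d \<Longrightarrow> Z j \<subseteq> Y j" "a' \<xi> = a \<eta>" shows "tup d Z a' \<xi> \<subseteq> tup d Y a \<eta>"
  unfolding tup_def by (rule PiE_mono) (use assms in auto)

lemma tup_PiE: "tup d Y a \<xi> \<subseteq> (\<Pi>\<^sub>E j\<in>{..<d}. Y j)"
  unfolding tup_def by (rule PiE_mono) auto

text \<open>
  Coordinate \<open>0\<close> has no tree, and coordinate \<open>Suc j\<close> has the tree \<open>Y j\<close>. The colour \<open>F i x u\<close> is
  the colour of a tuple whose coordinates \<open>0, \<dots>, i\<close> are the points \<open>x 0, \<dots>, x i\<close> and whose later
  coordinates are generic points above \<open>u i, \<dots>, u (d - 1)\<close>: by the tail cone property it depends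
  only on the restriction of \<open>u\<close> to the first level above those of \<open>x 0, \<dots>, x i\<close>.
\<close>

definition tail_system ::
    "nat \<Rightarrow> ((nat \<Rightarrow> 'k) \<Rightarrow> 'k) \<Rightarrow> 'k \<Rightarrow> nat \<Rightarrow> (nat \<Rightarrow> 'k set) \<Rightarrow> ('k \<Rightarrow> 'k) \<Rightarrow> (nat \<Rightarrow> 'k \<Rightarrow> 'k) \<Rightarrow>
      (nat \<Rightarrow> (nat \<Rightarrow> 'k) \<Rightarrow> (nat \<Rightarrow> 'k) \<Rightarrow> 'k) \<Rightarrow> bool" where
  "tail_system d f \<delta> k Y a cs F \<longleftrightarrow>
    strict_mono a \<and> (\<forall>j<d. sub (Y j) a) \<and>
    (\<forall>j<d. \<forall>t\<in>Y j. \<forall>\<xi>. lev t = a \<xi> \<longrightarrow>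
      cs j t \<in> Y j \<and> t \<sqsubseteq> cs j t \<and> cs j t \<lhd> t \<and> lev (cs j t) = a (osuc \<xi>)) \<and>
    (\<forall>i x u. F i x u < \<delta>) \<and>
    (\<forall>i x u. k \<le> i \<longrightarrow> i \<le> d \<longrightarrow> F i x u = F i (restrict x {..i}) u) \<and>
    (\<forall>x u. F d x u = f (restrict x {..d})) \<and>
    (\<forall>i \<xi> \<eta> \<zeta> x u v. k \<le> i \<longrightarrow> i \<le> d \<longrightarrow> (\<forall>m\<le>i. lev (x m) \<le> a \<xi>) \<longrightarrow>
      osuc \<xi> \<le> \<eta> \<longrightarrow> osuc \<xi> \<le> \<zeta> \<longrightarrow> u \<in> tup d Y a \<eta> \<longrightarrow> v \<in> tup d Y a \<zeta> \<longrightarrow>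
      (\<forall>j<d. rs (u j) (a (osuc \<xi>)) = rs (v j) (a (osuc \<xi>))) \<longrightarrow> F i x u = F i x v) \<and>
    (\<forall>i \<xi> x u. k \<le> i \<longrightarrow> i < d \<longrightarrow> (\<forall>m\<le>i. lev (x m) \<le> a \<xi>) \<longrightarrow> u \<in> tup d Y a \<xi> \<longrightarrow>
      F (Suc i) (x(Suc i := u i)) (\<lambda>j\<in>{..<d}. cs j (u j)) = F i x u)"

lemma
  assumes "tail_system d f \<delta> k Y a cs F"
  shows tail_system_mono: "strict_mono a"
    and tail_system_sub: "j < d \<Longrightarrow> sub (Y j) a"
    and tail_system_cs: "j < d \<Longrightarrow> t \<in> Y j \<Longrightarrow> lev t = a \<xi> \<Longrightarrow>
      cs j t \<in> Y j \<and> t \<sqsubseteq> cs j t \<and> cs j t \<lhd> t \<and> lev (cs j t) = a (osuc \<xi>)"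
    and tail_system_less: "F i x u < \<delta>"
    and tail_system_restrict: "k \<le> i \<Longrightarrow> i \<le> d \<Longrightarrow> F i x u = F i (restrict x {..i}) u"
    and tail_system_top: "F d x u = f (restrict x {..d})"
    and tail_system_tail: "k \<le> i \<Longrightarrow> i \<le> d \<Longrightarrow> (\<And>m. m \<le> i \<Longrightarrow> lev (x m) \<le> a \<xi>) \<Longrightarrow>
      osuc \<xi> \<le> \<eta> \<Longrightarrow> osuc \<xi> \<le> \<zeta> \<Longrightarrow> u \<in> tup d Y a \<eta> \<Longrightarrow> v \<in> tup d Y a \<zeta> \<Longrightarrow>
      (\<And>j. j < d \<Longrightarrow> rs (u j) (a (osuc \<xi>)) = rs (v j) (a (osuc \<xi>))) \<Longrightarrow> F i x u = F i x v"
    and tail_system_link: "k \<le> i \<Longrightarrow> i < d \<Longrightarrow> (\<And>m. m \<le> i \<Longrightarrow> lev (x m) \<le> a \<xi>) \<Longrightarrow>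
      u \<in> tup d Y a \<xi> \<Longrightarrow> F (Suc i) (x(Suc i := u i)) (\<lambda>j\<in>{..<d}. cs j (u j)) = F i x u"
proof -
  note s1 = assms[unfolded tail_system_def]
  note p1 = s1[THEN conjunct1] and s2 = s1[THEN conjunct2]
  note p2 = s2[THEN conjunct1] and s3 = s2[THEN conjunct2]
  note p3 = s3[THEN conjunct1] and s4 = s3[THEN conjunct2]
  note p4 = s4[THEN conjunct1] and s5 = s4[THEN conjunct2]
  note p5 = s5[THEN conjunct1] and s6 = s5[THEN conjunct2]
  note p6 = s6[THEN conjunct1] and s7 = s6[THEN conjunct2]
  note p7 = s7[THEN conjunct1] and p8 = s7[THEN conjunct2]
  show "strict_mono a" by (rule p1)
  show "sub (Y j) a" if "j < d" using p2 that by simp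
  show "cs j t \<in> Y j \<and> t \<sqsubseteq> cs j t \<and> cs j t \<lhd> t \<and> lev (cs j t) = a (osuc \<xi>)"
    if "j < d" "t \<in> Y j" "lev t = a \<xi>"
    using p3[THEN spec, THEN mp, OF that(1)] that by simp
  show "F i x u < \<delta>" using p4 by simp
  show "F i x u = F i (restrict x {..i}) u" if "k \<le> i" "i \<le> d"
    by (rule p5[THEN spec, THEN spec, THEN spec, THEN mp, THEN mp, OF that])
  show "F d x u = f (restrict x {..d})" using p6 by simp
  show "F i x u = F i x v"
    if t: "k \<le> i" "i \<le> d" "\<And>m. m \<le> i \<Longrightarrow> lev (x m) \<le> a \<xi>"
      "osuc \<xi> \<le> \<eta>" "osuc \<xi> \<le> \<zeta>" "u \<in> tup d Y a \<eta>" "v \<in> tup d Y a \<zeta>"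
      "\<And>j. j < d \<Longrightarrow> rs (u j) (a (osuc \<xi>)) = rs (v j) (a (osuc \<xi>))"
    by (rule p7[rule_format, of i x \<xi> \<eta> \<zeta> u v]) (use t in simp_all)
  show "F (Suc i) (x(Suc i := u i)) (\<lambda>j\<in>{..<d}. cs j (u j)) = F i x u"
    if t: "k \<le> i" "i < d" "\<And>m. m \<le> i \<Longrightarrow> lev (x m) \<le> a \<xi>" "u \<in> tup d Y a \<xi>"
    by (rule p8[rule_format, of i x \<xi> u]) (use t in simp_all)
qed

lemma rs_coarser:
  assumes "rs s \<beta> = rs t \<beta>" "\<alpha> \<le> \<beta>" "\<beta> \<le> lev s" "\<beta> \<le> lev t"
  shows "rs s \<alpha> = rs t \<alpha>"
  using rs_tle_eq[OF rs_tle[OF assms(3)], of \<alpha>] rs_tle_eq[OF rs_tle[OF assms(4)], of \<alpha>]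
    lev_rs[OF assms(3)] lev_rs[OF assms(4)] assms by simp

text \<open>For \<open>k = d\<close> all coordinates are points already: the colour ignores
  \<open>u\<close>, so the tail clause is trivial and the linking clause is vacuous.\<close>

lemma tail_system_base:
  assumes f: "\<And>x. f x < \<delta>"
  shows "\<exists>Y a cs F. tail_system d f \<delta> d Y a cs F"
proof -
  define cs where "cs j t = (SOME u. t \<sqsubseteq> u \<and> u \<lhd> t \<and> lev u = osuc (lev t))" for j :: nat and t
  have cs: "t \<sqsubseteq> cs j t \<and> cs j t \<lhd> t \<and> lev (cs j t) = osuc (lev t)" for j t
    unfolding cs_def by (rule someI_ex) (rule left_child)
  have "tail_system d f \<delta> d (\<lambda>_. UNIV) (\<lambda>\<xi>. \<xi>) cs (\<lambda>i x u. f (restrict x {..d}))"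
    unfolding tail_system_def
    using f cs sub_UNIV by (simp add: strict_mono_def min_def)
  then show ?thesis by blast
qed

text \<open>One more coordinate becomes generic. The new colour is the old one with coordinate
  \<open>Suc k\<close> put at its node; the tail cone property makes this depend only on an initial
  part of that node and of the others. Passing to sparser levels keeps the old clauses true.\<close>

lemma tail_system_step:
  assumes HL: "HL_tc TYPE('k) d" and sys: "tail_system d f \<delta> (Suc k) Y a cs F" and k: "Suc k \<le> d"
  shows "\<exists>Y a cs F. tail_system d f \<delta> k Y a cs F"
proof -
  note a = tail_system_mono[OF sys]
  \<comment> \<open>Coordinate \<open>Suc k\<close> belongs to tree \<open>k\<close>, so it is put
    at \<open>u k\<close>. The generic nodes then have to lie above it; \<open>cs\<close> lifts each
    to a fixed left child, which leaves the right side free for further points.\<close>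
  define G where "G x u = F (Suc k) (x(Suc k := u k)) (\<lambda>j\<in>{..<d}. cs j (u j))" for x u
  \<comment> \<open>There are fewer than \<kappa> parameter tuples \<open>x\<close> of level at most
    \<open>l\<close>, hence fewer than \<kappa> functions from them to \<delta>, and
    \<open>g l\<close> records all these colours at once.\<close>
  define g where "g l u = (\<lambda>x\<in>(\<Pi>\<^sub>E m\<in>{..k}. {t. lev t \<le> l}). G x u)" for l u
  have small_g: "small (g l ` (\<Pi>\<^sub>E j\<in>{..<d}. Y j))" for l
  proof (rule small_mono)
    show "g l ` (\<Pi>\<^sub>E j\<in>{..<d}. Y j) \<subseteq> (\<Pi>\<^sub>E x\<in>(\<Pi>\<^sub>E m\<in>{..k}. {t. lev t \<le> l}). {..<\<delta>})"
      unfolding g_def G_def using tail_system_less[OF sys]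
      by (intro image_subsetI restrict_PiE_iff[THEN iffD2] ballI) simp
    show "small (\<Pi>\<^sub>E x\<in>(\<Pi>\<^sub>E m\<in>{..k}. {t. lev t \<le> l}). {..<\<delta>})"
      by (intro small_PiE small_finite small_level_le small_lessThan finite_atMost)
  qed
  show ?thesis
  proof (rule HL_sub[where g = g, OF HL tail_system_sub[OF sys]])
    show "small (g l ` (\<Pi>\<^sub>E j\<in>{..<d}. Y j))" for l by (rule small_g)
  next
  fix Z a0 assume a0: "strict_mono a0"
    and Z: "\<And>j. j < d \<Longrightarrow> sub (Z j) (a \<circ> a0)"
    and ZY: "\<And>j. j < d \<Longrightarrow> Z j \<subseteq> Y j"
    and strong: "\<And>j \<xi> t s. j < d \<Longrightarrow> t \<in> Z j \<Longrightarrow> lev t = a (a0 \<xi>) \<Longrightarrow> s \<in> Y j \<Longrightarrow> t \<sqsubseteq> s \<Longrightarrow>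
      lev s = a (osuc (a0 \<xi>)) \<Longrightarrow> \<exists>v\<in>Z j. lev v = a (a0 (osuc \<xi>)) \<and> s \<sqsubseteq> v"
    and hom: "\<And>l \<xi> \<eta> u v. osuc l \<le> \<xi> \<Longrightarrow> osuc l \<le> \<eta> \<Longrightarrow>
      u \<in> (\<Pi>\<^sub>E j\<in>{..<d}. Z j) \<Longrightarrow> v \<in> (\<Pi>\<^sub>E j\<in>{..<d}. Z j) \<Longrightarrow>
      (\<And>j. j < d \<Longrightarrow> lev (u j) = a (a0 \<xi>)) \<Longrightarrow> (\<And>j. j < d \<Longrightarrow> lev (v j) = a (a0 \<eta>)) \<Longrightarrow>
      (\<And>j. j < d \<Longrightarrow> rs (u j) (a (a0 (osuc l))) = rs (v j) (a (a0 (osuc l)))) \<Longrightarrow> g l u = g l v"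
  \<comment> \<open>Parameters of level up to \<open>a' \<xi>\<close> require the colouring number
    \<open>l = a' \<xi>\<close>, which is stable only from height \<open>osuc l\<close> on. The
    growth of \<open>b\<close> makes the next kept level lie at or above that height.\<close>
  obtain b where b: "strict_mono b" and b_grow: "\<And>\<xi>. osuc (a (a0 (b \<xi>))) \<le> b (osuc \<xi>)"
    and cont: "\<And>\<xi> \<zeta>. nonsucc \<xi> \<Longrightarrow> \<zeta> < b \<xi> \<Longrightarrow> \<exists>\<eta><\<xi>. \<zeta> \<le> b \<eta>"
    using normal_function[of "\<lambda>\<beta>. osuc (a (a0 \<beta>))"] by blast
  define a' where "a' = (a \<circ> a0) \<circ> b"
  define c where "c = a0 \<circ> b"
  have a'_eq: "a' \<xi> = a (a0 (b \<xi>))" "a' \<xi> = a (c \<xi>)" for \<xi> by (simp_all add: a'_def c_def)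
  have c: "strict_mono c" using a0 b by (simp add: c_def strict_mono_def)
  have a': "strict_mono a'" using a a0 b by (simp add: a'_def strict_mono_def)
  define Y' where "Y' j = {t \<in> Z j. lev t \<in> range a'}" for j
  have Y'Z: "Y' j \<subseteq> Z j" for j by (auto simp: Y'_def)
  have Y': "sub (Y' j) a'" if "j < d" for j
    unfolding Y'_def a'_def by (rule sub_thin[OF Z[OF that] b cont])
  have tup_Y: "tup d Y' a' \<xi> \<subseteq> tup d Y a (c \<xi>)" for \<xi>
    by (rule tup_subset) (use Y'Z ZY in \<open>auto simp: a'_eq(2)\<close>)
  have ex_cs: "\<exists>w. w \<in> Y' j \<and> cs j t \<sqsubseteq> w \<and> lev w = a' (osuc \<xi>)"
    if j: "j < d" and t: "t \<in> Y' j" "lev t = a' \<xi>" for j t \<xi>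
  proof -
    have tZ: "t \<in> Z j" "t \<in> Y j" "lev t = a (a0 (b \<xi>))" using t Y'Z ZY[OF j] a'_eq by auto
    have s: "cs j t \<in> Y j" "t \<sqsubseteq> cs j t" "lev (cs j t) = a (osuc (a0 (b \<xi>)))"
      using tail_system_cs[OF sys j tZ(2,3)] by blast+
    obtain v where v: "v \<in> Z j" "lev v = a (a0 (osuc (b \<xi>)))" "cs j t \<sqsubseteq> v"
      using strong[OF j tZ(1,3) s] by blast
    have "osuc (b \<xi>) \<le> b (osuc \<xi>)" by (rule osuc_leI[OF strict_monoD[OF b osuc_greater]])
    then have "lev v \<le> (a \<circ> a0) (b (osuc \<xi>))"
      using v(2) strict_mono_less_eq[OF a] strict_mono_less_eq[OF a0] by simp
    then obtain w where w: "w \<in> Z j" "lev w = (a \<circ> a0) (b (osuc \<xi>))" "v \<sqsubseteq> w"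
      using sub_extend[OF Z[OF j] v(1)] by blast
    then have "w \<in> Y' j" "lev w = a' (osuc \<xi>)" by (simp_all add: Y'_def a'_def)
    then show ?thesis using tle_trans[OF v(3) w(3)] by blast
  qed
  \<comment> \<open>The new child is taken above the old one so that colours do not notice the
    exchange. With \<xi> quantified inside, the choice depends on \<open>t\<close> alone.\<close>
  define cs' where
    "cs' j t = (SOME w. w \<in> Y' j \<and> cs j t \<sqsubseteq> w \<and> (\<forall>\<xi>. lev t = a' \<xi> \<longrightarrow> lev w = a' (osuc \<xi>)))" for j t
  have cs': "cs' j t \<in> Y' j" "cs j t \<sqsubseteq> cs' j t" "lev (cs' j t) = a' (osuc \<xi>)"
    if j: "j < d" and t: "t \<in> Y' j" "lev t = a' \<xi>" for j t \<xi>
  proof -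
    have "\<eta> = \<xi>" if "lev t = a' \<eta>" for \<eta> using that t(2) strict_mono_eq[OF a'] by simp
    then have "\<exists>w. w \<in> Y' j \<and> cs j t \<sqsubseteq> w \<and> (\<forall>\<xi>. lev t = a' \<xi> \<longrightarrow> lev w = a' (osuc \<xi>))"
      using ex_cs[OF j t] by blast
    then have "cs' j t \<in> Y' j \<and> cs j t \<sqsubseteq> cs' j t \<and> (\<forall>\<xi>. lev t = a' \<xi> \<longrightarrow> lev (cs' j t) = a' (osuc \<xi>))"
      unfolding cs'_def by (rule someI_ex)
    then show "cs' j t \<in> Y' j" "cs j t \<sqsubseteq> cs' j t" "lev (cs' j t) = a' (osuc \<xi>)" using t(2) by blast+
  qed
  define F' where "F' = F(k := \<lambda>x u. G (restrict x {..k}) u)"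
  have coarser: "rs (u j) \<alpha> = rs (v j) \<alpha>"
    if u: "u \<in> tup d Y' a' \<eta>" "v \<in> tup d Y' a' \<zeta>" and le: "osuc \<xi> \<le> \<eta>" "osuc \<xi> \<le> \<zeta>"
      and j: "j < d" and eq: "rs (u j) (a' (osuc \<xi>)) = rs (v j) (a' (osuc \<xi>))"
      and al: "\<alpha> \<le> a' (osuc \<xi>)" for u v \<eta> \<zeta> \<xi> \<alpha> j
    by (rule rs_coarser[OF eq al])
      (use tupD[OF u(1) j] tupD[OF u(2) j] le strict_mono_less_eq[OF a'] in simp_all)
  \<comment> \<open>Restricted to the level of the old children both tuples agree, and all points
    placed so far lie below that level; so the old tail clause applies.\<close>
  have swap: "F (Suc i) (x(Suc i := u i)) (\<lambda>j\<in>{..<d}. cs' j (u j)) =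
      F (Suc i) (x(Suc i := u i)) (\<lambda>j\<in>{..<d}. cs j (u j))"
    if i: "k \<le> i" "i < d" and x: "\<And>m. m \<le> i \<Longrightarrow> lev (x m) \<le> a' \<xi>" and u: "u \<in> tup d Y' a' \<xi>"
    for i x u \<xi>
  proof (rule tail_system_tail[OF sys])
    have u_Y: "u j \<in> Y' j" "lev (u j) = a' \<xi>" "u j \<in> Y j" "lev (u j) = a (c \<xi>)" if "j < d" for j
      using tupD[OF u that] tupD[OF subsetD[OF tup_Y u] that] by simp_all
    show "lev ((x(Suc i := u i)) m) \<le> a (c \<xi>)" if "m \<le> Suc i" for m
      using x[of m] that u_Y(4)[OF i(2)] a'_eq(2) by (cases "m = Suc i") auto
    show "(\<lambda>j\<in>{..<d}. cs' j (u j)) \<in> tup d Y a (c (osuc \<xi>))"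
      by (rule subsetD[OF tup_Y], rule tupI) (use cs' u_Y in blast)
    show "(\<lambda>j\<in>{..<d}. cs j (u j)) \<in> tup d Y a (osuc (c \<xi>))"
      by (rule tupI) (use tail_system_cs[OF sys] u_Y in blast)
    show "osuc (c \<xi>) \<le> c (osuc \<xi>)" by (rule osuc_leI[OF strict_monoD[OF c osuc_greater]])
    fix j assume j: "j < d"
    have l: "lev (cs j (u j)) = a (osuc (c \<xi>))" using tail_system_cs[OF sys j u_Y(3,4)[OF j]] by blast
    show "rs ((\<lambda>j\<in>{..<d}. cs' j (u j)) j) (a (osuc (c \<xi>))) =
        rs ((\<lambda>j\<in>{..<d}. cs j (u j)) j) (a (osuc (c \<xi>)))"
      using rs_eqI[OF cs'(2)[OF j u_Y(1,2)[OF j]] l] rs_eqI[OF tle_refl l] j by simp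
  qed (use i in simp_all)
  have "tail_system d f \<delta> k Y' a' cs' F'"
    unfolding tail_system_def
  proof (intro conjI allI impI ballI)
    show "strict_mono a'" by (rule a')
    show "sub (Y' j) a'" if "j < d" for j by (rule Y'[OF that])
    fix j t \<xi> assume t: "j < d" "t \<in> Y' j" "lev t = a' \<xi>"
    then have "t \<in> Y j" "lev t = a (c \<xi>)" using Y'Z ZY[OF t(1)] by (auto simp: a'_eq(2))
    then have "t \<sqsubseteq> cs j t" "cs j t \<lhd> t" using tail_system_cs[OF sys t(1)] by blast+
    then show "t \<sqsubseteq> cs' j t" "cs' j t \<lhd> t"
      using cs'(2)[OF t] by (blast intro: tle_trans, blast intro: side_left)
    show "cs' j t \<in> Y' j" "lev (cs' j t) = a' (osuc \<xi>)" using cs'[OF t] by blast+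
  next
    show "F' i x u < \<delta>" for i x u using tail_system_less[OF sys] by (simp add: F'_def G_def)
    show "F' i x u = F' i (restrict x {..i}) u" if "k \<le> i" "i \<le> d" for i x u
      using tail_system_restrict[OF sys, of i x u] that by (cases "i = k") (simp_all add: F'_def)
    show "F' d x u = f (restrict x {..d})" for x u
      using tail_system_top[OF sys] k by (simp add: F'_def)
  next
    fix i \<xi> \<eta> \<zeta> x u v assume i: "k \<le> i" "i \<le> d" and x: "\<forall>m\<le>i. lev (x m) \<le> a' \<xi>"
      and le: "osuc \<xi> \<le> \<eta>" "osuc \<xi> \<le> \<zeta>" and u: "u \<in> tup d Y' a' \<eta>" and v: "v \<in> tup d Y' a' \<zeta>"
      and eq: "\<forall>j<d. rs (u j) (a' (osuc \<xi>)) = rs (v j) (a' (osuc \<xi>))"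
    show "F' i x u = F' i x v"
    proof (cases "i = k")
      case True
      let ?l = "a' \<xi>"
      have grow: "osuc ?l \<le> b (osuc \<xi>)" using b_grow by (simp add: a'_eq(1))
      have "g ?l u = g ?l v"
      proof (rule hom)
        show "osuc ?l \<le> b \<eta>" "osuc ?l \<le> b \<zeta>"
          using grow le strict_mono_less_eq[OF b] by (meson order_trans)+
        show "u \<in> (\<Pi>\<^sub>E j\<in>{..<d}. Z j)" "v \<in> (\<Pi>\<^sub>E j\<in>{..<d}. Z j)"
          using u v tup_PiE[of d Y' a'] PiE_mono[of "{..<d}" Y' Z] Y'Z by blast+
        show "lev (u j) = a (a0 (b \<eta>))" "lev (v j) = a (a0 (b \<zeta>))" if "j < d" for j
          using tupD[OF u that] tupD[OF v that] a'_eq(1) by simp_all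
        show "rs (u j) (a (a0 (osuc ?l))) = rs (v j) (a (a0 (osuc ?l)))" if j: "j < d" for j
        proof (rule coarser[OF u v le j])
          show "rs (u j) (a' (osuc \<xi>)) = rs (v j) (a' (osuc \<xi>))" using eq j by blast
          show "a (a0 (osuc ?l)) \<le> a' (osuc \<xi>)"
            using grow strict_mono_less_eq[OF a] strict_mono_less_eq[OF a0] a'_eq(1) by simp
        qed
      qed
      moreover have "restrict x {..k} \<in> (\<Pi>\<^sub>E m\<in>{..k}. {t. lev t \<le> ?l})"
        using x True by auto
      ultimately have "G (restrict x {..k}) u = G (restrict x {..k}) v"
        unfolding g_def by (metis (no_types, lifting) restrict_apply')
      then show ?thesis using True by (simp add: F'_def)
    next
      case False
      then have i': "Suc k \<le> i" using i by simp
      have "F i x u = F i x v"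
      proof (rule tail_system_tail[OF sys i' i(2)])
        show "lev (x m) \<le> a (c \<xi>)" if "m \<le> i" for m using x that a'_eq(2) by simp
        have "osuc (c \<xi>) \<le> c (osuc \<xi>)" by (rule osuc_leI[OF strict_monoD[OF c osuc_greater]])
        then show "osuc (c \<xi>) \<le> c \<eta>" "osuc (c \<xi>) \<le> c \<zeta>"
          using le strict_mono_less_eq[OF c] by (meson order_trans)+
        show "u \<in> tup d Y a (c \<eta>)" "v \<in> tup d Y a (c \<zeta>)" using tup_Y u v by blast+
        show "rs (u j) (a (osuc (c \<xi>))) = rs (v j) (a (osuc (c \<xi>)))" if j: "j < d" for j
        proof (rule coarser[OF u v le j])
          show "rs (u j) (a' (osuc \<xi>)) = rs (v j) (a' (osuc \<xi>))" using eq j by blast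
          show "a (osuc (c \<xi>)) \<le> a' (osuc \<xi>)"
            unfolding a'_eq(2) strict_mono_less_eq[OF a]
            by (rule osuc_leI[OF strict_monoD[OF c osuc_greater]])
        qed
      qed
      then show ?thesis using False by (simp add: F'_def)
    qed
  next
    fix i \<xi> x u assume i: "k \<le> i" "i < d" and x: "\<forall>m\<le>i. lev (x m) \<le> a' \<xi>" and u: "u \<in> tup d Y' a' \<xi>"
    have "F' (Suc i) (x(Suc i := u i)) (\<lambda>j\<in>{..<d}. cs' j (u j)) =
        F (Suc i) (x(Suc i := u i)) (\<lambda>j\<in>{..<d}. cs j (u j))"
      using swap[OF i _ u, of x] x i by (simp add: F'_def)
    also have "\<dots> = F' i x u"
    proof (cases "i = k")
      case True
      have "restrict (x(Suc k := u k)) {..Suc k} = restrict ((restrict x {..k})(Suc k := u k)) {..Suc k}"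
        by (auto simp: restrict_def)
      then have "F (Suc k) (x(Suc k := u k)) w = F (Suc k) ((restrict x {..k})(Suc k := u k)) w" for w
        using tail_system_restrict[OF sys, of "Suc k" "x(Suc k := u k)" w]
          tail_system_restrict[OF sys, of "Suc k" "(restrict x {..k})(Suc k := u k)" w] k by simp
      then show ?thesis using True by (simp add: F'_def G_def)
    next
      case False
      then have "F (Suc i) (x(Suc i := u i)) (\<lambda>j\<in>{..<d}. cs j (u j)) = F i x u"
        using i x u tup_Y a'_eq(2) by (intro tail_system_link[OF sys, of i x "c \<xi>" u]) auto
      then show ?thesis using False by (simp add: F'_def)
    qed
    finally show "F' (Suc i) (x(Suc i := u i)) (\<lambda>j\<in>{..<d}. cs' j (u j)) = F' i x u" .
  qed
  then show ?thesis by blast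
qed
qed

lemma tail_system_exists:
  assumes HL: "HL_tc TYPE('k) d" and f: "\<And>x. f x < \<delta>"
  shows "\<exists>Y a cs F. tail_system d f \<delta> 0 Y a cs F"
proof -
  have "\<exists>Y a cs F. tail_system d f \<delta> (d - n) Y a cs F" if "n \<le> d" for n
    using that
  proof (induction n)
    case 0
    then show ?case using tail_system_base[OF f] by simp
  next
    case (Suc n)
    then obtain Y a cs F where "tail_system d f \<delta> (d - n) Y a cs F" by auto
    moreover have "d - n = Suc (d - Suc n)" using Suc.prems by simp
    ultimately show ?case using tail_system_step[OF HL, of f \<delta> "d - Suc n" Y a cs F] by simp
  qed
  from this[of d] show ?thesis by simp
qed


section \<open>The lowest coordinate\<close>

text \<open>Here \<open>s\<close> is a candidate for coordinate 0. The extension map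
  \<open>r j\<close> acts on single nodes, not on tuples, so that all nodes of level
  \<open>a \<alpha>\<close> above \<open>u0\<close> can be moved at once and every tuple of them
  gets colour \<open>c\<close>.\<close>

definition dense_colour ::
    "nat \<Rightarrow> (nat \<Rightarrow> 'k set) \<Rightarrow> ('k \<Rightarrow> 'k) \<Rightarrow> (nat \<Rightarrow> (nat \<Rightarrow> 'k) \<Rightarrow> (nat \<Rightarrow> 'k) \<Rightarrow> 'k) \<Rightarrow>
      (nat \<Rightarrow> 'k) \<Rightarrow> 'k \<Rightarrow> 'k \<Rightarrow> 'k \<Rightarrow> bool" where
  "dense_colour d Y a F u0 c \<alpha> s \<longleftrightarrow> (\<exists>\<xi> \<beta> r. lev s \<le> a \<xi> \<and> osuc \<xi> \<le> \<beta> \<and> \<alpha> < \<beta> \<and>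
    (\<forall>j<d. \<forall>t\<in>Y j. lev t = a \<alpha> \<longrightarrow> u0 j \<sqsubseteq> t \<longrightarrow>
      r j t \<in> Y j \<and> lev (r j t) = a \<beta> \<and> t \<sqsubseteq> r j t) \<and>
    (\<forall>u\<in>tup d Y a \<alpha>. (\<forall>j<d. u0 j \<sqsubseteq> u j) \<longrightarrow>
      F 0 (\<lambda>_. s) (\<lambda>j\<in>{..<d}. r j (u j)) = c))"

text \<open>Extend the nodes from level \<alpha> to level \<alpha>' by a fixed choice before
  applying \<open>r\<close>.\<close>

lemma dense_colour_antimono:
  assumes Y: "\<And>j. j < d \<Longrightarrow> sub (Y j) a" and a: "strict_mono a"
    and D: "dense_colour d Y a F u0 c \<alpha>' s" and le: "\<alpha> \<le> \<alpha>'"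
  shows "dense_colour d Y a F u0 c \<alpha> s"
proof -
  obtain \<xi> \<beta> r where \<xi>: "lev s \<le> a \<xi>" "osuc \<xi> \<le> \<beta>" "\<alpha>' < \<beta>"
    and r: "\<forall>j<d. \<forall>t\<in>Y j. lev t = a \<alpha>' \<longrightarrow> u0 j \<sqsubseteq> t \<longrightarrow>
      r j t \<in> Y j \<and> lev (r j t) = a \<beta> \<and> t \<sqsubseteq> r j t"
    and col: "\<forall>u\<in>tup d Y a \<alpha>'. (\<forall>j<d. u0 j \<sqsubseteq> u j) \<longrightarrow>
      F 0 (\<lambda>_. s) (\<lambda>j\<in>{..<d}. r j (u j)) = c"
    using D unfolding dense_colour_def by (elim exE conjE)
  define X where "X j t = (SOME u. u \<in> Y j \<and> lev u = a \<alpha>' \<and> t \<sqsubseteq> u)" for j t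
  have X: "X j t \<in> Y j \<and> lev (X j t) = a \<alpha>' \<and> t \<sqsubseteq> X j t"
    if "j < d" "t \<in> Y j" "lev t = a \<alpha>" for j t
    unfolding X_def
  proof (rule someI_ex)
    have "lev t \<le> a \<alpha>'" using that(3) le strict_mono_less_eq[OF a] by simp
    then show "\<exists>u. u \<in> Y j \<and> lev u = a \<alpha>' \<and> t \<sqsubseteq> u"
      using sub_extend[OF Y[OF that(1)] that(2)] by blast
  qed
  have "r j (X j t) \<in> Y j \<and> lev (r j (X j t)) = a \<beta> \<and> t \<sqsubseteq> r j (X j t)"
    if t: "j < d" "t \<in> Y j" "lev t = a \<alpha>" "u0 j \<sqsubseteq> t" for j t
  proof -
    note x = X[OF t(1-3)]
    have "u0 j \<sqsubseteq> X j t" using tle_trans[OF t(4)] x by blast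
    then have "r j (X j t) \<in> Y j \<and> lev (r j (X j t)) = a \<beta> \<and> X j t \<sqsubseteq> r j (X j t)"
      using r t(1) x by blast
    then show ?thesis using x tle_trans[of t "X j t"] by blast
  qed
  moreover have "F 0 (\<lambda>_. s) (\<lambda>j\<in>{..<d}. r j (X j (u j))) = c"
    if u: "u \<in> tup d Y a \<alpha>" "\<forall>j<d. u0 j \<sqsubseteq> u j" for u
  proof -
    let ?v = "\<lambda>j\<in>{..<d}. X j (u j)"
    have x: "X j (u j) \<in> Y j \<and> lev (X j (u j)) = a \<alpha>' \<and> u j \<sqsubseteq> X j (u j)" if "j < d" for j
      using X[OF that] tupD[OF u(1) that] by blast
    have "?v \<in> tup d Y a \<alpha>'" by (rule tupI) (use x in blast)
    moreover have "\<forall>j<d. u0 j \<sqsubseteq> ?v j" using u(2) x tle_trans by fastforce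
    ultimately have "F 0 (\<lambda>_. s) (\<lambda>j\<in>{..<d}. r j (?v j)) = c" using col by blast
    moreover have "(\<lambda>j\<in>{..<d}. r j (?v j)) = (\<lambda>j\<in>{..<d}. r j (X j (u j)))"
      by (rule restrict_ext) simp
    ultimately show ?thesis by simp
  qed
  ultimately show ?thesis
    unfolding dense_colour_def using \<xi> le
    by (intro exI[of _ \<xi>] exI[of _ \<beta>] exI[of _ "\<lambda>j t. r j (X j t)"]) auto
qed

lemma small_tup: "small (tup d Y a \<xi>)"
  unfolding tup_def
  by (intro small_PiE small_finite finite_lessThan small_mono[OF _ small_level[of "a \<xi>"]]) auto

text \<open>
  Otherwise every pair \<open>(u0, c)\<close> is refuted above some node, so a single branch \<open>S\<close> refutes all of
  them. Colouring the tuples of level \<open>b \<eta>\<close> by means of \<open>S (b \<eta>)\<close>, a strong subtree on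
  which this colouring is constant contradicts the refutation of its own colour.
\<close>

lemma dense_colour_exists:
  assumes HL: "HL_tc TYPE('k) d" and sys: "tail_system d f \<delta> 0 Y a cs F"
  shows "\<exists>s0 u0 \<alpha>0 c. u0 \<in> tup d Y a \<alpha>0 \<and>
    (\<forall>s \<alpha>. s0 \<sqsubseteq> s \<longrightarrow> \<alpha>0 \<le> \<alpha> \<longrightarrow> (\<exists>s'. s \<sqsubseteq> s' \<and> dense_colour d Y a F u0 c \<alpha> s'))"
proof (rule ccontr)
  assume contra: "\<not> ?thesis"
  note a = tail_system_mono[OF sys] and Y = tail_system_sub[OF sys] and less = tail_system_less[OF sys]
  let ?bad = "\<lambda>u c \<alpha> s. \<forall>s'. s \<sqsubseteq> s' \<longrightarrow> \<not> dense_colour d Y a F u c \<alpha> s'"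
  have dense: "\<exists>s \<alpha>. s0 \<sqsubseteq> s \<and> ?bad u c \<alpha> s" if "u \<in> tup d Y a \<alpha>0" for u c \<alpha>0 s0
    using contra that by blast
  obtain code :: "(nat \<Rightarrow> 'k) \<Rightarrow> 'k" where code: "inj_on code (\<Pi>\<^sub>E j\<in>{..<d}. UNIV)"
    using tuple_code by blast
  obtain p :: "'k \<times> 'k \<Rightarrow> 'k" where p: "inj p" using pairing by blast
  \<comment> \<open>The code of a pair of tuple and colour is the stage of the recursion below at
    which this pair is refuted.\<close>
  define \<iota> where "\<iota> u c = p (code u, c)" for u c
  have \<iota>_inj: "u = u' \<and> c = c'"
    if "u \<in> tup d Y a \<alpha>" "u' \<in> tup d Y a \<alpha>'" "\<iota> u c = \<iota> u' c'" for u u' c c' \<alpha> \<alpha>'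
  proof -
    have "code u = code u'" "c = c'" using injD[OF p] that(3) by (auto simp: \<iota>_def)
    moreover have "u \<in> (\<Pi>\<^sub>E j\<in>{..<d}. UNIV)" "u' \<in> (\<Pi>\<^sub>E j\<in>{..<d}. UNIV)"
      using that(1,2) by (auto simp: tup_def PiE_iff)
    ultimately show ?thesis using inj_onD[OF code] by blast
  qed
  let ?P = "\<lambda>S \<nu> r. (\<forall>\<eta><\<nu>. S \<eta> \<sqsubseteq> r) \<and>
    (\<forall>u c \<alpha>0. u \<in> tup d Y a \<alpha>0 \<longrightarrow> \<iota> u c = \<nu> \<longrightarrow> (\<exists>\<alpha>. ?bad u c \<alpha> r))"
  have "\<exists>S. \<forall>\<nu>. ?P S \<nu> (S \<nu>)"
  proof (rule dependent_wellorder_choice[where P = ?P])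
    fix S S' :: "'k \<Rightarrow> 'k" and \<nu> r assume "\<And>\<eta>. \<eta> < \<nu> \<Longrightarrow> S \<eta> = S' \<eta>"
    then have "(\<forall>\<eta><\<nu>. S \<eta> \<sqsubseteq> r) \<longleftrightarrow> (\<forall>\<eta><\<nu>. S' \<eta> \<sqsubseteq> r)" by simp
    then show "?P S \<nu> r = ?P S' \<nu> r" by simp
  next
    fix \<nu> :: 'k and S assume IH: "\<And>\<eta>. \<eta> < \<nu> \<Longrightarrow> ?P S \<eta> (S \<eta>)"
    have "chain (S ` {..<\<nu>})"
      unfolding chain_def
    proof (intro ballI)
      fix s t assume "s \<in> S ` {..<\<nu>}" "t \<in> S ` {..<\<nu>}"
      then obtain \<eta> \<zeta> where e: "s = S \<eta>" "\<eta> < \<nu>" "t = S \<zeta>" "\<zeta> < \<nu>" by blast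
      show "s \<sqsubseteq> t \<or> t \<sqsubseteq> s"
        using less_linear[of \<eta> \<zeta>] IH[OF e(2)] IH[OF e(4)] e tle_refl by blast
    qed
    then obtain s where s: "\<And>\<eta>. \<eta> < \<nu> \<Longrightarrow> S \<eta> \<sqsubseteq> s"
      using chain_upper_bound[OF _ small_image[OF small_lessThan]] by blast
    show "\<exists>r. ?P S \<nu> r"
    proof (cases "\<exists>u c \<alpha>0. u \<in> tup d Y a \<alpha>0 \<and> \<iota> u c = \<nu>")
      case True
      then obtain u c \<alpha>0 where u: "u \<in> tup d Y a \<alpha>0" "\<iota> u c = \<nu>" by blast
      obtain r \<alpha> where r: "s \<sqsubseteq> r" "?bad u c \<alpha> r" using dense[OF u(1)] by blast
      have n2: "\<exists>\<alpha>. ?bad u' c' \<alpha> r" if "u' \<in> tup d Y a \<alpha>1" "\<iota> u' c' = \<nu>" for u' c' \<alpha>1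
      proof -
        have "u' = u" "c' = c" using \<iota>_inj[OF that(1) u(1), of c' c] that(2) u(2) by simp_all
        then show ?thesis using r(2) by (intro exI[of _ \<alpha>]) simp
      qed
      have n1: "S \<eta> \<sqsubseteq> r" if "\<eta> < \<nu>" for \<eta> by (rule tle_trans[OF s[OF that] r(1)])
      show ?thesis
        by (rule exI[of _ r], intro conjI allI impI) (erule n1, rule n2)
    next
      case False
      show ?thesis
      proof (rule exI[of _ s], intro conjI allI impI)
        fix u c \<alpha>0 assume "u \<in> tup d Y a \<alpha>0" "\<iota> u c = \<nu>"
        with False show "\<exists>\<alpha>. ?bad u c \<alpha> s" by blast
      qed (rule s)
    qed
  qed
  then obtain S where S_all: "\<forall>\<nu>. ?P S \<nu> (S \<nu>)" by (rule exE)
  then have S: "\<And>\<eta> \<nu>. \<eta> < \<nu> \<Longrightarrow> S \<eta> \<sqsubseteq> S \<nu>" by simp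
  have S_bad: "\<exists>\<alpha>. ?bad u c \<alpha> (S (\<iota> u c))" if "u \<in> tup d Y a \<alpha>0" for u c \<alpha>0
    using S_all[THEN spec[of _ "\<iota> u c"], THEN conjunct2, THEN spec[of _ u], THEN spec[of _ c],
        THEN spec[of _ \<alpha>0], THEN mp, OF that, THEN mp, OF refl] .
  \<comment> \<open>A level at which the pair is refuted everywhere above its stage of the branch,
    hence at all later nodes of the branch.\<close>
  define A where "A u c = (SOME \<alpha>. ?bad u c \<alpha> (S (\<iota> u c)))" for u c
  have A: "\<not> dense_colour d Y a F u c (A u c) (S \<nu>)"
    if u: "u \<in> tup d Y a \<alpha>0" and lt: "\<iota> u c < \<nu>" for u c \<alpha>0 \<nu>
  proof -
    have "?bad u c (A u c) (S (\<iota> u c))" unfolding A_def by (rule someI_ex[OF S_bad[OF u]])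
    then show ?thesis using S[OF lt] by blast
  qed
  show False
  proof (cases "d = 0")
    case True
    \<comment> \<open>Without trees there is only the empty tuple. A node of the branch past the
      stages of all its colours has some colour \<open>c\<close> itself, and this contradicts the
      refutation of \<open>c\<close>.\<close>
    define u where "u = (\<lambda>j::nat. undefined :: 'k)"
    have u: "u' \<in> tup d Y a \<alpha> \<longleftrightarrow> u' = u" for u' \<alpha> by (simp add: tup_def True u_def)
    obtain \<nu> where \<nu>: "\<And>c. c < \<delta> \<Longrightarrow> \<iota> u c < \<nu>"
      using small_bounded[OF small_image[OF small_lessThan[of \<delta>], of "\<iota> u"]] by blast
    define c where "c = F 0 (\<lambda>_. S \<nu>) u"
    let ?l = "lev (S \<nu>)"
    have "dense_colour d Y a F u c (A u c) (S \<nu>)"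
      unfolding dense_colour_def
      using strict_mono_ge[OF a, of ?l] True u
      by (intro exI[of _ ?l] exI[of _ "osuc (max (A u c) ?l)"] exI[of _ "\<lambda>_ t. t"])
        (simp add: c_def u_def osuc_mono less_osuc_iff)
    moreover have "\<iota> u c < \<nu>" using \<nu> less by (simp add: c_def)
    ultimately show False using A[of u ord0 c \<nu>] u by simp
  next
    case False
    then have d0: "0 < d" by simp
    have "\<exists>B. \<forall>u\<in>tup d Y a \<zeta>. \<forall>c<\<delta>. \<iota> u c < B \<and> A u c < B" for \<zeta>
    proof -
      have sm: "small (tup d Y a \<zeta> \<times> {..<\<delta>})" by (intro small_Times small_tup small_lessThan)
      obtain B1 where B1: "\<forall>x\<in>(\<lambda>(u, c). \<iota> u c) ` (tup d Y a \<zeta> \<times> {..<\<delta>}). x < B1"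
        using small_bounded[OF small_image[OF sm]] by blast
      obtain B2 where B2: "\<forall>x\<in>(\<lambda>(u, c). A u c) ` (tup d Y a \<zeta> \<times> {..<\<delta>}). x < B2"
        using small_bounded[OF small_image[OF sm]] by blast
      show ?thesis
      proof (intro exI[of _ "max B1 B2"] ballI allI impI)
        fix u c assume "u \<in> tup d Y a \<zeta>" "c < \<delta>"
        then have "\<iota> u c < B1" "A u c < B2" using B1 B2 by auto
        then show "\<iota> u c < max B1 B2 \<and> A u c < max B1 B2" by (simp add: less_max_iff_disj)
      qed
    qed
    then obtain \<phi> where \<phi>: "\<And>\<zeta> u c. u \<in> tup d Y a \<zeta> \<Longrightarrow> c < \<delta> \<Longrightarrow> \<iota> u c < \<phi> \<zeta> \<and> A u c < \<phi> \<zeta>"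
      by metis
    \<comment> \<open>Each kept level lies beyond the stages and the refutation levels of all tuples
      on the preceding kept level.\<close>
    obtain b where b: "strict_mono b" and b_grow: "\<And>\<xi>. \<phi> (b \<xi>) \<le> b (osuc \<xi>)"
      and cont: "\<And>\<xi> \<zeta>. nonsucc \<xi> \<Longrightarrow> \<zeta> < b \<xi> \<Longrightarrow> \<exists>\<eta><\<xi>. \<zeta> \<le> b \<eta>"
      using normal_function[of \<phi>] by blast
    define Yb where "Yb j = {t \<in> Y j. lev t \<in> range (a \<circ> b)}" for j
    have Yb: "sub (Yb j) (a \<circ> b)" if "j < d" for j
      unfolding Yb_def by (rule sub_thin[OF Y[OF that] b cont])
    have ab: "strict_mono (a \<circ> b)" using a b by (simp add: strict_mono_def)
    define X where "X \<beta> j t = (SOME u. u \<in> Y j \<and> lev u = a \<beta> \<and> t \<sqsubseteq> u)" for \<beta> j t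
    have X: "X \<beta> j t \<in> Y j \<and> lev (X \<beta> j t) = a \<beta> \<and> t \<sqsubseteq> X \<beta> j t"
      if "j < d" "t \<in> Y j" "lev t \<le> a \<beta>" for \<beta> j t
      unfolding X_def by (rule someI_ex) (use sub_extend[OF Y[OF that(1)] that(2,3)] in blast)
    \<comment> \<open>A level index above \<open>b \<eta>\<close>, where the tuple lies, and above
      the level of the point \<open>S (b \<eta>)\<close>, so that the colour is taken where it is
      stable.\<close>
    define B where "B \<eta> = osuc (max (lev (S (b \<eta>))) (b \<eta>))" for \<eta>
    define col where "col \<eta> u = F 0 (\<lambda>_. S (b \<eta>)) (\<lambda>j\<in>{..<d}. X (B \<eta>) j (u j))" for \<eta> u
    \<comment> \<open>The colouring has to be defined on the whole product, so the level is read off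
      from entry 0.\<close>
    define g where "g u = col (THE \<eta>. lev (u 0) = (a \<circ> b) \<eta>) u" for u :: "nat \<Rightarrow> 'k"
    have g: "g u = col \<eta> u" if "lev (u 0) = (a \<circ> b) \<eta>" for u \<eta>
    proof -
      have "(THE \<zeta>. lev (u 0) = (a \<circ> b) \<zeta>) = \<eta>"
        using that by (rule the_equality) (use that strict_mono_eq[OF ab] in simp)
      then show ?thesis by (simp add: g_def)
    qed
    have g_less: "g u < \<delta>" for u unfolding g_def col_def by (rule less)
    have small_g: "small (g ` (\<Pi>\<^sub>E j\<in>{..<d}. Yb j))"
      by (rule small_mono[OF _ small_lessThan[of \<delta>]]) (use g_less in auto)
    show False
    proof (rule HL_sub[where g = "\<lambda>_. g", OF HL Yb])
      show "small (g ` (\<Pi>\<^sub>E j\<in>{..<d}. Yb j))" by (rule small_g)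
    next
    fix Z a0 assume a0: "strict_mono a0"
      and Z: "\<And>j. j < d \<Longrightarrow> sub (Z j) ((a \<circ> b) \<circ> a0)"
      and ZY: "\<And>j. j < d \<Longrightarrow> Z j \<subseteq> Yb j"
      and strong: "\<And>j \<xi> t s. j < d \<Longrightarrow> t \<in> Z j \<Longrightarrow> lev t = (a \<circ> b) (a0 \<xi>) \<Longrightarrow> s \<in> Yb j \<Longrightarrow>
        t \<sqsubseteq> s \<Longrightarrow> lev s = (a \<circ> b) (osuc (a0 \<xi>)) \<Longrightarrow>
        \<exists>v\<in>Z j. lev v = (a \<circ> b) (a0 (osuc \<xi>)) \<and> s \<sqsubseteq> v"
      and hom: "\<And>l \<xi> \<eta> u v. osuc l \<le> \<xi> \<Longrightarrow> osuc l \<le> \<eta> \<Longrightarrow>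
        u \<in> (\<Pi>\<^sub>E j\<in>{..<d}. Z j) \<Longrightarrow> v \<in> (\<Pi>\<^sub>E j\<in>{..<d}. Z j) \<Longrightarrow>
        (\<And>j. j < d \<Longrightarrow> lev (u j) = (a \<circ> b) (a0 \<xi>)) \<Longrightarrow>
        (\<And>j. j < d \<Longrightarrow> lev (v j) = (a \<circ> b) (a0 \<eta>)) \<Longrightarrow>
        (\<And>j. j < d \<Longrightarrow> rs (u j) ((a \<circ> b) (a0 (osuc l))) = rs (v j) ((a \<circ> b) (a0 (osuc l)))) \<Longrightarrow>
        g u = g v"
    \<comment> \<open>Colours are stable from height \<open>osuc l\<close> on. With
      \<open>l = ord0\<close> the first such height is \<open>one\<close>: \<open>w\<close> is taken
      there, and its extensions are taken at the height after it.\<close>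
    define one where "one = osuc ord0"
    define \<zeta> where "\<zeta> = a0 one"
    define \<eta> where "\<eta> = a0 (osuc one)"
    have \<zeta>\<eta>: "osuc \<zeta> \<le> \<eta>"
      unfolding \<zeta>_def \<eta>_def by (rule osuc_leI[OF strict_monoD[OF a0 osuc_greater]])
    define w where "w = (\<lambda>j\<in>{..<d}. SOME t. t \<in> Z j \<and> lev t = (a \<circ> b) \<zeta>)"
    have w: "w j \<in> Z j" "lev (w j) = (a \<circ> b) \<zeta>" if "j < d" for j
    proof -
      have "\<exists>t. t \<in> Z j \<and> lev t = (a \<circ> b) \<zeta>"
        using sub_nonempty[OF Z[OF that], of one] by (auto simp: \<zeta>_def)
      from someI_ex[OF this] show "w j \<in> Z j" "lev (w j) = (a \<circ> b) \<zeta>" using that by (simp_all add: w_def)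
    qed
    define c where "c = g w"
    have w_tup: "w \<in> tup d Y a (b \<zeta>)"
      using w ZY unfolding tup_def w_def by (auto simp: Yb_def)
    have grow: "\<iota> w c < b (osuc \<zeta>)" "A w c \<le> b (osuc \<zeta>)"
      using \<phi>[OF w_tup, of c] b_grow[of \<zeta>] g_less by (auto simp: c_def)
    have "b (osuc \<zeta>) \<le> b \<eta>" using \<zeta>\<eta> strict_mono_less_eq[OF b] by simp
    \<comment> \<open>By the strong condition every node of the next level of \<open>Yb j\<close>
      above \<open>w j\<close> has an extension in \<open>Z j\<close>, not only the nodes already in
      \<open>Z j\<close>. This turns the constancy of \<open>g\<close> into density.\<close>
    define V where "V j t = (SOME v. v \<in> Z j \<and> lev v = (a \<circ> b) \<eta> \<and> t \<sqsubseteq> v)" for j t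
    have V: "V j t \<in> Z j \<and> lev (V j t) = (a \<circ> b) \<eta> \<and> t \<sqsubseteq> V j t"
      if "j < d" "t \<in> Y j" "lev t = a (b (osuc \<zeta>))" "w j \<sqsubseteq> t" for j t
      unfolding V_def
    proof (rule someI_ex)
      have "t \<in> Yb j" using that by (simp add: Yb_def)
      then show "\<exists>v. v \<in> Z j \<and> lev v = (a \<circ> b) \<eta> \<and> t \<sqsubseteq> v"
        using strong[OF that(1) w(1)[OF that(1)], of one t] w(2)[OF that(1)] that
        unfolding \<zeta>_def \<eta>_def by auto
    qed
    have XV: "X (B \<eta>) j (V j t) \<in> Y j \<and> lev (X (B \<eta>) j (V j t)) = a (B \<eta>) \<and> t \<sqsubseteq> X (B \<eta>) j (V j t)"
      if t: "j < d" "t \<in> Y j" "lev t = a (b (osuc \<zeta>))" "w j \<sqsubseteq> t" for j t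
    proof -
      have v: "V j t \<in> Y j" "lev (V j t) = a (b \<eta>)" "t \<sqsubseteq> V j t"
        using V[OF t] ZY[OF t(1)] by (auto simp: Yb_def)
      moreover have "b \<eta> \<le> B \<eta>" unfolding B_def by (meson max.cobounded2 less_imp_le less_osuc_iff)
      ultimately have "lev (V j t) \<le> a (B \<eta>)" using strict_mono_less_eq[OF a] by simp
      then show ?thesis using X[OF t(1) v(1)] tle_trans[OF v(3)] by blast
    qed
    have "dense_colour d Y a F w c (b (osuc \<zeta>)) (S (b \<eta>))"
      unfolding dense_colour_def
    proof (rule exI[of _ "lev (S (b \<eta>))"], rule exI[of _ "B \<eta>"],
        rule exI[of _ "\<lambda>j t. X (B \<eta>) j (V j t)"], intro conjI allI impI ballI)
      show "lev (S (b \<eta>)) \<le> a (lev (S (b \<eta>)))" by (rule strict_mono_ge[OF a])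
      show "osuc (lev (S (b \<eta>))) \<le> B \<eta>" unfolding B_def by (rule osuc_mono) simp
      show "b (osuc \<zeta>) < B \<eta>"
        unfolding B_def less_osuc_iff using \<open>b (osuc \<zeta>) \<le> b \<eta>\<close> by (simp add: le_max_iff_disj)
    next
      fix u assume u: "u \<in> tup d Y a (b (osuc \<zeta>))" and uw: "\<forall>j<d. w j \<sqsubseteq> u j"
      define v where "v = (\<lambda>j\<in>{..<d}. V j (u j))"
      have v: "v j \<in> Z j" "lev (v j) = (a \<circ> b) \<eta>" "w j \<sqsubseteq> v j" if "j < d" for j
        using V[of j "u j"] tupD[OF u that] uw that tle_trans[of "w j" "u j" "v j"]
        by (auto simp: v_def)
      have "g v = g w"
      proof (rule hom[of ord0 "osuc one" one])
        show "osuc ord0 \<le> osuc one" "osuc ord0 \<le> one" unfolding one_def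
          by (simp_all add: osuc_mono)
        show "v \<in> (\<Pi>\<^sub>E j\<in>{..<d}. Z j)" "w \<in> (\<Pi>\<^sub>E j\<in>{..<d}. Z j)"
          using v(1) w(1) by (auto simp: v_def w_def)
        fix j assume j: "j < d"
        show "lev (v j) = (a \<circ> b) (a0 (osuc one))" "lev (w j) = (a \<circ> b) (a0 one)"
          using v(2)[OF j] w(2)[OF j] by (simp_all add: \<zeta>_def \<eta>_def)
        show "rs (v j) ((a \<circ> b) (a0 (osuc ord0))) = rs (w j) ((a \<circ> b) (a0 (osuc ord0)))"
          using rs_eqI[OF v(3)[OF j] w(2)[OF j]] rs_eqI[OF tle_refl w(2)[OF j]]
          by (simp add: \<zeta>_def one_def)
      qed
      then have "col \<eta> v = c" using g[of v \<eta>] v(2)[OF d0] by (simp add: c_def)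
      moreover have "(\<lambda>j\<in>{..<d}. X (B \<eta>) j (v j)) = (\<lambda>j\<in>{..<d}. X (B \<eta>) j (V j (u j)))"
        by (rule restrict_ext) (simp add: v_def)
      ultimately show "F 0 (\<lambda>_. S (b \<eta>)) (\<lambda>j\<in>{..<d}. X (B \<eta>) j (V j (u j))) = c"
        by (simp add: col_def)
    qed (use XV in blast)+
    \<comment> \<open>The level reached is at least \<open>A w c\<close>, so density passes down to
      the refutation level, while \<open>S (b \<eta>)\<close> comes after the stage of
      \<open>(w, c)\<close>.\<close>
    from dense_colour_antimono[where Y = Y and d = d, OF _ a this grow(2)]
    have "dense_colour d Y a F w c (A w c) (S (b \<eta>))" using Y by blast
    moreover have "\<iota> w c < b \<eta>" using grow(1) \<open>b (osuc \<zeta>) \<le> b \<eta>\<close> by simp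
    ultimately show False using A[OF w_tup] by blast
    qed
  qed
qed


section \<open>Construction of the copies\<close>

text \<open>A state is a level index together with, for each copy \<open>j\<close> and each point
  \<open>q\<close>, the node to which the image of \<open>q\<close> is committed so far. A step
  places the image \<open>y\<close> of \<open>q0\<close> in copy \<open>j0\<close>. The last clause
  follows the colour of the tuple named by \<open>z\<close>: placing coordinate 0 makes it
  \<open>c\<close>, and placing a later coordinate hands on the colour obtained with the previous
  one.\<close>

definition step ::
    "nat \<Rightarrow> ('k \<Rightarrow> 'k) \<Rightarrow> (nat \<Rightarrow> (nat \<Rightarrow> 'k) \<Rightarrow> (nat \<Rightarrow> 'k) \<Rightarrow> 'k) \<Rightarrow> 'k \<Rightarrow> nat \<Rightarrow> 'k \<Rightarrow>
      'k \<times> (nat \<Rightarrow> 'k \<Rightarrow> 'k) \<Rightarrow> 'k \<times> (nat \<Rightarrow> 'k \<Rightarrow> 'k) \<Rightarrow> 'k \<Rightarrow> bool" where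
  "step d a F c j0 q0 st st' y \<longleftrightarrow>
    fst st < fst st' \<and> (\<exists>\<xi>. lev y \<le> a \<xi> \<and> osuc \<xi> \<le> fst st') \<and> snd st j0 q0 \<sqsubseteq> y \<and>
    (\<forall>j\<le>d. \<forall>q. snd st j q \<sqsubseteq> snd st' j q) \<and>
    (\<forall>q. snd st j0 q = snd st j0 q0 \<longrightarrow> y \<sqsubseteq> snd st' j0 q \<and>
      (if q0 \<lhd> q then y \<lhd> snd st' j0 q else snd st' j0 q \<lhd> y)) \<and>
    (\<forall>j\<le>d. \<forall>q r. snd st j q = snd st j r \<longrightarrow> snd st' j q \<noteq> snd st' j r \<longrightarrow>
      j = j0 \<and> snd st j q = snd st j q0 \<and> (q0 \<lhd> q \<longleftrightarrow> \<not> q0 \<lhd> r)) \<and>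
    (\<forall>z. z j0 = q0 \<longrightarrow> (case j0 of
        0 \<Rightarrow> F 0 (\<lambda>_. y) (\<lambda>j\<in>{..<d}. snd st' (Suc j) (z (Suc j))) = c
      | Suc i \<Rightarrow> \<forall>x. (\<forall>m\<le>i. lev (x m) \<le> a (fst st)) \<longrightarrow>
          F j0 (x(j0 := y)) (\<lambda>j\<in>{..<d}. snd st' (Suc j) (z (Suc j))) =
          F i x (\<lambda>j\<in>{..<d}. snd st (Suc j) (z (Suc j)))))"

definition nodes :: "(nat \<Rightarrow> 'k set) \<Rightarrow> nat \<Rightarrow> 'k set" where
  "nodes Y j = (case j of 0 \<Rightarrow> UNIV | Suc i \<Rightarrow> Y i)"

definition base :: "'k \<Rightarrow> (nat \<Rightarrow> 'k) \<Rightarrow> nat \<Rightarrow> 'k" where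
  "base s0 u0 j = (case j of 0 \<Rightarrow> s0 | Suc i \<Rightarrow> u0 i)"

definition valid ::
    "nat \<Rightarrow> (nat \<Rightarrow> 'k set) \<Rightarrow> ('k \<Rightarrow> 'k) \<Rightarrow> 'k \<Rightarrow> (nat \<Rightarrow> 'k) \<Rightarrow> 'k \<Rightarrow> 'k \<times> (nat \<Rightarrow> 'k \<Rightarrow> 'k) \<Rightarrow> bool" where
  "valid d Y a s0 u0 \<alpha>0 st \<longleftrightarrow> \<alpha>0 \<le> fst st \<and> (\<forall>j\<le>d. \<forall>q. snd st j q \<in> nodes Y j \<and>
    lev (snd st j q) = a (fst st) \<and> base s0 u0 j \<sqsubseteq> snd st j q)"

lemma step_exists:
  assumes sys: "tail_system d f \<delta> 0 Y a cs F"
    and dense: "\<And>s \<alpha>. s0 \<sqsubseteq> s \<Longrightarrow> \<alpha>0 \<le> \<alpha> \<Longrightarrow> \<exists>s'. s \<sqsubseteq> s' \<and> dense_colour d Y a F u0 c \<alpha> s'"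
    and valid: "valid d Y a s0 u0 \<alpha>0 st" and j0: "j0 \<le> d"
  shows "\<exists>st' y. step d a F c j0 q0 st st' y \<and> valid d Y a s0 u0 \<alpha>0 st'"
proof -
  note a = tail_system_mono[OF sys] and Y = tail_system_sub[OF sys] and cs = tail_system_cs[OF sys]
  define \<mu> where "\<mu> = fst st"
  define p where "p = snd st"
  have le0: "\<alpha>0 \<le> \<mu>" using valid by (simp add: valid_def \<mu>_def)
  have p: "p j q \<in> nodes Y j" "lev (p j q) = a \<mu>" "base s0 u0 j \<sqsubseteq> p j q" if "j \<le> d" for j q
    using valid that by (simp_all add: valid_def p_def \<mu>_def)
  have pS: "p (Suc j) q \<in> Y j" "lev (p (Suc j) q) = a \<mu>" "u0 j \<sqsubseteq> p (Suc j) q" if "j < d" for j q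
    using p[of "Suc j" q] that by (simp_all add: nodes_def base_def)
  have tup_p: "(\<lambda>j\<in>{..<d}. p (Suc j) (z (Suc j))) \<in> tup d Y a \<mu>" for z
    by (rule tupI) (use pS in blast)
  have child: "\<exists>u. t \<sqsubseteq> u \<and> lev u = \<beta>" if "lev t \<le> \<beta>" for t \<beta>
    using sub_extend[OF sub_UNIV, of t \<beta>] that by auto
  show ?thesis
  proof (cases j0)
    case 0
    have "s0 \<sqsubseteq> p 0 q0" using p(3)[of 0 q0] by (simp add: base_def)
    then obtain y where y: "p 0 q0 \<sqsubseteq> y" "dense_colour d Y a F u0 c \<mu> y"
      using dense le0 by blast
    obtain \<xi> \<beta> r where \<xi>: "lev y \<le> a \<xi>" "osuc \<xi> \<le> \<beta>" "\<mu> < \<beta>"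
      and r: "\<forall>j<d. \<forall>t\<in>Y j. lev t = a \<mu> \<longrightarrow> u0 j \<sqsubseteq> t \<longrightarrow>
        r j t \<in> Y j \<and> lev (r j t) = a \<beta> \<and> t \<sqsubseteq> r j t"
      and col: "\<forall>u\<in>tup d Y a \<mu>. (\<forall>j<d. u0 j \<sqsubseteq> u j) \<longrightarrow>
        F 0 (\<lambda>_. y) (\<lambda>j\<in>{..<d}. r j (u j)) = c"
      using y(2) unfolding dense_colour_def by (elim exE conjE)
    have "a \<xi> < a \<beta>" using \<xi>(2) strict_mono_less[OF a] by (simp add: osuc_le_iff)
    then have ly: "osuc (lev y) \<le> a \<beta>" using \<xi>(1) by (simp add: osuc_le_iff)
    obtain L0 where L0: "y \<sqsubseteq> L0" "L0 \<lhd> y" "lev L0 = osuc (lev y)" using left_child by blast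
    obtain L where L: "L0 \<sqsubseteq> L" "lev L = a \<beta>" using child[of L0 "a \<beta>"] L0(3) ly by auto
    obtain R0 where R0: "y \<sqsubseteq> R0" "y \<lhd> R0" "lev R0 = osuc (lev y)" using right_child by blast
    obtain R where R: "R0 \<sqsubseteq> R" "lev R = a \<beta>" using child[of R0 "a \<beta>"] R0(3) ly by auto
    have yL: "y \<sqsubseteq> L" "L \<lhd> y" using tle_trans[OF L0(1) L(1)] side_left[OF L0(1) L(1) L0(2)] by blast+
    have yR: "y \<sqsubseteq> R" "y \<lhd> R" using tle_trans[OF R0(1) R(1)] side_right[OF R0(1) R(1) R0(2)] by blast+
    define X where "X t = (SOME u. t \<sqsubseteq> u \<and> lev u = a \<beta>)" for t
    have X: "p 0 q \<sqsubseteq> X (p 0 q) \<and> lev (X (p 0 q)) = a \<beta>" for q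
      unfolding X_def
      by (rule someI_ex, rule child) (use p(2)[of 0 q] \<xi>(3) strict_mono_less[OF a] in \<open>simp add: less_imp_le\<close>)
    \<comment> \<open>All points committed to the node of \<open>q0\<close> move above
      \<open>y\<close>, each to its own side; the other trees follow the extension maps belonging to
      the dense colour.\<close>
    define p' where "p' j q = (case j of
        0 \<Rightarrow> if p 0 q = p 0 q0 then if q0 \<lhd> q then R else L else X (p 0 q)
      | Suc i \<Rightarrow> r i (p (Suc i) q))" for j q
    have p'0: "p' 0 q = (if p 0 q = p 0 q0 then if q0 \<lhd> q then R else L else X (p 0 q))" for q
      by (simp add: p'_def)
    have p'S: "p' (Suc i) q = r i (p (Suc i) q)" for i q by (simp add: p'_def)
    have ext: "p j q \<sqsubseteq> p' j q \<and> p' j q \<in> nodes Y j \<and> lev (p' j q) = a \<beta>" if j: "j \<le> d" for j q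
    proof (cases j)
      case 0
      then show ?thesis
        using X[of q] tle_trans[OF y(1) yL(1)] tle_trans[OF y(1) yR(1)] L(2) R(2)
        by (simp add: p'0 nodes_def)
    next
      case (Suc i)
      then show ?thesis using r pS[of i q] j by (simp add: p'S nodes_def)
    qed
    have split: "j = 0 \<and> p j q = p j q0 \<and> (q0 \<lhd> q \<longleftrightarrow> \<not> q0 \<lhd> r')"
      if "p j q = p j r'" "p' j q \<noteq> p' j r'" for j q r'
      using that by (cases j) (auto simp: p'0 p'S split: if_splits)
    have colour: "F 0 (\<lambda>_. y) (\<lambda>j\<in>{..<d}. p' (Suc j) (z (Suc j))) = c" for z
    proof -
      let ?u = "\<lambda>j\<in>{..<d}. p (Suc j) (z (Suc j))"
      have "F 0 (\<lambda>_. y) (\<lambda>j\<in>{..<d}. r j (?u j)) = c"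
        using col[THEN bspec, OF tup_p] pS(3) by simp
      moreover have "(\<lambda>j\<in>{..<d}. r j (?u j)) = (\<lambda>j\<in>{..<d}. p' (Suc j) (z (Suc j)))"
        by (rule restrict_ext) (simp add: p'S)
      ultimately show ?thesis by simp
    qed
    have side: "y \<sqsubseteq> p' 0 q \<and> (if q0 \<lhd> q then y \<lhd> p' 0 q else p' 0 q \<lhd> y)"
      if "p 0 q = p 0 q0" for q
      using that yL yR by (simp add: p'0)
    have "step d a F c j0 q0 st (\<beta>, p') y"
      unfolding step_def p_def[symmetric] \<mu>_def[symmetric] fst_conv snd_conv 0 nat.case
    proof (intro conjI)
      show "\<exists>\<xi>. lev y \<le> a \<xi> \<and> osuc \<xi> \<le> \<beta>" using \<xi> by blast
      show "\<forall>j\<le>d. \<forall>q. p j q \<sqsubseteq> p' j q" using ext by blast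
      show "\<forall>q. p 0 q = p 0 q0 \<longrightarrow> y \<sqsubseteq> p' 0 q \<and> (if q0 \<lhd> q then y \<lhd> p' 0 q else p' 0 q \<lhd> y)"
        using side by blast
      show "\<forall>j\<le>d. \<forall>q r. p j q = p j r \<longrightarrow> p' j q \<noteq> p' j r \<longrightarrow>
          j = 0 \<and> p j q = p j q0 \<and> (q0 \<lhd> q \<longleftrightarrow> \<not> q0 \<lhd> r)"
        by (intro allI impI) (rule split)
      show "\<forall>z. z 0 = q0 \<longrightarrow> F 0 (\<lambda>_. y) (\<lambda>j\<in>{..<d}. p' (Suc j) (z (Suc j))) = c"
        using colour by blast
    qed (use \<xi> y in blast)+
    moreover have "valid d Y a s0 u0 \<alpha>0 (\<beta>, p')"
      unfolding valid_def fst_conv snd_conv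
    proof (intro conjI allI impI)
      show "\<alpha>0 \<le> \<beta>" using le0 \<xi>(3) by simp
      fix j q assume j: "j \<le> d"
      show "p' j q \<in> nodes Y j" "lev (p' j q) = a \<beta>" using ext[OF j] by blast+
      show "base s0 u0 j \<sqsubseteq> p' j q" using tle_trans[OF p(3)[OF j]] ext[OF j] by blast
    qed
    ultimately show ?thesis by blast
  next
    case (Suc i)
    then have i: "i < d" using j0 by simp
    \<comment> \<open>A later coordinate is placed exactly at its current node, which is the
      situation of \<open>tail_system_link\<close>.\<close>
    define y where "y = p (Suc i) q0"
    have y: "y \<in> Y i" "lev y = a \<mu>" using pS[OF i] by (simp_all add: y_def)
    obtain R where R: "R \<in> Y i" "y \<sqsubseteq> R" "y \<lhd> R" "lev R = a (osuc \<mu>)"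
      using sub_right[OF Y[OF i] y] by blast
    define X where "X t = (SOME u. t \<sqsubseteq> u \<and> lev u = a (osuc \<mu>))" for t
    have X: "p 0 q \<sqsubseteq> X (p 0 q) \<and> lev (X (p 0 q)) = a (osuc \<mu>)" for q
      unfolding X_def
      by (rule someI_ex, rule child)
        (use p(2)[of 0 q] osuc_greater[of \<mu>] strict_mono_less[OF a] in \<open>simp add: less_imp_le\<close>)
    \<comment> \<open>The point \<open>q0\<close> itself is not to the right of \<open>q0\<close>
      and so follows \<open>cs\<close>, as the linking clause demands; only points to its right
      leave for \<open>R\<close>.\<close>
    define p' where "p' j q = (case j of
        0 \<Rightarrow> X (p 0 q)
      | Suc l \<Rightarrow> if l = i \<and> p (Suc i) q = y \<and> q0 \<lhd> q then R else cs l (p (Suc l) q))" for j q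
    have p'0: "p' 0 q = X (p 0 q)" for q by (simp add: p'_def)
    have p'S: "p' (Suc l) q = (if l = i \<and> p (Suc i) q = y \<and> q0 \<lhd> q then R else cs l (p (Suc l) q))"
      for l q by (simp add: p'_def)
    have ext: "p j q \<sqsubseteq> p' j q \<and> p' j q \<in> nodes Y j \<and> lev (p' j q) = a (osuc \<mu>)" if j: "j \<le> d" for j q
    proof (cases j)
      case 0
      then show ?thesis using X[of q] by (simp add: p'0 nodes_def)
    next
      case (Suc l)
      then have "l < d" using j by simp
      then show ?thesis using cs[OF _ pS(1,2), of l q] R Suc by (auto simp: p'S nodes_def)
    qed
    have split: "j = Suc i \<and> p j q = p j q0 \<and> (q0 \<lhd> q \<longleftrightarrow> \<not> q0 \<lhd> r')"
      if "p j q = p j r'" "p' j q \<noteq> p' j r'" for j q r'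
      using that by (cases j) (auto simp: p'0 p'S y_def split: if_splits)
    have colour: "F (Suc i) (x(Suc i := y)) (\<lambda>j\<in>{..<d}. p' (Suc j) (z (Suc j))) =
        F i x (\<lambda>j\<in>{..<d}. p (Suc j) (z (Suc j)))"
      if z: "z (Suc i) = q0" and x: "\<And>m. m \<le> i \<Longrightarrow> lev (x m) \<le> a \<mu>" for z x
    proof -
      let ?u = "\<lambda>j\<in>{..<d}. p (Suc j) (z (Suc j))"
      have "F (Suc i) (x(Suc i := ?u i)) (\<lambda>j\<in>{..<d}. cs j (?u j)) = F i x ?u"
        by (rule tail_system_link[OF sys _ i x tup_p]) simp
      moreover have "(\<lambda>j\<in>{..<d}. cs j (?u j)) = (\<lambda>j\<in>{..<d}. p' (Suc j) (z (Suc j)))"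
        by (rule restrict_ext) (use z in \<open>auto simp: p'S\<close>)
      ultimately show ?thesis using i z by (simp add: y_def)
    qed
    have side: "y \<sqsubseteq> p' (Suc i) q \<and> (if q0 \<lhd> q then y \<lhd> p' (Suc i) q else p' (Suc i) q \<lhd> y)"
      if "p (Suc i) q = p (Suc i) q0" for q
      using that R cs[OF i y] by (simp add: p'S y_def)
    have "step d a F c j0 q0 st (osuc \<mu>, p') y"
      unfolding step_def p_def[symmetric] \<mu>_def[symmetric] fst_conv snd_conv Suc nat.case
    proof (intro conjI)
      show "\<exists>\<xi>. lev y \<le> a \<xi> \<and> osuc \<xi> \<le> osuc \<mu>" using y(2) by (intro exI[of _ \<mu>]) simp
      show "p (Suc i) q0 \<sqsubseteq> y" by (simp add: y_def)
      show "\<forall>j\<le>d. \<forall>q. p j q \<sqsubseteq> p' j q" using ext by blast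
      show "\<forall>q. p (Suc i) q = p (Suc i) q0 \<longrightarrow>
          y \<sqsubseteq> p' (Suc i) q \<and> (if q0 \<lhd> q then y \<lhd> p' (Suc i) q else p' (Suc i) q \<lhd> y)"
        using side by blast
      show "\<forall>j\<le>d. \<forall>q r. p j q = p j r \<longrightarrow> p' j q \<noteq> p' j r \<longrightarrow>
          j = Suc i \<and> p j q = p j q0 \<and> (q0 \<lhd> q \<longleftrightarrow> \<not> q0 \<lhd> r)"
        by (intro allI impI) (rule split)
      show "\<forall>z. z (Suc i) = q0 \<longrightarrow> (\<forall>x. (\<forall>m\<le>i. lev (x m) \<le> a \<mu>) \<longrightarrow>
          F (Suc i) (x(Suc i := y)) (\<lambda>j\<in>{..<d}. p' (Suc j) (z (Suc j))) =
          F i x (\<lambda>j\<in>{..<d}. p (Suc j) (z (Suc j))))"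
        using colour by blast
    qed simp
    moreover have "valid d Y a s0 u0 \<alpha>0 (osuc \<mu>, p')"
      unfolding valid_def fst_conv snd_conv
    proof (intro conjI allI impI)
      show "\<alpha>0 \<le> osuc \<mu>" by (rule order_trans[OF le0 less_imp_le[OF osuc_greater]])
      fix j q assume j: "j \<le> d"
      show "p' j q \<in> nodes Y j" "lev (p' j q) = a (osuc \<mu>)" using ext[OF j] by blast+
      show "base s0 u0 j \<sqsubseteq> p' j q" using tle_trans[OF p(3)[OF j]] ext[OF j] by blast
    qed
    ultimately show ?thesis by blast
  qed
qed


lemma stepD:
  assumes "step d a F c j0 q0 st st' y"
  shows "fst st < fst st'"
    and "\<exists>\<xi>. lev y \<le> a \<xi> \<and> osuc \<xi> \<le> fst st'"
    and "snd st j0 q0 \<sqsubseteq> y"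
    and "\<forall>j\<le>d. \<forall>q. snd st j q \<sqsubseteq> snd st' j q"
    and "snd st j0 q = snd st j0 q0 \<Longrightarrow> y \<sqsubseteq> snd st' j0 q \<and>
      (if q0 \<lhd> q then y \<lhd> snd st' j0 q else snd st' j0 q \<lhd> y)"
    and "j \<le> d \<Longrightarrow> snd st j q = snd st j r \<Longrightarrow> snd st' j q \<noteq> snd st' j r \<Longrightarrow>
      j = j0 \<and> snd st j q = snd st j q0 \<and> (q0 \<lhd> q \<longleftrightarrow> \<not> q0 \<lhd> r)"
    and "z j0 = q0 \<Longrightarrow> (case j0 of
        0 \<Rightarrow> F 0 (\<lambda>_. y) (\<lambda>j\<in>{..<d}. snd st' (Suc j) (z (Suc j))) = c
      | Suc i \<Rightarrow> \<forall>x. (\<forall>m\<le>i. lev (x m) \<le> a (fst st)) \<longrightarrow>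
          F j0 (x(j0 := y)) (\<lambda>j\<in>{..<d}. snd st' (Suc j) (z (Suc j))) =
          F i x (\<lambda>j\<in>{..<d}. snd st (Suc j) (z (Suc j))))"
proof -
  note s1 = assms[unfolded step_def]
  note p1 = s1[THEN conjunct1] and s2 = s1[THEN conjunct2]
  note p2 = s2[THEN conjunct1] and s3 = s2[THEN conjunct2]
  note p3 = s3[THEN conjunct1] and s4 = s3[THEN conjunct2]
  note p4 = s4[THEN conjunct1] and s5 = s4[THEN conjunct2]
  note p5 = s5[THEN conjunct1] and s6 = s5[THEN conjunct2]
  note p6 = s6[THEN conjunct1] and p7 = s6[THEN conjunct2]
  show "fst st < fst st'" by (rule p1)
  show "\<exists>\<xi>. lev y \<le> a \<xi> \<and> osuc \<xi> \<le> fst st'" by (rule p2)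
  show "snd st j0 q0 \<sqsubseteq> y" by (rule p3)
  show "\<forall>j\<le>d. \<forall>q. snd st j q \<sqsubseteq> snd st' j q" by (rule p4)
  show "y \<sqsubseteq> snd st' j0 q \<and> (if q0 \<lhd> q then y \<lhd> snd st' j0 q else snd st' j0 q \<lhd> y)"
    if "snd st j0 q = snd st j0 q0" by (rule p5[THEN spec, THEN mp, OF that])
  show "j = j0 \<and> snd st j q = snd st j q0 \<and> (q0 \<lhd> q \<longleftrightarrow> \<not> q0 \<lhd> r)"
    if "j \<le> d" "snd st j q = snd st j r" "snd st' j q \<noteq> snd st' j r"
    by (rule p6[THEN spec, THEN mp, THEN spec, THEN spec, THEN mp, THEN mp, OF that])
  show "case j0 of
        0 \<Rightarrow> F 0 (\<lambda>_. y) (\<lambda>j\<in>{..<d}. snd st' (Suc j) (z (Suc j))) = c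
      | Suc i \<Rightarrow> \<forall>x. (\<forall>m\<le>i. lev (x m) \<le> a (fst st)) \<longrightarrow>
          F j0 (x(j0 := y)) (\<lambda>j\<in>{..<d}. snd st' (Suc j) (z (Suc j))) =
          F i x (\<lambda>j\<in>{..<d}. snd st (Suc j) (z (Suc j)))" if "z j0 = q0"
    by (rule p7[THEN spec[of _ z], THEN mp, OF that])
qed

lemma nodes_chain:
  assumes Y: "\<And>j. j < d \<Longrightarrow> sub (Y j) a" and j: "j \<le> d"
    and C: "C \<subseteq> nodes Y j" "chain C" "\<And>t. t \<in> C \<Longrightarrow> lev t \<le> a \<xi>"
  shows "\<exists>u\<in>nodes Y j. lev u = a \<xi> \<and> (\<forall>t\<in>C. t \<sqsubseteq> u)"
proof (cases j)
  case 0
  then show ?thesis using sub_chain[OF sub_UNIV, of C "a \<xi>"] C by (simp add: nodes_def)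
next
  case (Suc i)
  then show ?thesis using sub_chain[OF Y, of i C \<xi>] C j by (simp add: nodes_def)
qed

text \<open>Moving all nodes further up preserves sides and common nodes, and the tail clause
  preserves colours. The level can therefore be pushed beyond any \<beta>, which later makes the
  embedding respect the enumeration.\<close>

lemma raise_step:
  assumes sys: "tail_system d f \<delta> 0 Y a cs F" and j0: "j0 \<le> d"
    and step: "step d a F c j0 q0 st st' y" and valid: "valid d Y a s0 u0 \<alpha>0 st'"
  shows "\<exists>st''. step d a F c j0 q0 st st'' y \<and> valid d Y a s0 u0 \<alpha>0 st'' \<and> \<beta> < fst st''"
proof -
  note a = tail_system_mono[OF sys] and Y = tail_system_sub[OF sys]
  define \<mu> where "\<mu> = max (fst st') (osuc \<beta>)"
  have \<mu>: "fst st' \<le> \<mu>" "\<beta> < \<mu>" by (simp_all add: \<mu>_def less_max_iff_disj)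
  define X where "X j t = (SOME u. u \<in> nodes Y j \<and> lev u = a \<mu> \<and> t \<sqsubseteq> u)" for j t
  define p where "p = snd st'"
  have p: "p j q \<in> nodes Y j" "lev (p j q) = a (fst st')" "base s0 u0 j \<sqsubseteq> p j q" if "j \<le> d" for j q
    using valid that by (simp_all add: valid_def p_def)
  have X: "X j (p j q) \<in> nodes Y j \<and> lev (X j (p j q)) = a \<mu> \<and> p j q \<sqsubseteq> X j (p j q)"
    if j: "j \<le> d" for j q
    unfolding X_def
  proof (rule someI_ex)
    have "\<exists>u\<in>nodes Y j. lev u = a \<mu> \<and> (\<forall>t\<in>{p j q}. t \<sqsubseteq> u)"
      by (rule nodes_chain[where Y = Y and d = d, OF Y j])
        (use p[OF j] \<mu>(1) strict_mono_less_eq[OF a] in \<open>auto simp: chain_def\<close>)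
    then show "\<exists>u. u \<in> nodes Y j \<and> lev u = a \<mu> \<and> p j q \<sqsubseteq> u" by auto
  qed
  define p' where "p' j q = X j (p j q)" for j q
  have ext: "p j q \<sqsubseteq> p' j q" if "j \<le> d" for j q using X[OF that] by (simp add: p'_def)
  have tup_p: "(\<lambda>j\<in>{..<d}. p (Suc j) (z (Suc j))) \<in> tup d Y a (fst st')" for z
  proof (rule tupI)
    fix j assume "j < d"
    then show "p (Suc j) (z (Suc j)) \<in> Y j \<and> lev (p (Suc j) (z (Suc j))) = a (fst st')"
      using p(1,2)[of "Suc j" "z (Suc j)"] by (simp add: nodes_def)
  qed
  have tup_p': "(\<lambda>j\<in>{..<d}. p' (Suc j) (z (Suc j))) \<in> tup d Y a \<mu>" for z
  proof (rule tupI)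
    fix j assume "j < d"
    then show "p' (Suc j) (z (Suc j)) \<in> Y j \<and> lev (p' (Suc j) (z (Suc j))) = a \<mu>"
      using X[of "Suc j" "z (Suc j)"] by (simp add: nodes_def p'_def)
  qed
  have tail: "F i x (\<lambda>j\<in>{..<d}. p' (Suc j) (z (Suc j))) = F i x (\<lambda>j\<in>{..<d}. p (Suc j) (z (Suc j)))"
    if i: "i \<le> d" and x: "\<And>m. m \<le> i \<Longrightarrow> lev (x m) \<le> a \<xi>" and \<xi>: "osuc \<xi> \<le> fst st'" for i x \<xi> z
  proof (rule tail_system_tail[OF sys _ i x _ \<xi> tup_p' tup_p])
    show "osuc \<xi> \<le> \<mu>" by (rule order_trans[OF \<xi> \<mu>(1)])
    fix j assume j: "j < d"
    have "a (osuc \<xi>) \<le> lev (p (Suc j) (z (Suc j)))"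
      using p(2)[of "Suc j" "z (Suc j)"] j \<xi> strict_mono_less_eq[OF a] by simp
    moreover have "p (Suc j) (z (Suc j)) \<sqsubseteq> p' (Suc j) (z (Suc j))" using ext[of "Suc j"] j by simp
    ultimately show "rs ((\<lambda>j\<in>{..<d}. p' (Suc j) (z (Suc j))) j) (a (osuc \<xi>)) =
        rs ((\<lambda>j\<in>{..<d}. p (Suc j) (z (Suc j))) j) (a (osuc \<xi>))"
      using rs_tle_eq j by simp
  qed simp
  obtain \<xi> where \<xi>: "lev y \<le> a \<xi>" "osuc \<xi> \<le> fst st'" using stepD(2)[OF step] by blast
  have "step d a F c j0 q0 st (\<mu>, p') y"
    unfolding step_def fst_conv snd_conv
  proof (intro conjI)
    show "fst st < \<mu>" by (rule less_le_trans[OF stepD(1)[OF step] \<mu>(1)])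
    show "\<exists>\<xi>. lev y \<le> a \<xi> \<and> osuc \<xi> \<le> \<mu>" using \<xi> order_trans[OF \<xi>(2) \<mu>(1)] by blast
    show "snd st j0 q0 \<sqsubseteq> y" by (rule stepD(3)[OF step])
    show "\<forall>j\<le>d. \<forall>q. snd st j q \<sqsubseteq> p' j q"
    proof (intro allI impI)
      fix j q assume j: "j \<le> d"
      show "snd st j q \<sqsubseteq> p' j q"
        by (rule tle_trans[OF _ ext[OF j]]) (use stepD(4)[OF step] j in \<open>simp add: p_def\<close>)
    qed
    show "\<forall>q. snd st j0 q = snd st j0 q0 \<longrightarrow> y \<sqsubseteq> p' j0 q \<and> (if q0 \<lhd> q then y \<lhd> p' j0 q else p' j0 q \<lhd> y)"
    proof (intro allI impI)
      fix q assume "snd st j0 q = snd st j0 q0"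
      from stepD(5)[OF step this]
      have *: "y \<sqsubseteq> p j0 q" "if q0 \<lhd> q then y \<lhd> p j0 q else p j0 q \<lhd> y" by (simp_all add: p_def)
      show "y \<sqsubseteq> p' j0 q \<and> (if q0 \<lhd> q then y \<lhd> p' j0 q else p' j0 q \<lhd> y)"
        using tle_trans[OF *(1) ext[OF j0]] side_left[OF *(1) ext[OF j0]] side_right[OF *(1) ext[OF j0]]
          *(2) by simp
    qed
    show "\<forall>j\<le>d. \<forall>q r. snd st j q = snd st j r \<longrightarrow> p' j q \<noteq> p' j r \<longrightarrow>
        j = j0 \<and> snd st j q = snd st j q0 \<and> (q0 \<lhd> q \<longleftrightarrow> \<not> q0 \<lhd> r)"
    proof (intro allI impI)
      fix j q r assume *: "j \<le> d" "snd st j q = snd st j r" "p' j q \<noteq> p' j r"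
      then have "snd st' j q \<noteq> snd st' j r" by (auto simp: p'_def p_def)
      then show "j = j0 \<and> snd st j q = snd st j q0 \<and> (q0 \<lhd> q \<longleftrightarrow> \<not> q0 \<lhd> r)"
        by (rule stepD(6)[OF step *(1,2)])
    qed
    show "\<forall>z. z j0 = q0 \<longrightarrow> (case j0 of
        0 \<Rightarrow> F 0 (\<lambda>_. y) (\<lambda>j\<in>{..<d}. p' (Suc j) (z (Suc j))) = c
      | Suc i \<Rightarrow> \<forall>x. (\<forall>m\<le>i. lev (x m) \<le> a (fst st)) \<longrightarrow>
          F j0 (x(j0 := y)) (\<lambda>j\<in>{..<d}. p' (Suc j) (z (Suc j))) =
          F i x (\<lambda>j\<in>{..<d}. snd st (Suc j) (z (Suc j))))"
    proof (intro allI impI)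
      fix z assume z: "z j0 = q0"
      show "case j0 of
        0 \<Rightarrow> F 0 (\<lambda>_. y) (\<lambda>j\<in>{..<d}. p' (Suc j) (z (Suc j))) = c
      | Suc i \<Rightarrow> \<forall>x. (\<forall>m\<le>i. lev (x m) \<le> a (fst st)) \<longrightarrow>
          F j0 (x(j0 := y)) (\<lambda>j\<in>{..<d}. p' (Suc j) (z (Suc j))) =
          F i x (\<lambda>j\<in>{..<d}. snd st (Suc j) (z (Suc j)))"
      proof (cases j0)
        case 0
        have "F 0 (\<lambda>_. y) (\<lambda>j\<in>{..<d}. p' (Suc j) (z (Suc j))) =
            F 0 (\<lambda>_. y) (\<lambda>j\<in>{..<d}. p (Suc j) (z (Suc j)))"
          by (rule tail[OF _ _ \<xi>(2)]) (use \<xi>(1) in simp_all)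
        also have "\<dots> = c" using stepD(7)[where z = z, OF step z] 0 by (simp add: p_def)
        finally show ?thesis using 0 by simp
      next
        case (Suc i)
        have "F (Suc i) (x(Suc i := y)) (\<lambda>j\<in>{..<d}. p' (Suc j) (z (Suc j))) =
          F i x (\<lambda>j\<in>{..<d}. snd st (Suc j) (z (Suc j)))" if x: "\<forall>m\<le>i. lev (x m) \<le> a (fst st)" for x
        proof -
          \<comment> \<open>Has to bound the new point as well as all earlier ones while staying
            below the level of the state after the step.\<close>
          define \<zeta> where "\<zeta> = max \<xi> (fst st)"
          have "a \<xi> \<le> a \<zeta>" "a (fst st) \<le> a \<zeta>"
            using strict_mono_less_eq[OF a] by (simp_all add: \<zeta>_def)
          have le: "lev ((x(Suc i := y)) m) \<le> a \<zeta>" if "m \<le> Suc i" for m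
          proof (cases "m = Suc i")
            case True
            then show ?thesis using order_trans[OF \<xi>(1) \<open>a \<xi> \<le> a \<zeta>\<close>] by simp
          next
            case False
            then have "lev (x m) \<le> a (fst st)" using x that by simp
            then show ?thesis using order_trans[OF _ \<open>a (fst st) \<le> a \<zeta>\<close>] False by simp
          qed
          have os: "osuc \<zeta> \<le> fst st'"
            using \<xi>(2) stepD(1)[OF step] by (simp add: \<zeta>_def osuc_le_iff)
          have "F (Suc i) (x(Suc i := y)) (\<lambda>j\<in>{..<d}. p' (Suc j) (z (Suc j))) =
            F (Suc i) (x(Suc i := y)) (\<lambda>j\<in>{..<d}. p (Suc j) (z (Suc j)))"
            by (rule tail[OF _ _ os], use j0 Suc in simp, rule le)
          also have "\<dots> = F i x (\<lambda>j\<in>{..<d}. snd st (Suc j) (z (Suc j)))"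
            using stepD(7)[where z = z, OF step z] Suc x by (simp add: p_def)
          finally show ?thesis .
        qed
        then show ?thesis using Suc by simp
      qed
    qed
  qed
  moreover have "valid d Y a s0 u0 \<alpha>0 (\<mu>, p')"
    unfolding valid_def fst_conv snd_conv
  proof (intro conjI allI impI)
    show "\<alpha>0 \<le> \<mu>" using valid \<mu>(1) unfolding valid_def by (blast intro: order_trans)
    fix j q assume j: "j \<le> d"
    show "p' j q \<in> nodes Y j" "lev (p' j q) = a \<mu>" using X[OF j] by (simp_all add: p'_def)
    show "base s0 u0 j \<sqsubseteq> p' j q" by (rule tle_trans[OF p(3)[OF j] ext[OF j]])
  qed
  ultimately show ?thesis using \<mu>(2) by (intro exI[of _ "(\<mu>, p')"]) simp
qed

text \<open>Stage \<open>osuc (e j q)\<close> places point \<open>q\<close> of copy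
  \<open>j\<close>; by injectivity of \<open>e\<close> it has no other task. All other stages take
  bounds. The last clause ensures that two points part only at a step, where their sides are
  controlled.\<close>

lemma construction:
  fixes e :: "nat \<Rightarrow> 'k \<Rightarrow> 'k"
  assumes sys: "tail_system d f \<delta> 0 Y a cs F"
    and u0: "u0 \<in> tup d Y a \<alpha>0"
    and dense: "\<And>s \<alpha>. s0 \<sqsubseteq> s \<Longrightarrow> \<alpha>0 \<le> \<alpha> \<Longrightarrow> \<exists>s'. s \<sqsubseteq> s' \<and> dense_colour d Y a F u0 c \<alpha> s'"
    and e: "\<And>i j q r. i \<le> d \<Longrightarrow> j \<le> d \<Longrightarrow> e i q = e j r \<Longrightarrow> i = j \<and> q = r"
  shows "\<exists>st. (\<forall>\<nu>. valid d Y a s0 u0 \<alpha>0 (st \<nu>)) \<and>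
    (\<forall>\<eta> \<nu>. \<eta> < \<nu> \<longrightarrow> fst (st \<eta>) < fst (st \<nu>)) \<and>
    (\<forall>\<eta> \<nu> j q. \<eta> < \<nu> \<longrightarrow> j \<le> d \<longrightarrow> snd (st \<eta>) j q \<sqsubseteq> snd (st \<nu>) j q) \<and>
    (\<forall>j q. j \<le> d \<longrightarrow> (\<exists>y. step d a F c j q (st (e j q)) (st (osuc (e j q))) y \<and> e j y < fst (st (osuc (e j q))))) \<and>
    (\<forall>\<nu> j q r. (\<nexists>i z. i \<le> d \<and> \<nu> = osuc (e i z)) \<longrightarrow> j \<le> d \<longrightarrow>
      (\<forall>\<eta><\<nu>. snd (st \<eta>) j q = snd (st \<eta>) j r) \<longrightarrow> snd (st \<nu>) j q = snd (st \<nu>) j r)"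
proof -
  note a = tail_system_mono[OF sys] and Y = tail_system_sub[OF sys]
  \<comment> \<open>The first level must lie above the base nodes: the tuple \<open>u0\<close> at
    level \<open>a \<alpha>0\<close> and the node \<open>s0\<close>.\<close>
  define A where "A = max \<alpha>0 (lev s0)"
  let ?V = "valid d Y a s0 u0 \<alpha>0"
  let ?stage = "\<lambda>\<nu>. \<exists>i z. i \<le> d \<and> \<nu> = osuc (e i z)"
  let ?mono = "\<lambda>st \<nu> r. \<forall>\<eta><\<nu>. fst (st \<eta>) < fst r \<and> (\<forall>j\<le>d. \<forall>q. snd (st \<eta>) j q \<sqsubseteq> snd r j q)"
  let ?step = "\<lambda>st \<nu> r. \<forall>j q. j \<le> d \<longrightarrow> \<nu> = osuc (e j q) \<longrightarrow> (\<exists>y. step d a F c j q (st (e j q)) r y \<and> e j y < fst r)"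
  let ?limit = "\<lambda>st \<nu> r. \<not> ?stage \<nu> \<longrightarrow> (\<forall>j q q'. j \<le> d \<longrightarrow>
      (\<forall>\<eta><\<nu>. snd (st \<eta>) j q = snd (st \<eta>) j q') \<longrightarrow> snd r j q = snd r j q')"
  let ?P = "\<lambda>st (\<nu>::'k) r. ?V r \<and> ?mono st \<nu> r \<and> ?step st \<nu> r \<and> ?limit st \<nu> r"
  have "\<exists>st. \<forall>\<nu>. ?P st \<nu> (st \<nu>)"
  proof (rule dependent_wellorder_choice[where P = ?P])
    fix st st' :: "'k \<Rightarrow> 'k \<times> (nat \<Rightarrow> 'k \<Rightarrow> 'k)" and \<nu> r
    assume eq: "\<And>\<eta>. \<eta> < \<nu> \<Longrightarrow> st \<eta> = st' \<eta>"
    have "?mono st \<nu> r = ?mono st' \<nu> r" using eq by simp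
    moreover have "?step st \<nu> r = ?step st' \<nu> r" using eq osuc_greater by auto
    moreover have "?limit st \<nu> r = ?limit st' \<nu> r" using eq by simp
    ultimately show "?P st \<nu> r = ?P st' \<nu> r" by argo
  next
    fix \<nu> :: 'k and st :: "'k \<Rightarrow> 'k \<times> (nat \<Rightarrow> 'k \<Rightarrow> 'k)"
    assume IH: "\<And>\<eta>. \<eta> < \<nu> \<Longrightarrow> ?P st \<eta> (st \<eta>)"
    show "\<exists>r. ?P st \<nu> r"
    proof (cases "?stage \<nu>")
      case True
      then obtain j q where j: "j \<le> d" and \<nu>: "\<nu> = osuc (e j q)" by blast
      then have lt: "e j q < \<nu>" using osuc_greater by simp
      have V: "?V (st (e j q))" using IH[OF lt] by (rule conjunct1)
      have "\<exists>r y. step d a F c j q (st (e j q)) r y \<and> ?V r"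
        by (rule step_exists[OF sys _ V j]) (rule dense)
      then obtain r0 y where r0: "step d a F c j q (st (e j q)) r0 y" "?V r0" by blast
      obtain r where r: "step d a F c j q (st (e j q)) r y" "?V r" "e j y < fst r"
        using raise_step[OF sys j r0] by blast
      have m: "fst (st (e j q)) < fst r" "\<forall>i\<le>d. \<forall>z. snd (st (e j q)) i z \<sqsubseteq> snd r i z"
        using stepD(1,4)[OF r(1)] by blast+
      have n1: "fst (st \<eta>) < fst r \<and> (\<forall>i\<le>d. \<forall>z. snd (st \<eta>) i z \<sqsubseteq> snd r i z)" if "\<eta> < \<nu>" for \<eta>
      proof (cases "\<eta> = e j q")
        case True
        then show ?thesis using m by simp
      next
        case False
        then have "\<eta> < e j q" using that unfolding \<nu> less_osuc_iff by simp
        then have *: "fst (st \<eta>) < fst (st (e j q))"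
          "\<forall>i\<le>d. \<forall>z. snd (st \<eta>) i z \<sqsubseteq> snd (st (e j q)) i z"
          using IH[OF lt, THEN conjunct2, THEN conjunct1] by simp_all
        have "snd (st \<eta>) i z \<sqsubseteq> snd r i z" if "i \<le> d" for i z
          by (rule tle_trans[of _ "snd (st (e j q)) i z"]) (use *(2) m(2) that in simp_all)
        then show ?thesis using less_trans[OF *(1) m(1)] by simp
      qed
      have n2: "\<exists>y. step d a F c i z (st (e i z)) r y \<and> e i y < fst r" if "i \<le> d" "\<nu> = osuc (e i z)" for i z
      proof -
        have "i = j \<and> z = q" using e[OF that(1) j] osuc_inject[of "e i z" "e j q"] that(2) \<nu> by simp
        then show ?thesis using r(1,3) by blast
      qed
      show ?thesis
      proof (rule exI[of _ r], intro conjI)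
        show "?V r" by (rule r(2))
        show "?mono st \<nu> r" using n1 by simp
        show "?step st \<nu> r" using n2 by simp
        show "?limit st \<nu> r" using True by simp
      qed
    next
      case False
      obtain B where B: "\<And>\<eta>. \<eta> < \<nu> \<Longrightarrow> fst (st \<eta>) < B"
        using small_bounded[OF small_image[OF small_lessThan[of \<nu>], of "\<lambda>\<eta>. fst (st \<eta>)"]] by auto
      define M where "M = max A B"
      have M: "\<alpha>0 \<le> M" "lev s0 \<le> M" "B \<le> M" by (simp_all add: M_def A_def le_max_iff_disj)
      \<comment> \<open>The bound is a function of the set of earlier nodes and not of the point, so
        points with the same history keep a common node.\<close>
      define W where "W j C = (SOME u. u \<in> nodes Y j \<and> lev u = a M \<and> (\<forall>t\<in>C. t \<sqsubseteq> u))" for j C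
      define C where "C j q = insert (base s0 u0 j) ((\<lambda>\<eta>. snd (st \<eta>) j q) ` {..<\<nu>})" for j q
      define p where "p j q = W j (C j q)" for j q
      have p: "p j q \<in> nodes Y j \<and> lev (p j q) = a M \<and> (\<forall>t\<in>C j q. t \<sqsubseteq> p j q)" if j: "j \<le> d" for j q
        unfolding p_def W_def
      proof (rule someI_ex)
        have V: "\<And>\<eta>. \<eta> < \<nu> \<Longrightarrow> snd (st \<eta>) j q \<in> nodes Y j"
          "\<And>\<eta>. \<eta> < \<nu> \<Longrightarrow> lev (snd (st \<eta>) j q) = a (fst (st \<eta>))"
          "\<And>\<eta>. \<eta> < \<nu> \<Longrightarrow> base s0 u0 j \<sqsubseteq> snd (st \<eta>) j q"
          using IH j by (simp_all add: valid_def)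
        have bn: "base s0 u0 j \<in> nodes Y j" "lev (base s0 u0 j) \<le> a M"
        proof -
          have "lev s0 \<le> a M" using strict_mono_ge[OF a, of M] M(2) by simp
          moreover have "a \<alpha>0 \<le> a M" using strict_mono_less_eq[OF a] M(1) by simp
          ultimately show "base s0 u0 j \<in> nodes Y j" "lev (base s0 u0 j) \<le> a M"
            using tupD[OF u0] j by (cases j; simp add: base_def nodes_def)+
        qed
        have "\<exists>u\<in>nodes Y j. lev u = a M \<and> (\<forall>t\<in>C j q. t \<sqsubseteq> u)"
        proof (rule nodes_chain[where Y = Y and d = d, OF Y j])
          show "C j q \<subseteq> nodes Y j" using V(1) bn(1) by (auto simp: C_def)
          show "lev t \<le> a M" if "t \<in> C j q" for t
          proof -
            have "a (fst (st \<eta>)) \<le> a M" if "\<eta> < \<nu>" for \<eta>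
              using B[OF that] M(3) strict_mono_less_eq[OF a] by simp
            then show ?thesis using that V(2) bn(2) by (auto simp: C_def)
          qed
          have "snd (st \<eta>) j q \<sqsubseteq> snd (st \<zeta>) j q \<or> snd (st \<zeta>) j q \<sqsubseteq> snd (st \<eta>) j q"
            if "\<eta> < \<nu>" "\<zeta> < \<nu>" for \<eta> \<zeta>
            using less_linear[of \<eta> \<zeta>] j
              IH[OF that(1), THEN conjunct2, THEN conjunct1] IH[OF that(2), THEN conjunct2, THEN conjunct1]
            by auto
          then have "chain ((\<lambda>\<eta>. snd (st \<eta>) j q) ` {..<\<nu>})" by (auto simp: chain_def)
          then show "chain (C j q)" using V(3) unfolding C_def by (auto simp: chain_def)
        qed
        then show "\<exists>u. u \<in> nodes Y j \<and> lev u = a M \<and> (\<forall>t\<in>C j q. t \<sqsubseteq> u)" by blast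
      qed
      have n1: "?V (M, p)"
        unfolding valid_def using p M(1) by (simp add: C_def)
      have n2: "?mono st \<nu> (M, p)"
        using p less_le_trans[OF B M(3)] by (auto simp: C_def)
      have n3: "?limit st \<nu> (M, p)"
      proof (intro impI allI)
        fix j q q' assume "\<forall>\<eta><\<nu>. snd (st \<eta>) j q = snd (st \<eta>) j q'"
        then have "C j q = C j q'" unfolding C_def by simp
        then show "snd (M, p) j q = snd (M, p) j q'" by (simp add: p_def)
      qed
      have n4: "?step st \<nu> (M, p)" using False by simp
      show ?thesis by (rule exI[of _ "(M, p)"], intro conjI n1 n2 n3 n4)
    qed
  qed
  then obtain st where st: "\<forall>\<nu>. ?P st \<nu> (st \<nu>)" by (rule exE)
  show ?thesis
  proof (rule exI[of _ st], intro conjI)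
    show "\<forall>\<nu>. ?V (st \<nu>)" using st by simp
    show "\<forall>\<eta> \<nu>. \<eta> < \<nu> \<longrightarrow> fst (st \<eta>) < fst (st \<nu>)" using st by simp
    show "\<forall>\<eta> \<nu> j q. \<eta> < \<nu> \<longrightarrow> j \<le> d \<longrightarrow> snd (st \<eta>) j q \<sqsubseteq> snd (st \<nu>) j q" using st by simp
    show "\<forall>j q. j \<le> d \<longrightarrow> (\<exists>y. step d a F c j q (st (e j q)) (st (osuc (e j q))) y \<and> e j y < fst (st (osuc (e j q))))"
      using st by simp
    show "\<forall>\<nu> j q r. (\<nexists>i z. i \<le> d \<and> \<nu> = osuc (e i z)) \<longrightarrow> j \<le> d \<longrightarrow>
      (\<forall>\<eta><\<nu>. snd (st \<eta>) j q = snd (st \<eta>) j r) \<longrightarrow> snd (st \<nu>) j q = snd (st \<nu>) j r"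
    proof (intro allI impI)
      fix \<nu> j q r assume *: "\<nexists>i z. i \<le> d \<and> \<nu> = osuc (e i z)" "j \<le> d"
        "\<forall>\<eta><\<nu>. snd (st \<eta>) j q = snd (st \<eta>) j r"
      from st have "?limit st \<nu> (st \<nu>)" by simp
      then show "snd (st \<nu>) j q = snd (st \<nu>) j r" using * by simp
    qed
  qed
qed

text \<open>Colours are controlled only for tuples whose coordinates are enumerated in increasing
  order; other orders follow by permuting coordinates. Preservation of \<open>e\<close> across
  copies makes such embeddings composable.\<close>

lemma monochromatic_embedding:
  fixes f :: "(nat \<Rightarrow> 'k) \<Rightarrow> 'k" and e :: "nat \<Rightarrow> 'k \<Rightarrow> 'k"
  assumes HL: "HL_tc TYPE('k) d" and f: "\<And>x. f x < \<delta>"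
    and e: "\<And>i j q r. i \<le> d \<Longrightarrow> j \<le> d \<Longrightarrow> e i q = e j r \<Longrightarrow> i = j \<and> q = r"
    and e_ge: "\<And>j y. j \<le> d \<Longrightarrow> y \<le> e j y"
  shows "\<exists>h c. (\<forall>j\<le>d. \<forall>q r. q \<lhd> r \<longrightarrow> h j q \<lhd> h j r) \<and>
    (\<forall>i\<le>d. \<forall>j\<le>d. \<forall>q r. e i q < e j r \<longrightarrow> e i (h i q) < e j (h j r)) \<and>
    (\<forall>x. (\<forall>i<d. e i (x i) < e (Suc i) (x (Suc i))) \<longrightarrow> f (\<lambda>j\<in>{..d}. h j (x j)) = c)"
proof -
  have "\<exists>Y a cs F. tail_system d f \<delta> 0 Y a cs F" by (rule tail_system_exists[OF HL f])
  then obtain Y a cs F where sys: "tail_system d f \<delta> 0 Y a cs F" by (elim exE) (rule that)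
  note a = tail_system_mono[OF sys]
  obtain s0 u0 \<alpha>0 c where D: "u0 \<in> tup d Y a \<alpha>0 \<and>
    (\<forall>s \<alpha>. s0 \<sqsubseteq> s \<longrightarrow> \<alpha>0 \<le> \<alpha> \<longrightarrow> (\<exists>s'. s \<sqsubseteq> s' \<and> dense_colour d Y a F u0 c \<alpha> s'))"
    using dense_colour_exists[OF HL sys] by (elim exE) (rule that)
  note u0 = D[THEN conjunct1] and D2 = D[THEN conjunct2]
  have dense: "\<exists>s'. s \<sqsubseteq> s' \<and> dense_colour d Y a F u0 c \<alpha> s'" if "s0 \<sqsubseteq> s" "\<alpha>0 \<le> \<alpha>" for s \<alpha>
    by (rule D2[THEN spec, THEN spec, THEN mp, THEN mp, OF that])
  let ?C = "\<lambda>st. (\<forall>\<nu>. valid d Y a s0 u0 \<alpha>0 (st \<nu>)) \<and>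
    (\<forall>\<eta> \<nu>. \<eta> < \<nu> \<longrightarrow> fst (st \<eta>) < fst (st \<nu>)) \<and>
    (\<forall>\<eta> \<nu> j q. \<eta> < \<nu> \<longrightarrow> j \<le> d \<longrightarrow> snd (st \<eta>) j q \<sqsubseteq> snd (st \<nu>) j q) \<and>
    (\<forall>j q. j \<le> d \<longrightarrow> (\<exists>y. step d a F c j q (st (e j q)) (st (osuc (e j q))) y \<and> e j y < fst (st (osuc (e j q))))) \<and>
    (\<forall>\<nu> j q r. (\<nexists>i z. i \<le> d \<and> \<nu> = osuc (e i z)) \<longrightarrow> j \<le> d \<longrightarrow>
      (\<forall>\<eta><\<nu>. snd (st \<eta>) j q = snd (st \<eta>) j r) \<longrightarrow> snd (st \<nu>) j q = snd (st \<nu>) j r)"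
  have "\<exists>st. ?C st" by (rule construction[OF sys u0 dense e])
  then obtain st where st: "?C st" by (elim exE) (rule that)
  note st1 = st[THEN conjunct1] and st2 = st[THEN conjunct2]
  note st3 = st2[THEN conjunct1] and st4 = st2[THEN conjunct2]
  note st5 = st4[THEN conjunct1] and st6 = st4[THEN conjunct2]
  note st7 = st6[THEN conjunct1] and st8 = st6[THEN conjunct2]
  have valid: "valid d Y a s0 u0 \<alpha>0 (st \<nu>)" for \<nu> by (rule st1[THEN spec])
  have L_less: "fst (st \<eta>) < fst (st \<nu>)" if "\<eta> < \<nu>" for \<eta> \<nu>
    by (rule st3[THEN spec, THEN spec, THEN mp, OF that])
  have p_less: "snd (st \<eta>) j q \<sqsubseteq> snd (st \<nu>) j q" if "\<eta> < \<nu>" "j \<le> d" for \<eta> \<nu> j q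
    by (rule st5[THEN spec, THEN spec, THEN spec, THEN spec, THEN mp, THEN mp, OF that])
  have ex_step: "\<exists>y. step d a F c j q (st (e j q)) (st (osuc (e j q))) y \<and>
    e j y < fst (st (osuc (e j q)))" if "j \<le> d" for j q
    by (rule st7[THEN spec, THEN spec, THEN mp, OF that])
  have limit: "snd (st \<nu>) j q = snd (st \<nu>) j r"
    if "\<nexists>i z. i \<le> d \<and> \<nu> = osuc (e i z)" "j \<le> d"
      "\<forall>\<eta><\<nu>. snd (st \<eta>) j q = snd (st \<eta>) j r" for \<nu> j q r
    by (rule st8[THEN spec, THEN spec, THEN spec, THEN spec, THEN mp, THEN mp, THEN mp, OF that])
  define L where "L \<nu> = fst (st \<nu>)" for \<nu>
  define p where "p \<nu> = snd (st \<nu>)" for \<nu>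
  define h where "h j q = (SOME y. step d a F c j q (st (e j q)) (st (osuc (e j q))) y \<and>
    e j y < fst (st (osuc (e j q))))" for j q
  have h: "step d a F c j q (st (e j q)) (st (osuc (e j q))) (h j q) \<and>
    e j (h j q) < fst (st (osuc (e j q)))" if "j \<le> d" for j q
    unfolding h_def by (rule someI_ex[OF ex_step[OF that]])
  note step = h[THEN conjunct1]
  have p_mono: "p \<eta> j q \<sqsubseteq> p \<nu> j q" if "\<eta> \<le> \<nu>" "j \<le> d" for \<eta> \<nu> j q
    using p_less[of \<eta> \<nu> j q] that by (auto simp: p_def order_le_less)
  have L_mono: "L \<eta> \<le> L \<nu>" if "\<eta> \<le> \<nu>" for \<eta> \<nu>
    using L_less[of \<eta> \<nu>] that by (auto simp: L_def order_le_less)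
  have lev_h: "\<exists>\<xi>. lev (h j q) \<le> a \<xi> \<and> osuc \<xi> \<le> L (osuc (e j q))" if "j \<le> d" for j q
    unfolding L_def by (rule stepD(2)[OF step[OF that]])
  have p_h: "p (e j q) j q \<sqsubseteq> h j q" if "j \<le> d" for j q
    unfolding p_def by (rule stepD(3)[OF step[OF that]])
  have side: "h j q \<sqsubseteq> p (osuc (e j q)) j r \<and>
      (if q \<lhd> r then h j q \<lhd> p (osuc (e j q)) j r else p (osuc (e j q)) j r \<lhd> h j q)"
    if "j \<le> d" "p (e j q) j r = p (e j q) j q" for j q r
    unfolding p_def by (rule stepD(5)[OF step[OF that(1)] that(2)[unfolded p_def]])
  have split: "i = j \<and> p (e j q) i r = p (e j q) i q \<and> (q \<lhd> r \<longleftrightarrow> \<not> q \<lhd> r')"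
    if "j \<le> d" "i \<le> d" "p (e j q) i r = p (e j q) i r'"
      "p (osuc (e j q)) i r \<noteq> p (osuc (e j q)) i r'" for i j q r r'
    unfolding p_def
    by (rule stepD(6)[OF step[OF that(1)] that(2) that(3,4)[unfolded p_def]])
  have p_below_h: "p \<eta> j q \<sqsubseteq> h j q" if "\<eta> \<le> e j q" "j \<le> d" for \<eta> j q
    by (rule tle_trans[OF p_mono[OF that] p_h[OF that(2)]])
  \<comment> \<open>The first stage with different nodes must be a step, and the point
    \<open>z\<close> placed there separates the two points, with \<open>z\<close> itself counted on
    the left.\<close>
  have diverge: "\<exists>z. e j z < \<nu> \<and> p (e j z) j q = p (e j z) j z \<and> p (e j z) j r = p (e j z) j z \<and>
      (z \<lhd> q \<longleftrightarrow> \<not> z \<lhd> r)"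
    if j: "j \<le> d" and ne: "p \<nu> j q \<noteq> p \<nu> j r" for j q r \<nu>
  proof -
    define \<mu> where "\<mu> = (LEAST \<mu>. p \<mu> j q \<noteq> p \<mu> j r)"
    have \<mu>: "p \<mu> j q \<noteq> p \<mu> j r" unfolding \<mu>_def by (rule LeastI[of _ \<nu>]) (rule ne)
    have eq: "p \<eta> j q = p \<eta> j r" if "\<eta> < \<mu>" for \<eta>
      using not_less_Least[of \<eta> "\<lambda>\<mu>. p \<mu> j q \<noteq> p \<mu> j r"] that unfolding \<mu>_def by blast
    have "\<mu> \<le> \<nu>" unfolding \<mu>_def by (rule Least_le) (rule ne)
    have "\<exists>i z. i \<le> d \<and> \<mu> = osuc (e i z)"
      using limit[of \<mu> j q r] eq \<mu> j unfolding p_def by blast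
    then obtain i z where i: "i \<le> d" "\<mu> = osuc (e i z)" by blast
    then have lt: "e i z < \<mu>" using osuc_greater by simp
    have "j = i \<and> p (e i z) j q = p (e i z) j z \<and> (z \<lhd> q \<longleftrightarrow> \<not> z \<lhd> r)"
      by (rule split[OF i(1) j eq[OF lt]]) (use \<mu> i(2) in simp)
    then show ?thesis using eq[OF lt] lt \<open>\<mu> \<le> \<nu>\<close> by (intro exI[of _ z]) auto
  qed
  have order: "h j q \<lhd> h j r" if j: "j \<le> d" and qr: "q \<lhd> r" for j q r
  proof -
    \<comment> \<open>If two points parted before either was placed, the image of the separating
      point lies between their images. In the remaining case they still share a node when the first
      is placed, and that step orders them.\<close>
    have via: "h j q \<lhd> h j r" if ne: "p \<nu> j q \<noteq> p \<nu> j r" and le: "\<nu> \<le> e j q" "\<nu> \<le> e j r" for \<nu>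
    proof -
      obtain z where z: "e j z < \<nu>" "p (e j z) j q = p (e j z) j z" "p (e j z) j r = p (e j z) j z"
        "z \<lhd> q \<longleftrightarrow> \<not> z \<lhd> r" using diverge[OF j ne] by blast
      have "\<not> z \<lhd> q" "z \<lhd> r" using z(4) qr by auto
      then have q': "h j z \<sqsubseteq> p (osuc (e j z)) j q" "p (osuc (e j z)) j q \<lhd> h j z"
        and r': "h j z \<sqsubseteq> p (osuc (e j z)) j r" "h j z \<lhd> p (osuc (e j z)) j r"
        using side[OF j z(2)] side[OF j z(3)] by simp_all
      have os: "osuc (e j z) \<le> e j q" "osuc (e j z) \<le> e j r"
        using osuc_leI[OF z(1)] le by simp_all
      have "h j q \<lhd> h j z" by (rule side_left[OF q'(1) p_below_h[OF os(1) j] q'(2)])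
      also have "h j z \<lhd> h j r" by (rule side_right[OF r'(1) p_below_h[OF os(2) j] r'(2)])
      finally show ?thesis .
    qed
    have "e j q \<noteq> e j r" using e[OF j j, of q r] qr by auto
    then consider "e j q < e j r" | "e j r < e j q" using less_linear by blast
    then show ?thesis
    proof cases
      case 1
      show ?thesis
      proof (cases "p (e j q) j q = p (e j q) j r")
        case True
        have "h j q \<sqsubseteq> p (osuc (e j q)) j r" "h j q \<lhd> p (osuc (e j q)) j r"
          using side[OF j True[symmetric]] qr by simp_all
        then show ?thesis using side_right p_below_h[OF osuc_leI[OF 1] j] by blast
      qed (use via 1 in simp)
    next
      case 2
      show ?thesis
      proof (cases "p (e j r) j q = p (e j r) j r")
        case True
        have "h j r \<sqsubseteq> p (osuc (e j r)) j q" "p (osuc (e j r)) j q \<lhd> h j r"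
          using side[OF j True] qr by (simp_all add: less_not_sym)
        then show ?thesis using side_left p_below_h[OF osuc_leI[OF 2] j] by blast
      qed (use via 2 in simp)
    qed
  qed
  \<comment> \<open>The raised step bounds \<open>e i (h i q)\<close> by the level index reached
    after its stage. This index is at most the level of any point placed later, and levels are
    bounded by indices and these by values of \<open>e\<close>.\<close>
  have e_order: "e i (h i q) < e j (h j r)" if i: "i \<le> d" and j: "j \<le> d" and lt: "e i q < e j r" for i j q r
  proof -
    have "e i (h i q) < L (osuc (e i q))" using h[OF i] by (simp add: L_def)
    also have "\<dots> \<le> L (e j r)" by (rule L_mono[OF osuc_leI[OF lt]])
    also have "\<dots> \<le> a (L (e j r))" by (rule strict_mono_ge[OF a])
    also have "\<dots> = lev (p (e j r) j r)" using valid[of "e j r"] j by (simp add: valid_def p_def L_def)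
    also have "\<dots> \<le> lev (h j r)" by (rule lev_mono[OF p_h[OF j]])
    also have "\<dots> \<le> h j r" by (rule lev_le)
    also have "\<dots> \<le> e j (h j r)" by (rule e_ge[OF j])
    finally show ?thesis .
  qed
  have colour: "f (\<lambda>j\<in>{..d}. h j (x j)) = c"
    if x: "\<forall>i<d. e i (x i) < e (Suc i) (x (Suc i))" for x
  proof -
    define X where "X j = h j (x j)" for j
    define E where "E j = e j (x j)" for j
    define U where "U \<nu> = (\<lambda>j\<in>{..<d}. p \<nu> (Suc j) (x (Suc j)))" for \<nu>
    have U: "U \<nu> \<in> tup d Y a (L \<nu>)" for \<nu>
      unfolding U_def
    proof (rule tupI)
      fix j assume "j < d"
      then have "p \<nu> (Suc j) q \<in> nodes Y (Suc j) \<and> lev (p \<nu> (Suc j) q) = a (L \<nu>)" for q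
        using valid[of \<nu>] by (simp add: valid_def p_def L_def)
      then show "p \<nu> (Suc j) (x (Suc j)) \<in> Y j \<and> lev (p \<nu> (Suc j) (x (Suc j))) = a (L \<nu>)"
        by (simp add: nodes_def)
    qed
    have E_mono: "E i < E j" if "i < j" "j \<le> d" for i j
      using that
    proof (induction j)
      case (Suc j)
      then have "E j < E (Suc j)" using x by (simp add: E_def)
      then show ?case using Suc less_trans by (cases "i = j") auto
    qed simp
    have lev_X: "lev (X m) \<le> a (L \<nu>)" if m: "m \<le> d" "E m < \<nu>" for m \<nu>
    proof -
      obtain \<xi> where \<xi>: "lev (X m) \<le> a \<xi>" "osuc \<xi> \<le> L (osuc (E m))"
        using lev_h[OF m(1), of "x m"] by (auto simp: X_def E_def)
      then have "\<xi> \<le> L \<nu>" using L_mono[OF osuc_leI[OF m(2)]] by (simp add: osuc_le_iff)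
      then show ?thesis using \<xi>(1) strict_mono_less_eq[OF a, of \<xi> "L \<nu>"] by simp
    qed
    \<comment> \<open>From stage \<open>osuc (E k)\<close> on, the nodes only move up, and already
      lie above all points placed by then, so the colour is frozen.\<close>
    have tail: "F k X (U \<nu>) = F k X (U (osuc (E k)))" if k: "k \<le> d" "E k < \<nu>" for k \<nu>
    proof -
      obtain \<xi>k where \<xi>k: "lev (X k) \<le> a \<xi>k" "osuc \<xi>k \<le> L (osuc (E k))"
        using lev_h[OF k(1), of "x k"] by (auto simp: X_def E_def)
      define \<xi> where "\<xi> = max \<xi>k (L (E k))"
      have "L (E k) < L (osuc (E k))" using L_less[OF osuc_greater] by (simp add: L_def)
      then have 1: "osuc \<xi> \<le> L (osuc (E k))" using \<xi>k(2) by (simp add: \<xi>_def osuc_le_iff)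
      have 2: "L (osuc (E k)) \<le> L \<nu>" by (rule L_mono[OF osuc_leI[OF k(2)]])
      show ?thesis
      proof (rule tail_system_tail[OF sys _ k(1)])
        show "lev (X m) \<le> a \<xi>" if "m \<le> k" for m
        proof (cases "m = k")
          case True
          then show ?thesis
            using \<xi>k(1) strict_mono_less_eq[OF a, of \<xi>k \<xi>] by (simp add: \<xi>_def)
        next
          case False
          then have "lev (X m) \<le> a (L (E k))" using lev_X[of m "E k"] E_mono[of m k] that k by simp
          then show ?thesis
            using strict_mono_less_eq[OF a, of "L (E k)" \<xi>] by (simp add: \<xi>_def)
        qed
        show "osuc \<xi> \<le> L \<nu>" "osuc \<xi> \<le> L (osuc (E k))" using 1 2 by simp_all
        show "U \<nu> \<in> tup d Y a (L \<nu>)" "U (osuc (E k)) \<in> tup d Y a (L (osuc (E k)))" by (rule U)+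
        fix j assume j: "j < d"
        have "U (osuc (E k)) j \<sqsubseteq> U \<nu> j"
          using p_mono[OF osuc_leI[OF k(2)], of "Suc j"] j by (simp add: U_def)
        moreover have "a (osuc \<xi>) \<le> lev (U (osuc (E k)) j)"
          using tupD[OF U j] 1 strict_mono_less_eq[OF a] by simp
        ultimately show "rs (U \<nu> j) (a (osuc \<xi>)) = rs (U (osuc (E k)) j) (a (osuc \<xi>))"
          using rs_tle_eq by simp
      qed simp
    qed
    \<comment> \<open>Coordinate 0 gets colour \<open>c\<close> when it is placed. The colour stays
      frozen until the next coordinate of the tuple is placed, and that step hands it on.\<close>
    have main: "\<forall>\<nu>>E k. F k X (U \<nu>) = c" if "k \<le> d" for k
      using that
    proof (induction k)
      case 0
      let ?u = "U (osuc (E 0))"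
      have r: "restrict X {..0} = restrict (\<lambda>_. h 0 (x 0)) {..0::nat}"
        by (rule restrict_ext) (simp add: X_def)
      have "F 0 X ?u = F 0 (restrict X {..0}) ?u" by (rule tail_system_restrict[OF sys]) simp_all
      also have "\<dots> = F 0 (\<lambda>_. h 0 (x 0)) ?u"
        unfolding r by (rule tail_system_restrict[OF sys, symmetric]) simp_all
      also have "\<dots> = c"
        using stepD(7)[OF step[of 0 "x 0"], of x] by (simp add: U_def p_def E_def)
      finally have "F 0 X ?u = c" .
      then show ?case using trans[OF tail[of 0]] by blast
    next
      case (Suc i)
      have "F (Suc i) (X(Suc i := h (Suc i) (x (Suc i)))) (U (osuc (E (Suc i)))) = F i X (U (E (Suc i)))"
      proof -
        have "lev (X m) \<le> a (L (E (Suc i)))" if "m \<le> i" for m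
          using lev_X[of m "E (Suc i)"] E_mono[of m "Suc i"] that Suc.prems by simp
        then show ?thesis
          using stepD(7)[OF step[of "Suc i" "x (Suc i)"], of x] Suc.prems
          by (simp add: U_def p_def E_def L_def)
      qed
      moreover have "X(Suc i := h (Suc i) (x (Suc i))) = X" by (simp add: X_def fun_upd_idem)
      moreover have "F i X (U (E (Suc i))) = c"
        using Suc E_mono[of i "Suc i"] by simp
      ultimately have "F (Suc i) X (U (osuc (E (Suc i)))) = c" by simp
      then show ?case using trans[OF tail[of "Suc i"]] Suc.prems by blast
    qed
    have "F d X (U (osuc (E d))) = c" using main[of d] by simp
    moreover have "restrict X {..d} = (\<lambda>j\<in>{..d}. h j (x j))" by (rule restrict_ext) (simp add: X_def)
    ultimately show ?thesis using tail_system_top[OF sys, of X "U (osuc (E d))"] by simp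
  qed
  show ?thesis
  proof (rule exI[of _ h], rule exI[of _ c], intro conjI allI impI)
    show "h j q \<lhd> h j r" if "j \<le> d" "q \<lhd> r" for j q r by (rule order[OF that])
    show "e i (h i q) < e j (h j r)" if "i \<le> d" "j \<le> d" "e i q < e j r" for i j q r
      by (rule e_order[OF that])
    show "f (\<lambda>j\<in>{..d}. h j (x j)) = c" if "\<forall>i<d. e i (x i) < e (Suc i) (x (Suc i))" for x
      by (rule colour[OF that])
  qed
qed

end

section \<open>All orders of the coordinates at once\<close>

lemma sorting_permutation:
  fixes v :: "nat \<Rightarrow> 'a::linorder"
  assumes "inj_on v {..d}"
  shows "\<exists>\<pi>. \<pi> permutes {..d} \<and> (\<forall>i<d. v (\<pi> i) < v (\<pi> (Suc i)))"
proof -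
  define xs where "xs = sort_key v [0..<Suc d]"
  have set: "set xs = {..d}" and dist: "distinct xs" and len: "length xs = Suc d"
    by (auto simp: xs_def)
  define \<pi> where "\<pi> i = (if i \<le> d then xs ! i else i)" for i
  have "bij_betw \<pi> {..d} {..d}"
  proof -
    have "bij_betw (\<lambda>i. xs ! i) {..<length xs} (set xs)" by (rule bij_betw_nth[OF dist]) auto
    then show ?thesis unfolding len set lessThan_Suc_atMost
      by (rule bij_betw_cong[THEN iffD1, rotated]) (simp add: \<pi>_def)
  qed
  then have "\<pi> permutes {..d}"
    by (rule bij_imp_permutes) (simp add: \<pi>_def)
  moreover have "v (\<pi> i) < v (\<pi> (Suc i))" if i: "i < d" for i
  proof -
    have "sorted (map v xs)" by (simp add: xs_def)
    then have "v (xs ! i) \<le> v (xs ! Suc i)"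
      using sorted_nth_mono[of "map v xs" i "Suc i"] i len by simp
    moreover have "v (xs ! i) \<noteq> v (xs ! Suc i)"
    proof
      assume "v (xs ! i) = v (xs ! Suc i)"
      moreover have "xs ! i \<in> {..d}" "xs ! Suc i \<in> {..d}"
        unfolding set[symmetric] using i len by (simp_all del: set)
      ultimately have "xs ! i = xs ! Suc i" using assms by (auto dest: inj_onD)
      then show False using nth_eq_iff_index_eq[OF dist, of i "Suc i"] i len by simp
    qed
    ultimately show ?thesis using i by (simp add: \<pi>_def)
  qed
  ultimately show ?thesis by blast
qed

context treap
begin

text \<open>Number the coordinates in the order prescribed by \<pi>, apply the increasing case to
  the relabelled enumeration, and transport the embeddings back along the inverse of \<pi>.\<close>

lemma monochromatic_embedding_permuted:
  fixes f :: "(nat \<Rightarrow> 'k) \<Rightarrow> 'k" and e :: "nat \<Rightarrow> 'k \<Rightarrow> 'k"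
  assumes HL: "HL_tc TYPE('k) d" and f: "\<And>x. f x < \<delta>"
    and e: "\<And>i j q r. i \<le> d \<Longrightarrow> j \<le> d \<Longrightarrow> e i q = e j r \<Longrightarrow> i = j \<and> q = r"
    and e_ge: "\<And>j y. j \<le> d \<Longrightarrow> y \<le> e j y"
    and \<pi>: "\<pi> permutes {..d}"
  shows "\<exists>h c. (\<forall>j\<le>d. \<forall>q r. q \<lhd> r \<longrightarrow> h j q \<lhd> h j r) \<and>
    (\<forall>i\<le>d. \<forall>j\<le>d. \<forall>q r. e i q < e j r \<longrightarrow> e i (h i q) < e j (h j r)) \<and>
    (\<forall>x. (\<forall>i<d. e (\<pi> i) (x (\<pi> i)) < e (\<pi> (Suc i)) (x (\<pi> (Suc i)))) \<longrightarrow>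
      f (\<lambda>j\<in>{..d}. h j (x j)) = c)"
proof -
  let ?\<rho> = "inv \<pi>"
  have \<rho>: "?\<rho> permutes {..d}" by (rule permutes_inv[OF \<pi>])
  have mem: "\<pi> j \<le> d" "?\<rho> j \<le> d" if "j \<le> d" for j
    using permutes_in_image[OF \<pi>, of j] permutes_in_image[OF \<rho>, of j] that by simp_all
  define f' where "f' y = f (\<lambda>j\<in>{..d}. y (?\<rho> j))" for y
  have "\<exists>h c. (\<forall>j\<le>d. \<forall>q r. q \<lhd> r \<longrightarrow> h j q \<lhd> h j r) \<and>
    (\<forall>i\<le>d. \<forall>j\<le>d. \<forall>q r. e (\<pi> i) q < e (\<pi> j) r \<longrightarrow> e (\<pi> i) (h i q) < e (\<pi> j) (h j r)) \<and>
    (\<forall>x. (\<forall>i<d. e (\<pi> i) (x i) < e (\<pi> (Suc i)) (x (Suc i))) \<longrightarrow> f' (\<lambda>j\<in>{..d}. h j (x j)) = c)"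
  proof (rule monochromatic_embedding[OF HL])
    show "f' x < \<delta>" for x by (simp add: f'_def f)
    fix i j q r assume "i \<le> d" "j \<le> d" "e (\<pi> i) q = e (\<pi> j) r"
    then have "\<pi> i = \<pi> j \<and> q = r" using e[OF mem(1) mem(1)] by blast
    then show "i = j \<and> q = r" using permutes_inj[OF \<pi>] by (auto dest: injD)
  next
    show "y \<le> e (\<pi> j) y" if "j \<le> d" for j y by (rule e_ge[OF mem(1)[OF that]])
  qed
  then obtain h c where hc: "(\<forall>j\<le>d. \<forall>q r. q \<lhd> r \<longrightarrow> h j q \<lhd> h j r) \<and>
    (\<forall>i\<le>d. \<forall>j\<le>d. \<forall>q r. e (\<pi> i) q < e (\<pi> j) r \<longrightarrow> e (\<pi> i) (h i q) < e (\<pi> j) (h j r)) \<and>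
    (\<forall>x. (\<forall>i<d. e (\<pi> i) (x i) < e (\<pi> (Suc i)) (x (Suc i))) \<longrightarrow> f' (\<lambda>j\<in>{..d}. h j (x j)) = c)"
    by (elim exE) (rule that)
  note h = hc[THEN conjunct1, rule_format] and hc2 = hc[THEN conjunct2]
  note h_e = hc2[THEN conjunct1, rule_format] and col = hc2[THEN conjunct2, THEN spec, THEN mp]
  have "f (\<lambda>j\<in>{..d}. h (?\<rho> j) (x j)) = c"
    if "\<forall>i<d. e (\<pi> i) (x (\<pi> i)) < e (\<pi> (Suc i)) (x (\<pi> (Suc i)))" for x
  proof -
    have "f' (\<lambda>j\<in>{..d}. h j (x (\<pi> j))) = c" by (rule col[OF that])
    moreover have "(\<lambda>j\<in>{..d}. (\<lambda>j\<in>{..d}. h j (x (\<pi> j))) (?\<rho> j)) = (\<lambda>j\<in>{..d}. h (?\<rho> j) (x j))"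
      by (rule restrict_ext) (use mem in \<open>simp add: permutes_inverses[OF \<pi>]\<close>)
    ultimately show ?thesis by (simp add: f'_def)
  qed
  moreover have "h (?\<rho> j) q \<lhd> h (?\<rho> j) r" if "j \<le> d" "q \<lhd> r" for j q r
    by (rule h[OF mem(2)[OF that(1)] that(2)])
  moreover have "e i (h (?\<rho> i) q) < e j (h (?\<rho> j) r)" if "i \<le> d" "j \<le> d" "e i q < e j r" for i j q r
    using h_e[OF mem(2)[OF that(1)] mem(2)[OF that(2)], of q r] that(3)
    by (simp add: permutes_inverses[OF \<pi>])
  ultimately show ?thesis by (intro exI[of _ "\<lambda>j. h (?\<rho> j)"] exI[of _ c]) simp
qed

text \<open>For a new order, apply the previous lemma to the colouring pulled back along the
  embedding found so far, and compose. Orders treated earlier keep their colours because the new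
  embedding does not change the order of a tuple under \<open>e\<close>.\<close>

lemma simultaneous_embedding:
  fixes f :: "(nat \<Rightarrow> 'k) \<Rightarrow> 'k" and e :: "nat \<Rightarrow> 'k \<Rightarrow> 'k"
  assumes HL: "HL_tc TYPE('k) d" and f: "\<And>x. f x < \<delta>"
    and e: "\<And>i j q r. i \<le> d \<Longrightarrow> j \<le> d \<Longrightarrow> e i q = e j r \<Longrightarrow> i = j \<and> q = r"
    and e_ge: "\<And>j y. j \<le> d \<Longrightarrow> y \<le> e j y"
    and P: "finite P" "\<And>\<pi>. \<pi> \<in> P \<Longrightarrow> \<pi> permutes {..d}"
  shows "\<exists>h col. (\<forall>j\<le>d. \<forall>q r. q \<lhd> r \<longrightarrow> h j q \<lhd> h j r) \<and>
    (\<forall>i\<le>d. \<forall>j\<le>d. \<forall>q r. e i q < e j r \<longrightarrow> e i (h i q) < e j (h j r)) \<and>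
    (\<forall>\<pi>\<in>P. \<forall>x. (\<forall>i<d. e (\<pi> i) (x (\<pi> i)) < e (\<pi> (Suc i)) (x (\<pi> (Suc i)))) \<longrightarrow>
      f (\<lambda>j\<in>{..d}. h j (x j)) = col \<pi>)"
  using P
proof (induction P rule: finite_induct)
  case empty
  show ?case by (intro exI[of _ "\<lambda>j q. q"]) simp
next
  case (insert \<pi> P)
  have "\<exists>h col. (\<forall>j\<le>d. \<forall>q r. q \<lhd> r \<longrightarrow> h j q \<lhd> h j r) \<and>
    (\<forall>i\<le>d. \<forall>j\<le>d. \<forall>q r. e i q < e j r \<longrightarrow> e i (h i q) < e j (h j r)) \<and>
    (\<forall>\<pi>\<in>P. \<forall>x. (\<forall>i<d. e (\<pi> i) (x (\<pi> i)) < e (\<pi> (Suc i)) (x (\<pi> (Suc i)))) \<longrightarrow>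
      f (\<lambda>j\<in>{..d}. h j (x j)) = col \<pi>)"
    by (rule insert.IH) (simp add: insert.prems)
  then obtain h col where hc: "(\<forall>j\<le>d. \<forall>q r. q \<lhd> r \<longrightarrow> h j q \<lhd> h j r) \<and>
    (\<forall>i\<le>d. \<forall>j\<le>d. \<forall>q r. e i q < e j r \<longrightarrow> e i (h i q) < e j (h j r)) \<and>
    (\<forall>\<pi>\<in>P. \<forall>x. (\<forall>i<d. e (\<pi> i) (x (\<pi> i)) < e (\<pi> (Suc i)) (x (\<pi> (Suc i)))) \<longrightarrow>
      f (\<lambda>j\<in>{..d}. h j (x j)) = col \<pi>)"
    by (elim exE) (rule that)
  note h = hc[THEN conjunct1, rule_format] and hc2 = hc[THEN conjunct2]
  note h_e = hc2[THEN conjunct1, rule_format] and col = hc2[THEN conjunct2, THEN bspec, THEN spec, THEN mp]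
  have \<pi>: "\<pi> permutes {..d}" using insert.prems by simp
  define f' where "f' y = f (\<lambda>j\<in>{..d}. h j (y j))" for y
  have "\<exists>h' c. (\<forall>j\<le>d. \<forall>q r. q \<lhd> r \<longrightarrow> h' j q \<lhd> h' j r) \<and>
    (\<forall>i\<le>d. \<forall>j\<le>d. \<forall>q r. e i q < e j r \<longrightarrow> e i (h' i q) < e j (h' j r)) \<and>
    (\<forall>x. (\<forall>i<d. e (\<pi> i) (x (\<pi> i)) < e (\<pi> (Suc i)) (x (\<pi> (Suc i)))) \<longrightarrow>
      f' (\<lambda>j\<in>{..d}. h' j (x j)) = c)"
    by (rule monochromatic_embedding_permuted[OF HL _ e e_ge \<pi>]) (unfold f'_def, rule f)
  then obtain h' c where hc': "(\<forall>j\<le>d. \<forall>q r. q \<lhd> r \<longrightarrow> h' j q \<lhd> h' j r) \<and>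
    (\<forall>i\<le>d. \<forall>j\<le>d. \<forall>q r. e i q < e j r \<longrightarrow> e i (h' i q) < e j (h' j r)) \<and>
    (\<forall>x. (\<forall>i<d. e (\<pi> i) (x (\<pi> i)) < e (\<pi> (Suc i)) (x (\<pi> (Suc i)))) \<longrightarrow>
      f' (\<lambda>j\<in>{..d}. h' j (x j)) = c)"
    by (elim exE) (rule that)
  note h' = hc'[THEN conjunct1, rule_format] and hc2' = hc'[THEN conjunct2]
  note h'_e = hc2'[THEN conjunct1, rule_format] and c = hc2'[THEN conjunct2, THEN spec, THEN mp]
  define H where "H j q = h j (h' j q)" for j q
  have f'H: "f' (\<lambda>j\<in>{..d}. h' j (x j)) = f (\<lambda>j\<in>{..d}. H j (x j))" for x
  proof -
    have "(\<lambda>j\<in>{..d}. h j ((\<lambda>j\<in>{..d}. h' j (x j)) j)) = (\<lambda>j\<in>{..d}. H j (x j))"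
      by (rule restrict_ext) (simp add: H_def)
    then show ?thesis by (simp add: f'_def)
  qed
  show ?case
  proof (rule exI[of _ H], rule exI[of _ "col(\<pi> := c)"], intro conjI allI impI ballI)
    show "H j q \<lhd> H j r" if "j \<le> d" "q \<lhd> r" for j q r
      unfolding H_def by (rule h[OF that(1) h'[OF that]])
    show "e i (H i q) < e j (H j r)" if "i \<le> d" "j \<le> d" "e i q < e j r" for i j q r
      unfolding H_def by (rule h_e[OF that(1,2) h'_e[OF that]])
    fix \<sigma> x assume \<sigma>: "\<sigma> \<in> insert \<pi> P"
      and x: "\<forall>i<d. e (\<sigma> i) (x (\<sigma> i)) < e (\<sigma> (Suc i)) (x (\<sigma> (Suc i)))"
    show "f (\<lambda>j\<in>{..d}. H j (x j)) = (col(\<pi> := c)) \<sigma>"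
    proof (cases "\<sigma> = \<pi>")
      case True
      then show ?thesis using c[of x] x f'H[of x] by simp
    next
      case False
      then have \<sigma>P: "\<sigma> \<in> P" using \<sigma> by simp
      have mem: "\<sigma> i \<le> d" if "i \<le> d" for i
        using permutes_in_image[of \<sigma> "{..d}" i] insert.prems[OF \<sigma>] that by simp
      have "\<forall>i<d. e (\<sigma> i) (h' (\<sigma> i) (x (\<sigma> i))) < e (\<sigma> (Suc i)) (h' (\<sigma> (Suc i)) (x (\<sigma> (Suc i))))"
        using h'_e[OF mem mem] x by simp
      from col[OF \<sigma>P this] show ?thesis using False by (simp add: H_def)
    qed
  qed
qed

text \<open>Point \<open>y\<close> of coordinate \<open>j\<close> gets the successor number
  \<open>j\<close> of \<open>b y\<close>, and \<open>b\<close> grows so fast that the blocks of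
  \<open>d + 1\<close> ordinals belonging to different points are disjoint.\<close>

lemma progressive_enumeration:
  "\<exists>e :: nat \<Rightarrow> 'k \<Rightarrow> 'k. (\<forall>i j q r. i \<le> d \<longrightarrow> j \<le> d \<longrightarrow> e i q = e j r \<longrightarrow> i = j \<and> q = r) \<and>
    (\<forall>j y. y \<le> e j y)"
proof -
  define s where "s j x = (osuc ^^ j) x" for j and x :: 'k
  have s_le: "s i x \<le> s j x" if "i \<le> j" for i j x
    using that
  proof (induction j rule: dec_induct)
    case (step n)
    have "s i x \<le> s n x" by (rule step)
    also have "\<dots> \<le> s (Suc n) x" using osuc_greater[of "s n x"] by (simp add: s_def less_imp_le)
    finally show ?case .
  qed simp
  obtain b :: "'k \<Rightarrow> 'k" where b: "strict_mono b" and grow: "\<And>\<xi>. osuc (s d (b \<xi>)) \<le> b (osuc \<xi>)"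
    using normal_function[of "\<lambda>\<beta>. osuc (s d \<beta>)"] by blast
  have less: "s i (b q) < s j (b r)" if "i \<le> d" "q < r" for i j q r
  proof -
    have "s i (b q) \<le> s d (b q)" by (rule s_le[OF that(1)])
    also have "s d (b q) < osuc (s d (b q))" by (rule osuc_greater)
    also have "\<dots> \<le> b (osuc q)" by (rule grow)
    also have "\<dots> \<le> b r" using osuc_leI[OF that(2)] strict_mono_less_eq[OF b] by simp
    also have "\<dots> \<le> s j (b r)" using s_le[of 0 j "b r"] by (simp add: s_def)
    finally show ?thesis .
  qed
  have strict: "s i x < s j x" if "i < j" for i j x
  proof -
    have "s i x < s (Suc i) x" using osuc_greater[of "s i x"] by (simp add: s_def)
    also have "\<dots> \<le> s j x" by (rule s_le) (use that in simp)
    finally show ?thesis .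
  qed
  have "i = j \<and> q = r" if ij: "i \<le> d" "j \<le> d" and eq: "s i (b q) = s j (b r)" for i j q r
  proof -
    have "q = r" using less[OF ij(1), of q r j] less[OF ij(2), of r q i] eq
      by (metis less_irrefl less_linear)
    moreover have "i = j" using strict[of i j "b r"] strict[of j i "b r"] eq \<open>q = r\<close>
      by (metis less_irrefl less_linear)
    ultimately show ?thesis by simp
  qed
  moreover have "y \<le> s j (b y)" for j y
    using s_le[of 0 j "b y"] strict_mono_ge[OF b, of y] by (simp add: s_def)
  ultimately show ?thesis by (intro exI[of _ "\<lambda>j y. s j (b y)"]) blast
qed

end

theorem theorem4p3:
  fixes d :: nat
    and Q :: "'q::linorder set"
    and \<delta> :: "'k::wellorder"
    and f :: "(nat \<Rightarrow> 'q) \<Rightarrow> 'k"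
  assumes "strongly_inaccessible (kappa :: 'k rel)"
    and "HL_tc TYPE('k) d"
    and "is_Q_kappa (kappa :: 'k rel) Q"
    and "f \<in> (\<Pi>\<^sub>E j\<in>{..d}. Q) \<rightarrow> {..<\<delta>}"
  shows "\<exists>X :: nat \<Rightarrow> 'q set.
           (\<forall>j\<le>d. X j \<subseteq> Q \<and> same_order_type Q (X j)) \<and>
           finite (f ` (\<Pi>\<^sub>E j\<in>{..d}. X j)) \<and>
           card (f ` (\<Pi>\<^sub>E j\<in>{..d}. X j)) \<le> fact (d + 1)"
proof -
  have card: "Card_order (kappa :: 'k rel)" using assms(1) by (simp add: strongly_inaccessible_def)
  have "|Q| =o (kappa :: 'k rel)" using assms(3) by (simp add: is_Q_kappa_def)
  then have "|Field (kappa :: 'k rel)| =o |Q|"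
    by (rule ordIso_transitive[OF card_of_Field_ordIso[OF card] ordIso_symmetric])
  then obtain qq :: "'k \<Rightarrow> 'q" where "bij_betw qq UNIV Q"
    unfolding Field_kappa card_of_ordIso[symmetric] by (rule exE)
  then have inj: "inj qq" and range: "range qq = Q" by (auto simp: bij_betw_def)
  interpret treap "kappa :: 'k rel" qq
    by unfold_locales (use assms(1,3) inj range in \<open>simp_all add: is_Q_kappa_def\<close>)
  obtain e :: "nat \<Rightarrow> 'k \<Rightarrow> 'k" where
    e: "\<And>i j q r. i \<le> d \<Longrightarrow> j \<le> d \<Longrightarrow> e i q = e j r \<Longrightarrow> i = j \<and> q = r" and e_ge: "\<And>j y. y \<le> e j y"
    using progressive_enumeration[of d] by metis
  define f' where "f' x = f (\<lambda>j\<in>{..d}. qq (x j))" for x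
  define P where "P = {\<pi>. \<pi> permutes {..d}}"
  have P: "finite P" "card P = fact (d + 1)"
    unfolding P_def by (simp_all add: finite_permutations card_permutations[OF refl])
  have "\<exists>h col. (\<forall>j\<le>d. \<forall>q r. qq q < qq r \<longrightarrow> qq (h j q) < qq (h j r)) \<and>
    (\<forall>i\<le>d. \<forall>j\<le>d. \<forall>q r. e i q < e j r \<longrightarrow> e i (h i q) < e j (h j r)) \<and>
    (\<forall>\<pi>\<in>P. \<forall>x. (\<forall>i<d. e (\<pi> i) (x (\<pi> i)) < e (\<pi> (Suc i)) (x (\<pi> (Suc i)))) \<longrightarrow>
      f' (\<lambda>j\<in>{..d}. h j (x j)) = col \<pi>)"
  proof (rule simultaneous_embedding[OF assms(2) _ e e_ge P(1)])
    show "f' x < \<delta>" for x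
    proof -
      have "(\<lambda>j\<in>{..d}. qq (x j)) \<in> (\<Pi>\<^sub>E j\<in>{..d}. Q)" using range by auto
      from funcset_mem[OF assms(4) this] show ?thesis by (simp add: f'_def)
    qed
    show "\<pi> permutes {..d}" if "\<pi> \<in> P" for \<pi> using that by (simp add: P_def)
  qed
  then obtain h col where hc: "(\<forall>j\<le>d. \<forall>q r. qq q < qq r \<longrightarrow> qq (h j q) < qq (h j r)) \<and>
    (\<forall>i\<le>d. \<forall>j\<le>d. \<forall>q r. e i q < e j r \<longrightarrow> e i (h i q) < e j (h j r)) \<and>
    (\<forall>\<pi>\<in>P. \<forall>x. (\<forall>i<d. e (\<pi> i) (x (\<pi> i)) < e (\<pi> (Suc i)) (x (\<pi> (Suc i)))) \<longrightarrow>
      f' (\<lambda>j\<in>{..d}. h j (x j)) = col \<pi>)"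
    by (elim exE) (rule that)
  note h = hc[THEN conjunct1, rule_format]
    and col = hc[THEN conjunct2, THEN conjunct2, THEN bspec, THEN spec, THEN mp]
  define X where "X j = range (\<lambda>q. qq (h j q))" for j
  have sub: "f ` (\<Pi>\<^sub>E j\<in>{..d}. X j) \<subseteq> col ` P"
  proof (rule image_subsetI)
    fix y assume y: "y \<in> (\<Pi>\<^sub>E j\<in>{..d}. X j)"
    then have "\<forall>j\<in>{..d}. \<exists>q. y j = qq (h j q)" by (auto simp: X_def PiE_iff)
    from bchoice[OF this] obtain x where x: "\<forall>j\<in>{..d}. y j = qq (h j (x j))" by (rule exE)
    \<comment> \<open>Distinct coordinates never tie under \<open>e\<close>, even when they carry
      the same point, so every tuple of the product has a strict order and is covered by some
      permutation.\<close>
    have "inj_on (\<lambda>j. e j (x j)) {..d}"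
    proof (rule inj_onI)
      fix i j assume "i \<in> {..d}" "j \<in> {..d}" "e i (x i) = e j (x j)"
      then show "i = j" using e[of i j "x i" "x j"] by simp
    qed
    then obtain \<pi> where \<pi>: "\<pi> permutes {..d}"
      and inc: "\<forall>i<d. e (\<pi> i) (x (\<pi> i)) < e (\<pi> (Suc i)) (x (\<pi> (Suc i)))"
      using sorting_permutation[of "\<lambda>j. e j (x j)" d] by blast
    have "f' (\<lambda>j\<in>{..d}. h j (x j)) = col \<pi>" by (rule col) (use \<pi> inc in \<open>simp_all add: P_def\<close>)
    moreover have "(\<lambda>j\<in>{..d}. qq ((\<lambda>j\<in>{..d}. h j (x j)) j)) = y"
    proof (rule PiE_ext[OF _ y])
      show "(\<lambda>j\<in>{..d}. qq ((\<lambda>j\<in>{..d}. h j (x j)) j)) \<in> (\<Pi>\<^sub>E j\<in>{..d}. X j)"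
        by (simp add: X_def)
    qed (use x in simp)
    ultimately show "f y \<in> col ` P" using \<pi> by (simp add: f'_def P_def)
  qed
  have "same_order_type Q (X j)" if "j \<le> d" for j
    unfolding same_order_type_def
  proof (intro exI conjI)
    let ?H = "\<lambda>t. qq (h j (inv qq t))"
    show "strict_mono_on Q ?H"
      unfolding range[symmetric]
      by (rule strict_mono_onI) (use h[OF that] inj in auto)
    show "?H ` Q = X j" unfolding range[symmetric] X_def image_image using inj by simp
  qed
  moreover have "X j \<subseteq> Q" for j using range by (auto simp: X_def)
  moreover have "finite (f ` (\<Pi>\<^sub>E j\<in>{..d}. X j))" using finite_subset[OF sub] P(1) by simp
  moreover have "card (f ` (\<Pi>\<^sub>E j\<in>{..d}. X j)) \<le> fact (d + 1)"
    using card_mono[OF finite_imageI[OF P(1)] sub] card_image_le[OF P(1), of col] P(2) by simp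
  ultimately show ?thesis by blast
qed

end
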